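(* Let $X,X_1,X_2,\ldots$ be identically distributed real-valued random variables with common distribution $F\in\mathcal{D}\cap\mathcal{L}$, and let $\Theta,\Theta_1,\Theta_2,\ldots$ be non-negative, identically distributed random variables, non-degenerate at zero, such that all the products $\Theta_iX_i$ have the same distribution as $\Theta X$. Let $N$ be a random variable with values in $\{0,1,2,\ldots\}$, non-degenerate at zero, with $\mathbf{P}[N>r_N]=0$ for some integer $r_N\ge2$, and independent of the sequences $(X_i)$ and $(\Theta_i)$ (jointly). Put $n=r_N$ and suppose that: (i) there exists a function $b:[0,\infty)\to(0,\infty)$ such that $b(x)\to\infty$ and $b(x)/x\to 0$ as $x\to\infty$, and, for all $1\le i\ne j\le n$, $$\mathbf{P}[\Theta_i>b(x_i)]=o\big(\mathbf{P}[\Theta_iX_i>x_i,\ \Theta_jX_j>x_j]\big)\quad\text{as } x_i\wedge x_j\to\infty;$$ (ii) there exists a function $h:[0,\infty)\to(0,\infty)$ such that, for each $i=1,\ldots,n$, $$\mathbf{P}[X_i>x\mid\Theta_i=\theta]\sim h(\theta)\,\mathbf{P}[X_i>x]\quad\text{as }x\to\infty,\ \text{uniformly for }\theta\in s_{\Theta};$$ (iii) there exist a measurable function $g:[0,\infty)^2\to(0,\infty)$ and constants $0<L\le U<\infty$ such that, for all $1\le i\neq j\le n$, as $x_i\wedge x_j\to\infty$, uniformly for $(\theta_i,\theta_j)\in s_{\Theta}\times s_{\Theta}$, $$\mathbf{P}[|X_i|>x_i,\ X_j>x_j\mid\Theta_i=\theta_i,\Theta_j=\theta_j]\sim g(\theta_i,\theta_j)\,\mathbf{P}[|X_i|>x_i,\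 X_j>x_j]$$ and $$L\,g(\theta_i,\theta_j)\mathbf{P}[X_i>x_i,X_j>x_j]\lesssim \mathbf{P}[X_i>x_i,X_j>x_j\mid\Theta_i=\theta_i,\Theta_j=\theta_j]\lesssim U\,g(\theta_i,\theta_j)\mathbf{P}[X_i>x_i,X_j>x_j].$$ Then: (1) If $X_1,\ldots,X_n$ are pTAI, then, as $x\to\infty$, $$\mathbf{P}[S_N^{\Theta}>x]\sim\mathbf{P}[S_{(N)}^{\Theta}>x]\sim\mathbf{P}[X_{(N)}^{\Theta}>x]\sim\mathbf{E}[N]\,\mathbf{P}[\Theta X>x],$$ and the distributions of $S_N^{\Theta}$, $S_{(N)}^{\Theta}$ and $X_{(N)}^{\Theta}$ belong to $\mathcal{D}\cap\mathcal{L}$. (2) If $X_1,\ldots,X_n$ are pQAI and $F\in\mathcal{C}$, then, as $x\to\infty$, $$\mathbf{P}[S_N^{\Theta}>x]\sim\mathbf{P}[S_{(N)}^{\Theta}>x]\sim\mathbf{E}[N]\,\mathbf{P}[\Theta X>x],$$ and the distributions of $S_N^{\Theta}$ and $S_{(N)}^{\Theta}$ belong to $\mathcal{C}$.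
   Context: Randomly stopped quantities: with $S_k^{\Theta}=\sum_{i=1}^k\Theta_iX_i$, put $S_N^{\Theta}=\sum_{i=1}^N\Theta_iX_i$ (equal to $0$ if $N=0$); $X_{(N)}^{\Theta}=0$ if $N=0$ and $X_{(N)}^{\Theta}=\max_{1\le i\le N}\Theta_iX_i$ if $N\ge1$; $S_{(N)}^{\Theta}=0$ if $N=0$ and $S_{(N)}^{\Theta}=\max_{1\le k\le N}S_k^{\Theta}$ if $N\ge1$. For a distribution $F$, $\overline F(x)=1-F(x)$; throughout $\overline F(x)>0$ for all $x\ge0$ for the distribution $F$ of $X$. "Non-degenerate at zero" means not almost surely equal to $0$. $x\wedge y=\min\{x,y\}$, $x^+=\max\{x,0\}$, $x^-=-\min\{x,0\}$. $f=o(g)$ means $f/g\to0$; $f\sim g$ means $f/g\to1$; $f\lesssim g$ means $\limsup f/g\le1$. Uniformity of $\sim$ over $\theta$ means that the supremum over $\theta$ of $|f/g-1|$ tends to $0$; uniformity of $\lesssim$ means $\limsup$ of the supremum over $\theta$ of the ratio $f/g$ is $\le1$. Support: $s_{\Theta}=\{\theta\in\mathbb{R}:\mathbf{P}(\Theta\in[\theta-\delta,\theta+\delta])>0\text{ for any }\delta>0\}$. For an event $A$, $\mathbf{P}[A\mid\Theta_i=\theta_i,\Theta_j=\theta_j]$ is defined as $$\lim_{\delta\downarrow0}\frac{\mathbf{P}[A,\ \Theta_i\in[\theta_i-\delta,\theta_i+\delta],\ \Theta_j\in[\theta_j-\delta,\theta_j+\delta]]}{\mathbf{P}[\Theta_i\in[\theta_i-\delta,\theta_i+\delta],\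 \Theta_j\in[\theta_j-\delta,\theta_j+\delta]]},$$ and $\mathbf{P}[A\mid\Theta_i=\theta]$ is defined analogously with a single weight. Distribution classes: $F\in\mathcal{D}$ if $\limsup_{x\to\infty}\overline F(bx)/\overline F(x)<\infty$ for any (equivalently, some) $b\in(0,1)$; $F\in\mathcal{L}$ if $\lim_{x\to\infty}\overline F(x-a)/\overline F(x)=1$ for any (equivalently, some) $a>0$; $F\in\mathcal{C}$ if $\lim_{v\uparrow1}\limsup_{x\to\infty}\overline F(vx)/\overline F(x)=1$. Real-valued random variables $Y_1,\ldots,Y_n$ are pTAI if for all $i\ne j$, $\lim_{x_i\wedge x_j\to\infty}\mathbf{P}[|Y_i|>x_i\mid Y_j>x_j]=0$. They are pQAI if for all $i\neq j$, $$\lim_{x\to\infty}\frac{\mathbf{P}[Y_i^+>x,\,Y_j^+>x]}{\mathbf{P}[Y_i>x]+\mathbf{P}[Y_j>x]}=\lim_{x\to\infty}\frac{\mathbf{P}[Y_i^->x,\,Y_j>x]}{\mathbf{P}[Y_i>x]+\mathbf{P}[Y_j>x]}=0.$$ *)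

theory Defs
  imports "HOL-Probability.Probability" "HOL-Library.Landau_Symbols"
begin

definition tail :: "real measure \<Rightarrow> real \<Rightarrow> real"
  where "tail F x = 1 - cdf F x"

text \<open>The three classes are considered only for distributions with positive tail, so that the
  quotients are meaningful (in HOL a quotient with denominator zero is zero, and a distribution
  bounded above would otherwise be dominatedly varying).\<close>

definition pos_tail :: "real measure \<Rightarrow> bool"
  where "pos_tail F \<longleftrightarrow> real_distribution F \<and> (\<forall>x\<ge>0. tail F x > 0)"

definition class_D :: "real measure set"
  where "class_D = {F. pos_tail F \<and>
    (\<forall>b. 0 < b \<and> b < 1 \<longrightarrow> Limsup at_top (\<lambda>x. ereal (tail F (b * x) / tail F x)) < \<infinity>)}"

definition class_L :: "real measure set"
  where "class_L = {F. pos_tail F \<and>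
    (\<forall>a>0. ((\<lambda>x. tail F (x - a) / tail F x) \<longlongrightarrow> 1) at_top)}"

definition class_C :: "real measure set"
  where "class_C = {F. pos_tail F \<and>
    ((\<lambda>v. Limsup at_top (\<lambda>x. ereal (tail F (v * x) / tail F x))) \<longlongrightarrow> 1) (at_left 1)}"

text \<open>The filter of pairs \<open>(x, y)\<close> with \<open>x \<and> y \<rightarrow> \<infinity>\<close>.\<close>

definition min_at_top :: "(real \<times> real) filter"
  where "min_at_top = filtercomap (\<lambda>(x, y). min x y) at_top"

definition uniform_equiv ::
    "'b filter \<Rightarrow> 'c set \<Rightarrow> ('b \<Rightarrow> 'c \<Rightarrow> real) \<Rightarrow> ('b \<Rightarrow> 'c \<Rightarrow> real) \<Rightarrow> bool"
  where "uniform_equiv F S f g \<longleftrightarrow>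
    uniform_limit S (\<lambda>x \<theta>. f x \<theta> / g x \<theta>) (\<lambda>_. 1) F"

text \<open>The quotient is taken in the extended reals, where \<open>c / 0 = \<infinity>\<close> for \<open>c > 0\<close>: a vanishing
  denominator does not make the relation hold when the numerator is positive.\<close>

definition uniform_lesssim ::
    "'b filter \<Rightarrow> 'c set \<Rightarrow> ('b \<Rightarrow> 'c \<Rightarrow> real) \<Rightarrow> ('b \<Rightarrow> 'c \<Rightarrow> real) \<Rightarrow> bool"
  where "uniform_lesssim F S f g \<longleftrightarrow>
    Limsup F (\<lambda>x. SUP \<theta>\<in>S. ereal (f x \<theta>) / ereal (g x \<theta>)) \<le> 1"

definition rv_support :: "'a measure \<Rightarrow> ('a \<Rightarrow> real) \<Rightarrow> real set"
  where "rv_support M T = {\<theta>. \<forall>\<delta>>0. \<P>(\<omega> in M. T \<omega> \<in> {\<theta> - \<delta>..\<theta> + \<delta>}) > 0}"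

text \<open>The conditional probabilities are limits of elementary conditional probabilities. A limit
  need not exist, in which case \<^const>\<open>Lim\<close> is an unspecified value; the predicates
  \<open>cond1_exists\<close> and \<open>cond2_exists\<close> state that it does.\<close>

definition cond1_approx ::
    "'a measure \<Rightarrow> ('a \<Rightarrow> bool) \<Rightarrow> ('a \<Rightarrow> real) \<Rightarrow> real \<Rightarrow> real \<Rightarrow> real"
  where "cond1_approx M A T \<theta> \<delta> = \<P>(\<omega> in M. A \<omega> \<bar> T \<omega> \<in> {\<theta> - \<delta>..\<theta> + \<delta>})"

definition cond1_exists :: "'a measure \<Rightarrow> ('a \<Rightarrow> bool) \<Rightarrow> ('a \<Rightarrow> real) \<Rightarrow> real \<Rightarrow> bool"
  where "cond1_exists M A T \<theta> \<longleftrightarrow> (\<exists>p. (cond1_approx M A T \<theta> \<longlongrightarrow> p) (at_right 0))"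

definition cond1 :: "'a measure \<Rightarrow> ('a \<Rightarrow> bool) \<Rightarrow> ('a \<Rightarrow> real) \<Rightarrow> real \<Rightarrow> real"
  where "cond1 M A T \<theta> = Lim (at_right 0) (cond1_approx M A T \<theta>)"

definition cond2_approx ::
    "'a measure \<Rightarrow> ('a \<Rightarrow> bool) \<Rightarrow> ('a \<Rightarrow> real) \<Rightarrow> ('a \<Rightarrow> real) \<Rightarrow> real \<times> real \<Rightarrow> real \<Rightarrow> real"
  where "cond2_approx M A T T' \<theta> \<delta> =
    \<P>(\<omega> in M. A \<omega> \<bar> T \<omega> \<in> {fst \<theta> - \<delta>..fst \<theta> + \<delta>} \<and> T' \<omega> \<in> {snd \<theta> - \<delta>..snd \<theta> + \<delta>})"

definition cond2_exists ::
    "'a measure \<Rightarrow> ('a \<Rightarrow> bool) \<Rightarrow> ('a \<Rightarrow> real) \<Rightarrow> ('a \<Rightarrow> real) \<Rightarrow> real \<times> real \<Rightarrow> bool"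
  where "cond2_exists M A T T' \<theta> \<longleftrightarrow> (\<exists>p. (cond2_approx M A T T' \<theta> \<longlongrightarrow> p) (at_right 0))"

definition cond2 ::
    "'a measure \<Rightarrow> ('a \<Rightarrow> bool) \<Rightarrow> ('a \<Rightarrow> real) \<Rightarrow> ('a \<Rightarrow> real) \<Rightarrow> real \<times> real \<Rightarrow> real"
  where "cond2 M A T T' \<theta> = Lim (at_right 0) (cond2_approx M A T T' \<theta>)"

definition pTAI :: "'a measure \<Rightarrow> nat \<Rightarrow> (nat \<Rightarrow> 'a \<Rightarrow> real) \<Rightarrow> bool"
  where "pTAI M n Y \<longleftrightarrow> (\<forall>i\<in>{1..n}. \<forall>j\<in>{1..n}. i \<noteq> j \<longrightarrow>
    ((\<lambda>(x, y). \<P>(\<omega> in M. \<bar>Y i \<omega>\<bar> > x \<bar> Y j \<omega> > y)) \<longlongrightarrow> 0) min_at_top)"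

definition pos_part :: "real \<Rightarrow> real"
  where "pos_part x = max x 0"

definition neg_part :: "real \<Rightarrow> real"
  where "neg_part x = - min x 0"

definition pQAI :: "'a measure \<Rightarrow> nat \<Rightarrow> (nat \<Rightarrow> 'a \<Rightarrow> real) \<Rightarrow> bool"
  where "pQAI M n Y \<longleftrightarrow> (\<forall>i\<in>{1..n}. \<forall>j\<in>{1..n}. i \<noteq> j \<longrightarrow>
    ((\<lambda>x. \<P>(\<omega> in M. pos_part (Y i \<omega>) > x \<and> pos_part (Y j \<omega>) > x)
        / (\<P>(\<omega> in M. Y i \<omega> > x) + \<P>(\<omega> in M. Y j \<omega> > x))) \<longlongrightarrow> 0) at_top \<and>
    ((\<lambda>x. \<P>(\<omega> in M. neg_part (Y i \<omega>) > x \<and> Y j \<omega> > x)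
        / (\<P>(\<omega> in M. Y i \<omega> > x) + \<P>(\<omega> in M. Y j \<omega> > x))) \<longlongrightarrow> 0) at_top)"

definition wsum :: "(nat \<Rightarrow> 'a \<Rightarrow> real) \<Rightarrow> (nat \<Rightarrow> 'a \<Rightarrow> real) \<Rightarrow> nat \<Rightarrow> 'a \<Rightarrow> real"
  where "wsum T X k \<omega> = (\<Sum>i=1..k. T i \<omega> * X i \<omega>)"

definition stopped_sum ::
    "(nat \<Rightarrow> 'a \<Rightarrow> real) \<Rightarrow> (nat \<Rightarrow> 'a \<Rightarrow> real) \<Rightarrow> ('a \<Rightarrow> nat) \<Rightarrow> 'a \<Rightarrow> real"
  where "stopped_sum T X N \<omega> = wsum T X (N \<omega>) \<omega>"

definition stopped_max ::
    "(nat \<Rightarrow> 'a \<Rightarrow> real) \<Rightarrow> (nat \<Rightarrow> 'a \<Rightarrow> real) \<Rightarrow> ('a \<Rightarrow> nat) \<Rightarrow> 'a \<Rightarrow> real"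
  where "stopped_max T X N \<omega> =
    (if N \<omega> = 0 then 0 else Max ((\<lambda>i. T i \<omega> * X i \<omega>) ` {1..N \<omega>}))"

definition stopped_max_sum ::
    "(nat \<Rightarrow> 'a \<Rightarrow> real) \<Rightarrow> (nat \<Rightarrow> 'a \<Rightarrow> real) \<Rightarrow> ('a \<Rightarrow> nat) \<Rightarrow> 'a \<Rightarrow> real"
  where "stopped_max_sum T X N \<omega> =
    (if N \<omega> = 0 then 0 else Max ((\<lambda>k. wsum T X k \<omega>) ` {1..N \<omega>}))"

text \<open>A counting variable is independent of the two sequences jointly: the sigma-algebra it
  generates is independent of the one generated by all pairs with index at least 1. (The library's
  \<open>indep_var\<close> requires both variables to take values in the same type.)\<close>

definition indep_of_seqs ::
    "'a measure \<Rightarrow> ('a \<Rightarrow> nat) \<Rightarrow> (nat \<Rightarrow> 'a \<Rightarrow> real) \<Rightarrow> (nat \<Rightarrow> 'a \<Rightarrow> real) \<Rightarrow> bool"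
  where "indep_of_seqs M N X T \<longleftrightarrow>
    prob_space.indep_set M
      (sets (vimage_algebra (space M) N (count_space UNIV)))
      (sets (vimage_algebra (space M) (\<lambda>\<omega>. \<lambda>i\<in>{1..}. (X i \<omega>, T i \<omega>))
        (PiM {1..} (\<lambda>_. borel :: (real \<times> real) measure))))"

end

theory Submission
  imports Defs
begin

text \<open>
  The proof rests on the principle of a single large term for the products \<open>Y i = \<Theta> i * X i\<close>: a sum of
  finitely many of them exceeds a large level essentially only if exactly one of them does, so that sums,
  maxima and maxima of partial sums of \<open>m\<close> terms all have tails equivalent to \<open>m * H\<close>, where \<open>H\<close>
  is the tail of \<open>\<Theta> * X\<close>. For this it is enough that \<open>H\<close> is insensitive to a shift \<open>s\<close> and that two products
  are rarely large together, one of them only at the scale of \<open>s\<close> (\<open>sum_tail_bounds\<close>). The shift is a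
  constant when \<open>H\<close> is long tailed, and a small multiple of the argument when \<open>H\<close> varies
  consistently. Conditioning on the independent counting variable replaces \<open>m\<close> by its mean, and
  the three distribution classes are closed under tail equivalence up to a positive constant.

  It remains to transfer the properties of the variables to the products. The conditional probabilities
  of the hypotheses are limits over shrinking intervals or squares around a point. By a
  differentiation theorem for arbitrary finite measures on the plane, such limits are densities, so
  that pointwise inequalities between them may be integrated (\<open>cond2_compare\<close>, \<open>cond1_compare\<close>). The
  hypotheses then say that the joint law of variables and weights has product form
  far out, asymptotically or up to constants. A large product \<open>\<Theta> X > x\<close> with \<open>\<Theta> \<le> b x\<close> means \<open>X > x / \<Theta>\<close> at a level
  that is uniformly large, and comparisons at fixed levels extend to random levels
  by discretisation (\<open>prob_staircase_le\<close>). Larger weights are negligible by hypothesis. In this way dominated variation,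
  long tails and consistent variation pass from \<open>X\<close> to \<open>\<Theta> X\<close>, and asymptotic independence passes from
  pairs of variables to pairs of products (\<open>products_pTAI\<close>, \<open>products_pQAI\<close>). The function \<open>g\<close> is bounded along
  the way by the conditional probabilities at one fixed level, so no integrability of \<open>g\<close> or \<open>h\<close>
  is needed.
\<close>

section \<open>Differentiation of measures along centred squares\<close>

text \<open>The closed square with centre \<open>\<theta>\<close> and half side \<open>\<delta>\<close>: the conditioning event of
  \<^const>\<open>cond2_approx\<close>.\<close>

definition sq :: "real \<times> real \<Rightarrow> real \<Rightarrow> (real \<times> real) set"
  where "sq \<theta> \<delta> = {fst \<theta> - \<delta>..fst \<theta> + \<delta>} \<times> {snd \<theta> - \<delta>..snd \<theta> + \<delta>}"

lemma fst_borel [measurable]: "(fst :: real \<times> real \<Rightarrow> real) \<in> borel_measurable borel"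
  and snd_borel [measurable]: "(snd :: real \<times> real \<Rightarrow> real) \<in> borel_measurable borel"
  by (intro borel_measurable_continuous_onI continuous_intros)+

lemma mem_sq: "y \<in> sq \<theta> \<delta> \<longleftrightarrow> \<bar>fst y - fst \<theta>\<bar> \<le> \<delta> \<and> \<bar>snd y - snd \<theta>\<bar> \<le> \<delta>"
  by (cases y) (auto simp: sq_def)

lemma sq_measurable [measurable]: "sq \<theta> \<delta> \<in> sets borel"
  unfolding sq_def by (intro borel_closed closed_Times) auto

locale planar_measure = finite_measure \<mu> for \<mu> :: "(real \<times> real) measure" +
  assumes sets_planar [measurable_cong]: "sets \<mu> = sets borel"
begin

text \<open>The average of \<open>f\<close> over the square; it is \<open>0\<close> on squares of measure zero.\<close>

definition sq_avg :: "(real \<times> real \<Rightarrow> real) \<Rightarrow> real \<Rightarrow> real \<times> real \<Rightarrow> real"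
  where "sq_avg f \<delta> \<theta> = (\<integral>y. indicator (sq \<theta> \<delta>) y * f y \<partial>\<mu>) / measure \<mu> (sq \<theta> \<delta>)"

lemma indicator_sq_measurable [measurable]:
  "(\<lambda>(\<theta>, y). indicator (sq \<theta> \<delta>) y :: real) \<in> borel_measurable (\<mu> \<Otimes>\<^sub>M \<mu>)"
  "(\<lambda>(\<theta>, y). indicator (sq \<theta> \<delta>) y :: ennreal) \<in> borel_measurable (\<mu> \<Otimes>\<^sub>M \<mu>)"
  unfolding indicator_def mem_sq by measurable

lemma indicator_sq_measurable' [measurable]:
  "(\<lambda>\<theta>. indicator (sq \<theta> \<delta>) y :: ennreal) \<in> borel_measurable \<mu>"
  unfolding indicator_def mem_sq by measurable

lemma emeasure_sq_measurable [measurable]: "(\<lambda>\<theta>. emeasure \<mu> (sq \<theta> \<delta>)) \<in> borel_measurable \<mu>"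
proof -
  have "(\<lambda>\<theta>. \<integral>\<^sup>+ y. indicator (sq \<theta> \<delta>) y \<partial>\<mu>) \<in> borel_measurable \<mu>"
    by measurable
  then show ?thesis by simp
qed

lemma measure_sq_measurable [measurable]: "(\<lambda>\<theta>. measure \<mu> (sq \<theta> \<delta>)) \<in> borel_measurable \<mu>"
  unfolding measure_def by measurable

lemma sq_avg_measurable [measurable]:
  assumes [measurable]: "f \<in> borel_measurable \<mu>"
  shows "sq_avg f \<delta> \<in> borel_measurable \<mu>"
  unfolding sq_avg_def[abs_def] by measurable

text \<open>The square around \<open>y\<close> splits into four quadrants of side \<open>\<delta>\<close>, and the square around any point of
  a quadrant contains that quadrant. Hence each quadrant contributes at most \<open>1\<close> to the integral.
  This replaces the covering theorem usually needed to differentiate an arbitrary measure.\<close>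

lemma inverse_sq_integral_le:
  "(\<integral>\<^sup>+ \<theta>. indicator (sq \<theta> \<delta>) y / emeasure \<mu> (sq \<theta> \<delta>) \<partial>\<mu>) \<le> 4"
proof -
  define a b where "a = fst y" and "b = snd y"
  define c where "c = (\<lambda>k::nat. (if k div 2 = 0 then {a - \<delta>..a} else {a..a + \<delta>}) \<times>
    (if k mod 2 = 0 then {b - \<delta>..b} else {b..b + \<delta>}))"
  have c_meas [measurable]: "c k \<in> sets borel" for k
    unfolding c_def by (intro borel_closed closed_Times) auto
  have c_sub: "c k \<subseteq> sq \<theta> \<delta>" if "\<theta> \<in> c k" for k \<theta>
    using that by (auto simp: c_def mem_sq split: if_splits)
  have cover: "(indicator (sq \<theta> \<delta>) y :: ennreal) \<le> (\<Sum>k<4. indicator (c k) \<theta>)" for \<theta>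
  proof (cases "y \<in> sq \<theta> \<delta>")
    case True
    then have "\<theta> \<in> c 0 \<or> \<theta> \<in> c 1 \<or> \<theta> \<in> c 2 \<or> \<theta> \<in> c 3"
      by (cases \<theta>) (auto simp: c_def mem_sq a_def b_def)
    then obtain k where k: "k < 4" "\<theta> \<in> c k"
      by (metis zero_less_numeral one_less_numeral_iff semiring_norm(76) numeral_less_iff semiring_norm(79) semiring_norm(78) semiring_norm(81))
    have "indicator (sq \<theta> \<delta>) y = (indicator (c k) \<theta> :: ennreal)"
      using True k by simp
    also have "\<dots> \<le> (\<Sum>k<4. indicator (c k) \<theta>)"
      using k by (intro member_le_sum) auto
    finally show ?thesis .
  qed simp
  have piece: "(\<integral>\<^sup>+ \<theta>. indicator (c k) \<theta> / emeasure \<mu> (sq \<theta> \<delta>) \<partial>\<mu>) \<le> 1" for k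
  proof (cases "emeasure \<mu> (c k) = 0")
    case True
    then have "AE \<theta> in \<mu>. \<theta> \<notin> c k"
      by (intro AE_not_in) (auto simp: null_sets_def sets_planar)
    then have "(\<integral>\<^sup>+ \<theta>. indicator (c k) \<theta> / emeasure \<mu> (sq \<theta> \<delta>) \<partial>\<mu>) = (\<integral>\<^sup>+ \<theta>. 0 \<partial>\<mu>)"
      by (intro nn_integral_cong_AE) auto
    then show ?thesis by simp
  next
    case False
    have "(\<integral>\<^sup>+ \<theta>. indicator (c k) \<theta> / emeasure \<mu> (sq \<theta> \<delta>) \<partial>\<mu>)
        \<le> (\<integral>\<^sup>+ \<theta>. indicator (c k) \<theta> / emeasure \<mu> (c k) \<partial>\<mu>)"
    proof (intro nn_integral_mono)
      fix \<theta>
      show "indicator (c k) \<theta> / emeasure \<mu> (sq \<theta> \<delta>) \<le> indicator (c k) \<theta> / emeasure \<mu> (c k)"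
      proof (cases "\<theta> \<in> c k")
        case True
        then have "measure \<mu> (c k) \<le> measure \<mu> (sq \<theta> \<delta>)"
          by (intro finite_measure_mono c_sub) (auto simp: sets_planar)
        moreover have "measure \<mu> (c k) > 0"
          using False by (simp add: emeasure_eq_measure zero_less_measure_iff)
        ultimately have "inverse (emeasure \<mu> (sq \<theta> \<delta>)) \<le> inverse (emeasure \<mu> (c k))"
          by (simp add: emeasure_eq_measure inverse_ennreal ennreal_leI le_imp_inverse_le)
        with True show ?thesis by (simp add: divide_ennreal_def)
      qed simp
    qed
    also have "\<dots> = emeasure \<mu> (c k) / emeasure \<mu> (c k)"
      by (subst nn_integral_divide) (auto simp: sets_planar)
    also have "\<dots> \<le> 1"
      using False emeasure_finite[of "c k"] by (subst ennreal_divide_self) (auto simp: less_top[symmetric])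
    finally show ?thesis .
  qed
  have "(\<integral>\<^sup>+ \<theta>. indicator (sq \<theta> \<delta>) y / emeasure \<mu> (sq \<theta> \<delta>) \<partial>\<mu>)
      \<le> (\<integral>\<^sup>+ \<theta>. (\<Sum>k<4. indicator (c k) \<theta> / emeasure \<mu> (sq \<theta> \<delta>)) \<partial>\<mu>)"
    unfolding divide_ennreal_def sum_distrib_right[symmetric]
    by (intro nn_integral_mono mult_right_mono cover) auto
  also have "\<dots> = (\<Sum>k<4. \<integral>\<^sup>+ \<theta>. indicator (c k) \<theta> / emeasure \<mu> (sq \<theta> \<delta>) \<partial>\<mu>)"
    by (intro nn_integral_sum) measurable
  also have "\<dots> \<le> (\<Sum>k<4::nat. 1)"
    by (intro sum_mono piece)
  finally show ?thesis by simp
qed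

text \<open>By Fubini, averaging over squares of a fixed size is bounded on \<open>L\<^sup>1(\<mu>)\<close>, uniformly in the size.\<close>

lemma sq_avg_L1_nn:
  fixes \<phi> :: "real \<times> real \<Rightarrow> ennreal"
  assumes [measurable]: "\<phi> \<in> borel_measurable \<mu>"
  shows "(\<integral>\<^sup>+ \<theta>. (\<integral>\<^sup>+ y. indicator (sq \<theta> \<delta>) y * \<phi> y \<partial>\<mu>) / emeasure \<mu> (sq \<theta> \<delta>) \<partial>\<mu>)
    \<le> 4 * (\<integral>\<^sup>+ y. \<phi> y \<partial>\<mu>)"
proof -
  interpret P: pair_sigma_finite \<mu> \<mu> ..
  have "(\<integral>\<^sup>+ \<theta>. (\<integral>\<^sup>+ y. indicator (sq \<theta> \<delta>) y * \<phi> y \<partial>\<mu>) / emeasure \<mu> (sq \<theta> \<delta>) \<partial>\<mu>)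
      = (\<integral>\<^sup>+ \<theta>. (\<integral>\<^sup>+ y. indicator (sq \<theta> \<delta>) y * \<phi> y / emeasure \<mu> (sq \<theta> \<delta>) \<partial>\<mu>) \<partial>\<mu>)"
    by (intro nn_integral_cong nn_integral_divide[symmetric]) measurable
  also have "\<dots> = (\<integral>\<^sup>+ y. (\<integral>\<^sup>+ \<theta>. indicator (sq \<theta> \<delta>) y * \<phi> y / emeasure \<mu> (sq \<theta> \<delta>) \<partial>\<mu>) \<partial>\<mu>)"
    by (intro P.Fubini'[symmetric]) measurable
  also have "\<dots> = (\<integral>\<^sup>+ y. (\<integral>\<^sup>+ \<theta>. indicator (sq \<theta> \<delta>) y / emeasure \<mu> (sq \<theta> \<delta>) \<partial>\<mu>) * \<phi> y \<partial>\<mu>)"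
    by (subst nn_integral_multc[symmetric]) (auto simp: divide_ennreal_def mult_ac)
  also have "\<dots> \<le> (\<integral>\<^sup>+ y. 4 * \<phi> y \<partial>\<mu>)"
    by (intro nn_integral_mono mult_right_mono inverse_sq_integral_le) auto
  finally show ?thesis by (simp add: nn_integral_cmult)
qed

lemma sq_avg_L1:
  assumes f: "integrable \<mu> f"
  shows "(\<integral>\<^sup>+ \<theta>. ennreal \<bar>sq_avg f \<delta> \<theta>\<bar> \<partial>\<mu>) \<le> 4 * (\<integral>\<^sup>+ y. ennreal \<bar>f y\<bar> \<partial>\<mu>)"
proof -
  have [measurable]: "f \<in> borel_measurable \<mu>" using f by simp
  have "(\<integral>\<^sup>+ \<theta>. ennreal \<bar>sq_avg f \<delta> \<theta>\<bar> \<partial>\<mu>)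
      \<le> (\<integral>\<^sup>+ \<theta>. (\<integral>\<^sup>+ y. indicator (sq \<theta> \<delta>) y * ennreal \<bar>f y\<bar> \<partial>\<mu>) / emeasure \<mu> (sq \<theta> \<delta>) \<partial>\<mu>)"
  proof (intro nn_integral_mono)
    fix \<theta>
    have int: "integrable \<mu> (\<lambda>y. indicator (sq \<theta> \<delta>) y * f y)"
      using integrable_mult_indicator[OF _ f, of "sq \<theta> \<delta>"] by (simp add: sets_planar)
    have *: "ennreal \<bar>\<integral>y. indicator (sq \<theta> \<delta>) y * f y \<partial>\<mu>\<bar>
        \<le> (\<integral>\<^sup>+ y. indicator (sq \<theta> \<delta>) y * ennreal \<bar>f y\<bar> \<partial>\<mu>)"
      using integral_norm_bound_ennreal[OF int]
      by (simp add: abs_mult ennreal_mult ennreal_indicator)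
    show "ennreal \<bar>sq_avg f \<delta> \<theta>\<bar>
        \<le> (\<integral>\<^sup>+ y. indicator (sq \<theta> \<delta>) y * ennreal \<bar>f y\<bar> \<partial>\<mu>) / emeasure \<mu> (sq \<theta> \<delta>)"
    proof (cases "measure \<mu> (sq \<theta> \<delta>) = 0")
      case False
      then have pos: "measure \<mu> (sq \<theta> \<delta>) > 0" by (simp add: zero_less_measure_iff)
      have "ennreal \<bar>sq_avg f \<delta> \<theta>\<bar>
          = ennreal \<bar>\<integral>y. indicator (sq \<theta> \<delta>) y * f y \<partial>\<mu>\<bar> / ennreal (measure \<mu> (sq \<theta> \<delta>))"
        using pos by (simp add: sq_avg_def divide_ennreal)
      also have "\<dots> \<le> (\<integral>\<^sup>+ y. indicator (sq \<theta> \<delta>) y * ennreal \<bar>f y\<bar> \<partial>\<mu>) / emeasure \<mu> (sq \<theta> \<delta>)"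
        unfolding emeasure_eq_measure by (intro divide_right_mono_ennreal *)
      finally show ?thesis .
    qed (simp add: sq_avg_def)
  qed
  also have "\<dots> \<le> 4 * (\<integral>\<^sup>+ y. ennreal \<bar>f y\<bar> \<partial>\<mu>)"
    by (intro sq_avg_L1_nn) measurable
  finally show ?thesis .
qed

text \<open>The \<open>L\<^sup>1\<close>-distance between a function and its square averages.\<close>

definition sq_err :: "(real \<times> real \<Rightarrow> real) \<Rightarrow> real \<Rightarrow> ennreal"
  where "sq_err f \<delta> = (\<integral>\<^sup>+ \<theta>. ennreal \<bar>sq_avg f \<delta> \<theta> - f \<theta>\<bar> \<partial>\<mu>)"

lemma sq_avg_add:
  assumes f: "integrable \<mu> f" and g: "integrable \<mu> g"
  shows "sq_avg (\<lambda>x. f x + g x) \<delta> \<theta> = sq_avg f \<delta> \<theta> + sq_avg g \<delta> \<theta>"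
proof -
  have "integrable \<mu> (\<lambda>y. indicator (sq \<theta> \<delta>) y * f y)" "integrable \<mu> (\<lambda>y. indicator (sq \<theta> \<delta>) y * g y)"
    using integrable_mult_indicator[OF _ f, of "sq \<theta> \<delta>"] integrable_mult_indicator[OF _ g, of "sq \<theta> \<delta>"]
    by (simp_all add: sets_planar)
  then show ?thesis
    by (simp add: sq_avg_def distrib_left add_divide_distrib)
qed

lemma sq_err_add:
  assumes f: "integrable \<mu> f" and g: "integrable \<mu> g"
  shows "sq_err (\<lambda>x. f x + g x) \<delta> \<le> sq_err f \<delta> + sq_err g \<delta>"
proof -
  have [measurable]: "f \<in> borel_measurable \<mu>" "g \<in> borel_measurable \<mu>" using f g by simp_all
  have "sq_err (\<lambda>x. f x + g x) \<delta>
      \<le> (\<integral>\<^sup>+ \<theta>. ennreal \<bar>sq_avg f \<delta> \<theta> - f \<theta>\<bar> + ennreal \<bar>sq_avg g \<delta> \<theta> - g \<theta>\<bar> \<partial>\<mu>)"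
    unfolding sq_err_def sq_avg_add[OF f g]
    by (intro nn_integral_mono) (auto simp: ennreal_plus[symmetric] simp del: ennreal_plus intro!: ennreal_leI)
  also have "\<dots> = sq_err f \<delta> + sq_err g \<delta>"
    unfolding sq_err_def by (intro nn_integral_add) measurable
  finally show ?thesis .
qed

lemma sq_err_le:
  assumes f: "integrable \<mu> f"
  shows "sq_err f \<delta> \<le> 5 * (\<integral>\<^sup>+ y. ennreal \<bar>f y\<bar> \<partial>\<mu>)"
proof -
  have [measurable]: "f \<in> borel_measurable \<mu>" using f by simp
  have "sq_err f \<delta> \<le> (\<integral>\<^sup>+ \<theta>. ennreal \<bar>sq_avg f \<delta> \<theta>\<bar> + ennreal \<bar>f \<theta>\<bar> \<partial>\<mu>)"
    unfolding sq_err_def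
    by (intro nn_integral_mono) (auto simp: ennreal_plus[symmetric] simp del: ennreal_plus intro!: ennreal_leI)
  also have "\<dots> = (\<integral>\<^sup>+ \<theta>. ennreal \<bar>sq_avg f \<delta> \<theta>\<bar> \<partial>\<mu>) + (\<integral>\<^sup>+ \<theta>. ennreal \<bar>f \<theta>\<bar> \<partial>\<mu>)"
    by (intro nn_integral_add) measurable
  also have "\<dots> \<le> 4 * (\<integral>\<^sup>+ y. ennreal \<bar>f y\<bar> \<partial>\<mu>) + (\<integral>\<^sup>+ \<theta>. ennreal \<bar>f \<theta>\<bar> \<partial>\<mu>)"
    by (intro add_mono sq_avg_L1 f) auto
  also have "\<dots> = 5 * (\<integral>\<^sup>+ y. ennreal \<bar>f y\<bar> \<partial>\<mu>)"
    by (metis (no_types, lifting) distrib_right mult_1 numeral_plus_one semiring_norm(5) add_num_simps(4))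
  finally show ?thesis .
qed

text \<open>The averages over shrinking squares converge in \<open>L\<^sup>1(\<mu>)\<close>; radii \<open>1/(k+1)\<close> suffice for the later
  identification of limits.\<close>

definition sq_conv :: "(real \<times> real \<Rightarrow> real) \<Rightarrow> bool"
  where "sq_conv f \<longleftrightarrow> (\<lambda>k. sq_err f (1 / Suc k)) \<longlonglongrightarrow> 0"

text \<open>Since averaging is uniformly bounded, the functions with convergent averages form a closed set.\<close>

lemma sq_conv_close:
  assumes f: "integrable \<mu> f"
    and g: "\<And>k. integrable \<mu> (g k)" "\<And>k. sq_conv (g k)"
    and lim: "(\<lambda>k. \<integral>\<^sup>+ y. ennreal \<bar>f y - g k y\<bar> \<partial>\<mu>) \<longlonglongrightarrow> 0"
  shows "sq_conv f"
  unfolding sq_conv_def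
proof (rule order_tendstoI)
  fix e :: ennreal assume "e > 0"
  then obtain e' where e': "0 < e'" "e' < e" using dense by blast
  have "e' / 12 > 0" using e' by (simp add: ennreal_zero_less_divide)
  then have "\<forall>\<^sub>F k in sequentially. (\<integral>\<^sup>+ y. ennreal \<bar>f y - g k y\<bar> \<partial>\<mu>) < e' / 12"
    using lim by (auto dest: order_tendstoD)
  then obtain k where k: "(\<integral>\<^sup>+ y. ennreal \<bar>f y - g k y\<bar> \<partial>\<mu>) < e' / 12"
    by (auto simp: eventually_sequentially)
  have "e' / 2 > 0" using e' by (simp add: ennreal_zero_less_divide)
  then have "\<forall>\<^sub>F m in sequentially. sq_err (g k) (1 / Suc m) < e' / 2"
    using g(2)[of k] unfolding sq_conv_def by (auto dest: order_tendstoD)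
  then show "\<forall>\<^sub>F m in sequentially. sq_err f (1 / Suc m) < e"
  proof eventually_elim
    case (elim m)
    have "sq_err f (1 / Suc m) = sq_err (\<lambda>x. g k x + (f x - g k x)) (1 / Suc m)" by simp
    also have "\<dots> \<le> sq_err (g k) (1 / Suc m) + sq_err (\<lambda>x. f x - g k x) (1 / Suc m)"
      using f g(1)[of k] by (intro sq_err_add) auto
    also have "\<dots> \<le> e' / 2 + 5 * (e' / 12)"
      using elim k f g(1)[of k]
      by (intro add_mono order_trans[OF sq_err_le[of "\<lambda>x. f x - g k x"]] mult_left_mono) auto
    also have "\<dots> \<le> e'"
    proof (cases e')
      case (real r)
      then show ?thesis
        by (auto simp: ennreal_numeral[symmetric] divide_ennreal ennreal_mult'[symmetric] ennreal_plus[symmetric]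
            simp del: ennreal_plus ennreal_numeral)
    qed simp
    finally show ?case using e' by simp
  qed
qed simp

text \<open>Almost every point lies in the topological support of \<open>\<mu>\<close>.\<close>

lemma AE_sq_pos: "AE \<theta> in \<mu>. \<forall>\<delta>>0. measure \<mu> (sq \<theta> \<delta>) > 0"
proof -
  define \<F> where "\<F> = {V :: (real \<times> real) set. open V \<and> emeasure \<mu> V = 0}"
  obtain \<G> where \<G>: "\<G> \<subseteq> \<F>" "countable \<G>" "\<Union>\<G> = \<Union>\<F>"
    using Lindelof[of \<F>] by (auto simp: \<F>_def)
  have "\<Union>\<G> \<in> null_sets \<mu>"
    using \<G> by (intro null_sets_UN'[of \<G> id, simplified]) (auto simp: \<F>_def null_sets_def sets_planar)
  then have "AE \<theta> in \<mu>. \<theta> \<notin> \<Union>\<F>" unfolding \<G>(3) by (rule AE_not_in)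
  then show ?thesis
  proof (eventually_elim, intro allI impI)
    fix \<theta> and \<delta> :: real assume \<theta>: "\<theta> \<notin> \<Union>\<F>" and \<delta>: "\<delta> > 0"
    define V where "V = {fst \<theta> - \<delta><..<fst \<theta> + \<delta>} \<times> {snd \<theta> - \<delta><..<snd \<theta> + \<delta>}"
    have V: "open V" "\<theta> \<in> V" "V \<subseteq> sq \<theta> \<delta>"
      using \<delta> by (auto simp: V_def sq_def intro!: open_Times mem_Times_iff[THEN iffD2])
    with \<theta> have "emeasure \<mu> V \<noteq> 0" by (auto simp: \<F>_def)
    moreover have "emeasure \<mu> V \<le> emeasure \<mu> (sq \<theta> \<delta>)"
      using V by (intro emeasure_mono) (auto simp: sets_planar)
    ultimately have "emeasure \<mu> (sq \<theta> \<delta>) \<noteq> 0" by auto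
    then show "measure \<mu> (sq \<theta> \<delta>) > 0"
      by (simp add: emeasure_eq_measure zero_less_measure_iff)
  qed
qed

lemma sq_conv_continuous:
  assumes cont: "continuous_on UNIV f" and bd: "\<And>x. \<bar>f x\<bar> \<le> B"
  shows "sq_conv f"
proof -
  have [measurable]: "f \<in> borel_measurable \<mu>"
    using borel_measurable_continuous_onI[OF cont] by (simp cong: measurable_cong_sets add: sets_planar)
  have f: "integrable \<mu> f"
    by (rule integrable_const_bound[where B=B]) (auto simp: bd)
  have B: "B \<ge> 0" using bd[of undefined] by simp
  have diff: "\<bar>sq_avg f \<delta> \<theta> - f \<theta>\<bar> \<le> e"
    if "\<And>y. y \<in> sq \<theta> \<delta> \<Longrightarrow> \<bar>f y - f \<theta>\<bar> \<le> e" and pos: "measure \<mu> (sq \<theta> \<delta>) > 0" for \<theta> \<delta> e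
  proof -
    have int: "integrable \<mu> (\<lambda>y. indicator (sq \<theta> \<delta>) y * f y)"
      using integrable_mult_indicator[OF _ f, of "sq \<theta> \<delta>"] by (simp add: sets_planar)
    have int2: "integrable \<mu> (\<lambda>y. indicator (sq \<theta> \<delta>) y * c)" for c :: real
      using integrable_mult_indicator[of "sq \<theta> \<delta>" \<mu> "\<lambda>_. c"] by (simp add: sets_planar)
    have "sq_avg f \<delta> \<theta> - f \<theta> = ((\<integral>y. indicator (sq \<theta> \<delta>) y * f y \<partial>\<mu>)
        - (\<integral>y. indicator (sq \<theta> \<delta>) y * f \<theta> \<partial>\<mu>)) / measure \<mu> (sq \<theta> \<delta>)"
      using pos by (simp add: sq_avg_def diff_divide_distrib sets_planar)
    also have "\<dots> = (\<integral>y. indicator (sq \<theta> \<delta>) y * (f y - f \<theta>) \<partial>\<mu>) / measure \<mu> (sq \<theta> \<delta>)"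
      using int int2 by (simp add: right_diff_distrib)
    finally have eq: "\<bar>sq_avg f \<delta> \<theta> - f \<theta>\<bar>
        = \<bar>\<integral>y. indicator (sq \<theta> \<delta>) y * (f y - f \<theta>) \<partial>\<mu>\<bar> / measure \<mu> (sq \<theta> \<delta>)"
      by simp
    have "\<bar>\<integral>y. indicator (sq \<theta> \<delta>) y * (f y - f \<theta>) \<partial>\<mu>\<bar> \<le> (\<integral>y. indicator (sq \<theta> \<delta>) y * e \<partial>\<mu>)"
    proof (rule order_trans[OF integral_abs_bound], rule integral_mono)
      show "integrable \<mu> (\<lambda>y. \<bar>indicator (sq \<theta> \<delta>) y * (f y - f \<theta>)\<bar>)"
        using int int2[of "f \<theta>"] by (intro integrable_abs) (simp add: right_diff_distrib)
      show "\<bar>indicator (sq \<theta> \<delta>) y * (f y - f \<theta>)\<bar> \<le> indicator (sq \<theta> \<delta>) y * e" for y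
        using that(1)[of y] by (auto simp: indicator_def)
    qed (rule int2)
    also have "\<dots> = measure \<mu> (sq \<theta> \<delta>) * e" by (simp add: sets_planar)
    finally show ?thesis unfolding eq using pos by (simp add: field_simps)
  qed
  have "(\<lambda>k. \<integral>\<^sup>+ \<theta>. ennreal \<bar>sq_avg f (1 / Suc k) \<theta> - f \<theta>\<bar> \<partial>\<mu>) \<longlonglongrightarrow> (\<integral>\<^sup>+ \<theta>. 0 \<partial>\<mu>)"
  proof (rule nn_integral_dominated_convergence[where w="\<lambda>_. ennreal (2 * B)"])
    show "(\<integral>\<^sup>+ \<theta>. ennreal (2 * B) \<partial>\<mu>) < \<infinity>"
      by (simp add: ennreal_mult_less_top emeasure_eq_measure)
    show "AE \<theta> in \<mu>. ennreal \<bar>sq_avg f (1 / Suc k) \<theta> - f \<theta>\<bar> \<le> ennreal (2 * B)" for k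
      using AE_sq_pos
    proof eventually_elim
      case (elim \<theta>)
      have "\<bar>f y - f \<theta>\<bar> \<le> 2 * B" for y using bd[of y] bd[of \<theta>] by linarith
      then show ?case using elim by (intro ennreal_leI diff) auto
    qed
    show "AE \<theta> in \<mu>. (\<lambda>k. ennreal \<bar>sq_avg f (1 / Suc k) \<theta> - f \<theta>\<bar>) \<longlonglongrightarrow> 0"
      using AE_sq_pos
    proof eventually_elim
      case (elim \<theta>)
      have "(\<lambda>k. sq_avg f (1 / Suc k) \<theta> - f \<theta>) \<longlonglongrightarrow> 0"
      proof (rule LIMSEQ_I)
        fix r :: real assume r: "r > 0"
        have "continuous (at \<theta>) f" using cont continuous_on_eq_continuous_at[OF open_UNIV, of f] by blast
        then obtain d where d: "d > 0" "\<And>y. dist y \<theta> < d \<Longrightarrow> dist (f y) (f \<theta>) < r / 2"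
          using r unfolding continuous_at_eps_delta by (metis half_gt_zero)
        obtain m :: nat where m: "2 / d < real m" using reals_Archimedean2 by blast
        show "\<exists>no. \<forall>k\<ge>no. norm (sq_avg f (1 / real (Suc k)) \<theta> - f \<theta> - 0) < r"
        proof (intro exI allI impI)
          fix k assume k: "k \<ge> m"
          have "2 / d < real (Suc k)" using m k by linarith
          then have "2 * (1 / real (Suc k)) < d" using d by (simp add: field_simps)
          moreover have "dist y \<theta> \<le> 2 * (1 / real (Suc k))" if "y \<in> sq \<theta> (1 / Suc k)" for y
          proof -
            have "dist y \<theta> \<le> \<bar>fst y - fst \<theta>\<bar> + \<bar>snd y - snd \<theta>\<bar>"
              unfolding dist_prod_def dist_real_def by (intro order_trans[OF sqrt_sum_squares_le_sum]) auto
            with that show ?thesis unfolding mem_sq by linarith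
          qed
          ultimately have "dist y \<theta> < d" if "y \<in> sq \<theta> (1 / Suc k)" for y
            using that by fastforce
          then have "\<bar>f y - f \<theta>\<bar> \<le> r / 2" if "y \<in> sq \<theta> (1 / Suc k)" for y
            using d(2)[of y] that by (simp add: dist_real_def)
          then have "\<bar>sq_avg f (1 / real (Suc k)) \<theta> - f \<theta>\<bar> \<le> r / 2"
            using elim by (intro diff) auto
          then show "norm (sq_avg f (1 / real (Suc k)) \<theta> - f \<theta> - 0) < r" using r by simp
        qed
      qed
      then have "(\<lambda>k. ennreal \<bar>sq_avg f (1 / Suc k) \<theta> - f \<theta>\<bar>) \<longlonglongrightarrow> ennreal \<bar>0\<bar>"
        by (intro tendsto_ennrealI tendsto_rabs)
      then show ?case by simp
    qed
  qed measurable
  then show ?thesis by (simp add: sq_conv_def sq_err_def)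
qed

lemma sq_conv_indicator_compact:
  assumes K: "compact K"
  shows "sq_conv (\<lambda>x. indicator K x * c)"
proof (cases "K = {}")
  case True
  then show ?thesis by (intro sq_conv_continuous[where B=0]) auto
next
  case False
  have Kb [measurable]: "K \<in> sets borel" using K by (intro borel_closed compact_imp_closed)
  define \<phi> where "\<phi> m x = max 0 (1 - real m * infdist x K) * c" for m x
  have bd: "\<bar>\<phi> m x\<bar> \<le> \<bar>c\<bar>" for m x
    by (auto simp: \<phi>_def abs_mult infdist_nonneg max_def intro!: mult_left_le_one_le)
  have cont: "continuous_on UNIV (\<phi> m)" for m
    unfolding \<phi>_def by (intro continuous_intros)
  have [measurable]: "\<phi> m \<in> borel_measurable \<mu>" for m
    using borel_measurable_continuous_onI[OF cont] by (simp cong: measurable_cong_sets add: sets_planar)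
  show ?thesis
  proof (rule sq_conv_close)
    show "integrable \<mu> (\<lambda>x. indicator K x * c)"
      by (rule integrable_const_bound[where B="\<bar>c\<bar>"]) (auto simp: indicator_def)
    show "integrable \<mu> (\<phi> m)" for m
      by (rule integrable_const_bound[where B="\<bar>c\<bar>"]) (auto simp: bd)
    show "sq_conv (\<phi> m)" for m
      using cont bd by (rule sq_conv_continuous)
    have "(\<lambda>m. \<integral>\<^sup>+ y. ennreal \<bar>indicator K y * c - \<phi> m y\<bar> \<partial>\<mu>) \<longlonglongrightarrow> (\<integral>\<^sup>+ y. 0 \<partial>\<mu>)"
    proof (rule nn_integral_dominated_convergence[where w="\<lambda>_. ennreal (2 * \<bar>c\<bar>)"])
      show "(\<integral>\<^sup>+ \<theta>. ennreal (2 * \<bar>c\<bar>) \<partial>\<mu>) < \<infinity>"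
        by (simp add: ennreal_mult_less_top emeasure_eq_measure)
      show "AE y in \<mu>. ennreal \<bar>indicator K y * c - \<phi> m y\<bar> \<le> ennreal (2 * \<bar>c\<bar>)" for m
      proof (intro AE_I2 ennreal_leI)
        fix y
        have "\<bar>indicator K y * c\<bar> \<le> \<bar>c\<bar>" by (auto simp: indicator_def)
        then show "\<bar>indicator K y * c - \<phi> m y\<bar> \<le> 2 * \<bar>c\<bar>" using bd[of m y] by linarith
      qed
      show "AE y in \<mu>. (\<lambda>m. ennreal \<bar>indicator K y * c - \<phi> m y\<bar>) \<longlonglongrightarrow> 0"
      proof (intro AE_I2 tendsto_eventually)
        fix y
        show "\<forall>\<^sub>F m in sequentially. ennreal \<bar>indicator K y * c - \<phi> m y\<bar> = 0"
        proof (cases "y \<in> K")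
          case True
          then show ?thesis by (simp add: \<phi>_def)
        next
          case out: False
          then have "infdist y K > 0"
            using False K by (metis compact_imp_closed in_closed_iff_infdist_zero infdist_nonneg order_less_le)
          then obtain m0 :: nat where m0: "1 < real m0 * infdist y K"
            using reals_Archimedean3 by blast
          show ?thesis
            using eventually_ge_at_top[of m0]
          proof eventually_elim
            case (elim m)
            have "real m0 * infdist y K \<le> real m * infdist y K"
              using elim by (intro mult_right_mono infdist_nonneg) auto
            with m0 have "1 - real m * infdist y K \<le> 0" by linarith
            then show ?case using out by (simp add: \<phi>_def)
          qed
        qed
      qed
    qed measurable
    then show "(\<lambda>m. \<integral>\<^sup>+ y. ennreal \<bar>indicator K y * c - \<phi> m y\<bar> \<partial>\<mu>) \<longlonglongrightarrow> 0" by simp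
  qed
qed

lemma sq_conv_indicator:
  assumes A: "A \<in> sets borel"
  shows "sq_conv (\<lambda>x. indicator A x * c)"
proof -
  have [measurable]: "A \<in> sets borel" by fact
  have "\<exists>K. K \<subseteq> A \<and> compact K \<and> emeasure \<mu> (A - K) < ennreal (1 / Suc m)" for m
  proof -
    have sup: "emeasure \<mu> A = (SUP K\<in>{K. K \<subseteq> A \<and> compact K}. emeasure \<mu> K)"
      using A by (intro inner_regular sets_planar) auto
    have "\<exists>K. K \<subseteq> A \<and> compact K \<and> measure \<mu> A < measure \<mu> K + 1 / Suc m"
    proof (cases "measure \<mu> A = 0")
      case True
      then show ?thesis by (intro exI[of _ "{}"]) auto
    next
      case False
      then have "ennreal (measure \<mu> A - 1 / Suc m) < emeasure \<mu> A"
        unfolding emeasure_eq_measure by (intro ennreal_lessI) (auto simp: zero_less_measure_iff)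
      then obtain K where K: "K \<subseteq> A" "compact K" "ennreal (measure \<mu> A - 1 / Suc m) < emeasure \<mu> K"
        unfolding sup by (auto simp: less_SUP_iff)
      have "measure \<mu> A - 1 / Suc m < measure \<mu> K"
        using K(3) unfolding emeasure_eq_measure by (meson ennreal_leI not_le)
      with K show ?thesis by (intro exI[of _ K]) auto
    qed
    then obtain K where K: "K \<subseteq> A" "compact K" "measure \<mu> A < measure \<mu> K + 1 / Suc m"
      by blast
    have [measurable]: "K \<in> sets borel" using K by (intro borel_closed compact_imp_closed)
    have "measure \<mu> (A - K) = measure \<mu> A - measure \<mu> K"
      using K by (intro finite_measure_Diff) (auto simp: sets_planar)
    with K(3) have "emeasure \<mu> (A - K) < ennreal (1 / Suc m)"
      unfolding emeasure_eq_measure by (intro ennreal_lessI) auto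
    with K show ?thesis by blast
  qed
  then obtain K where K: "\<And>m. K m \<subseteq> A" "\<And>m. compact (K m)"
    "\<And>m. emeasure \<mu> (A - K m) < ennreal (1 / Suc m)" by metis
  have [measurable]: "K m \<in> sets borel" for m using K(2) by (intro borel_closed compact_imp_closed)
  show ?thesis
  proof (rule sq_conv_close)
    show "integrable \<mu> (\<lambda>x. indicator A x * c)" "\<And>m. integrable \<mu> (\<lambda>x. indicator (K m) x * c)"
      by (rule integrable_const_bound[where B="\<bar>c\<bar>"], force simp: indicator_def, measurable)+
    show "sq_conv (\<lambda>x. indicator (K m) x * c)" for m
      by (intro sq_conv_indicator_compact K)
    have eq: "(\<integral>\<^sup>+ y. ennreal \<bar>indicator A y * c - indicator (K m) y * c\<bar> \<partial>\<mu>)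
        = emeasure \<mu> (A - K m) * ennreal \<bar>c\<bar>" for m
    proof -
      have "(\<integral>\<^sup>+ y. ennreal \<bar>indicator A y * c - indicator (K m) y * c\<bar> \<partial>\<mu>)
          = (\<integral>\<^sup>+ y. ennreal \<bar>c\<bar> * indicator (A - K m) y \<partial>\<mu>)"
        using K(1)[of m] by (intro nn_integral_cong) (auto simp: indicator_def)
      also have "\<dots> = ennreal \<bar>c\<bar> * emeasure \<mu> (A - K m)"
        by (intro nn_integral_cmult_indicator) (simp add: sets_planar)
      finally show ?thesis by (simp add: mult.commute)
    qed
    have z: "(\<lambda>m. emeasure \<mu> (A - K m)) \<longlonglongrightarrow> 0"
    proof (rule tendsto_sandwich[OF _ _ tendsto_const])
      have "(\<lambda>m. ennreal (1 / Suc m)) \<longlonglongrightarrow> ennreal 0"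
        by (intro tendsto_ennrealI LIMSEQ_Suc lim_1_over_n)
      then show "(\<lambda>m. ennreal (1 / Suc m)) \<longlonglongrightarrow> 0" by simp
    qed (use K(3) in \<open>auto intro!: always_eventually less_imp_le\<close>)
    have "(\<lambda>m. emeasure \<mu> (A - K m) * ennreal \<bar>c\<bar>) \<longlonglongrightarrow> 0 * ennreal \<bar>c\<bar>"
      by (intro tendsto_mult_ennreal z tendsto_const) auto
    then show "(\<lambda>m. \<integral>\<^sup>+ y. ennreal \<bar>indicator A y * c - indicator (K m) y * c\<bar> \<partial>\<mu>) \<longlonglongrightarrow> 0"
      unfolding eq by simp
  qed
qed

lemma sq_conv_integrable:
  assumes "integrable \<mu> f"
  shows "sq_conv f"
  using assms
proof (induction rule: integrable_induct)
  case (base A c)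
  then show ?case using sq_conv_indicator[of A c] by (simp add: sets_planar)
next
  case (add f g)
  show ?case
    unfolding sq_conv_def
  proof (rule tendsto_sandwich[OF _ _ tendsto_const])
    have "(\<lambda>k. sq_err f (1 / Suc k) + sq_err g (1 / Suc k)) \<longlonglongrightarrow> 0 + 0"
      using add unfolding sq_conv_def by (intro tendsto_add)
    then show "(\<lambda>k. sq_err f (1 / Suc k) + sq_err g (1 / Suc k)) \<longlonglongrightarrow> 0" by simp
  qed (use add in \<open>auto intro!: always_eventually sq_err_add\<close>)
next
  case (lim f s)
  have [measurable]: "f \<in> borel_measurable \<mu>" "\<And>i. s i \<in> borel_measurable \<mu>"
    using lim by simp_all
  have s_bound: "\<And>i x. x \<in> space \<mu> \<Longrightarrow> norm (s i x) \<le> 2 * norm (f x)"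
    and s_lim: "\<And>x. x \<in> space \<mu> \<Longrightarrow> (\<lambda>i. s i x) \<longlonglongrightarrow> f x"
    using lim by blast+
  show ?case
  proof (rule sq_conv_close)
    have "(\<lambda>i. \<integral>\<^sup>+ y. ennreal \<bar>f y - s i y\<bar> \<partial>\<mu>) \<longlonglongrightarrow> (\<integral>\<^sup>+ y. 0 \<partial>\<mu>)"
    proof (rule nn_integral_dominated_convergence[where w="\<lambda>y. 3 * ennreal \<bar>f y\<bar>"])
      have "(\<integral>\<^sup>+ y. ennreal \<bar>f y\<bar> \<partial>\<mu>) < \<infinity>"
        using \<open>integrable \<mu> f\<close> by (simp add: integrable_iff_bounded)
      then show "(\<integral>\<^sup>+ y. 3 * ennreal \<bar>f y\<bar> \<partial>\<mu>) < \<infinity>"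
        by (subst nn_integral_cmult) (auto simp: ennreal_mult_less_top)
      show "AE y in \<mu>. ennreal \<bar>f y - s i y\<bar> \<le> 3 * ennreal \<bar>f y\<bar>" for i
      proof (rule AE_I2)
        fix y assume "y \<in> space \<mu>"
        then have "\<bar>f y - s i y\<bar> \<le> 3 * \<bar>f y\<bar>" using s_bound[of y i] by simp
        then have "ennreal \<bar>f y - s i y\<bar> \<le> ennreal (3 * \<bar>f y\<bar>)" by (rule ennreal_leI)
        then show "ennreal \<bar>f y - s i y\<bar> \<le> 3 * ennreal \<bar>f y\<bar>" by (simp add: ennreal_mult)
      qed
      show "AE y in \<mu>. (\<lambda>i. ennreal \<bar>f y - s i y\<bar>) \<longlonglongrightarrow> 0"
      proof (rule AE_I2)
        fix y assume "y \<in> space \<mu>"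
        then have "(\<lambda>i. ennreal \<bar>f y - s i y\<bar>) \<longlonglongrightarrow> ennreal \<bar>f y - f y\<bar>"
          using s_lim by (intro tendsto_ennrealI tendsto_rabs tendsto_diff tendsto_const)
        then show "(\<lambda>i. ennreal \<bar>f y - s i y\<bar>) \<longlonglongrightarrow> 0" by simp
      qed
    qed measurable
    then show "(\<lambda>i. \<integral>\<^sup>+ y. ennreal \<bar>f y - s i y\<bar> \<partial>\<mu>) \<longlonglongrightarrow> 0" by simp
  qed (use lim in auto)
qed

text \<open>Wherever the square averages of \<open>f\<close> have a pointwise limit, Fatou's lemma identifies it with \<open>f\<close>.
  Existence of the limit is not claimed.\<close>

lemma density_eq_sq_limit:
  assumes f: "integrable \<mu> f"
  shows "AE \<theta> in \<mu>. \<forall>c. (\<lambda>k. sq_avg f (1 / Suc k) \<theta>) \<longlonglongrightarrow> c \<longrightarrow> c = f \<theta>"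
proof -
  have [measurable]: "f \<in> borel_measurable \<mu>" using f by simp
  have "(\<integral>\<^sup>+ \<theta>. liminf (\<lambda>k. ennreal \<bar>sq_avg f (1 / Suc k) \<theta> - f \<theta>\<bar>) \<partial>\<mu>)
      \<le> liminf (\<lambda>k. sq_err f (1 / Suc k))"
    unfolding sq_err_def by (intro nn_integral_liminf) measurable
  also have "\<dots> = 0"
    using sq_conv_integrable[OF f] unfolding sq_conv_def by (intro lim_imp_Liminf) auto
  finally have "(\<integral>\<^sup>+ \<theta>. liminf (\<lambda>k. ennreal \<bar>sq_avg f (1 / Suc k) \<theta> - f \<theta>\<bar>) \<partial>\<mu>) = 0" by simp
  then have "AE \<theta> in \<mu>. liminf (\<lambda>k. ennreal \<bar>sq_avg f (1 / Suc k) \<theta> - f \<theta>\<bar>) = 0"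
    by (subst (asm) nn_integral_0_iff_AE) measurable
  then show ?thesis
  proof (eventually_elim, intro allI impI)
    fix \<theta> c
    assume *: "liminf (\<lambda>k. ennreal \<bar>sq_avg f (1 / Suc k) \<theta> - f \<theta>\<bar>) = 0"
      and c: "(\<lambda>k. sq_avg f (1 / Suc k) \<theta>) \<longlonglongrightarrow> c"
    have "(\<lambda>k. ennreal \<bar>sq_avg f (1 / Suc k) \<theta> - f \<theta>\<bar>) \<longlonglongrightarrow> ennreal \<bar>c - f \<theta>\<bar>"
      by (intro tendsto_ennrealI tendsto_rabs tendsto_diff c tendsto_const)
    then have "liminf (\<lambda>k. ennreal \<bar>sq_avg f (1 / Suc k) \<theta> - f \<theta>\<bar>) = ennreal \<bar>c - f \<theta>\<bar>"
      by (intro lim_imp_Liminf) auto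
    with * show "c = f \<theta>" by simp
  qed
qed

lemma density_of_sq_limit:
  assumes fin: "finite_measure \<nu>" and sets: "sets \<nu> = sets borel" and ac: "absolutely_continuous \<mu> \<nu>"
  obtains D where "D \<in> borel_measurable \<mu>" "\<And>\<theta>. 0 \<le> D \<theta>"
    "\<And>B. B \<in> sets borel \<Longrightarrow> emeasure \<nu> B = (\<integral>\<^sup>+ \<theta>. ennreal (D \<theta>) * indicator B \<theta> \<partial>\<mu>)"
    "AE \<theta> in \<mu>. \<forall>c. (\<lambda>k. measure \<nu> (sq \<theta> (1 / Suc k)) / measure \<mu> (sq \<theta> (1 / Suc k))) \<longlonglongrightarrow> c \<longrightarrow> c = D \<theta>"
proof -
  interpret N: finite_measure \<nu> by fact
  have sets': "sets \<nu> = sets \<mu>" using sets sets_planar by simp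
  obtain D where D [measurable]: "D \<in> borel_measurable \<mu>"
    and RN: "AE \<theta> in \<mu>. RN_deriv \<mu> \<nu> \<theta> = ennreal (D \<theta>)" and nn: "\<And>\<theta>. 0 \<le> D \<theta>"
    using real_RN_deriv[OF fin ac sets'] by blast
  have eq: "emeasure \<nu> B = (\<integral>\<^sup>+ \<theta>. ennreal (D \<theta>) * indicator B \<theta> \<partial>\<mu>)" if "B \<in> sets borel" for B
  proof -
    have "emeasure \<nu> B = emeasure (density \<mu> (RN_deriv \<mu> \<nu>)) B"
      by (simp add: density_RN_deriv[OF ac sets'])
    also have "\<dots> = (\<integral>\<^sup>+ \<theta>. RN_deriv \<mu> \<nu> \<theta> * indicator B \<theta> \<partial>\<mu>)"
      using that by (intro emeasure_density) (auto simp: sets_planar)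
    also have "\<dots> = (\<integral>\<^sup>+ \<theta>. ennreal (D \<theta>) * indicator B \<theta> \<partial>\<mu>)"
      using RN by (intro nn_integral_cong_AE) auto
    finally show ?thesis .
  qed
  have int: "integrable \<mu> D"
  proof (rule integrableI_nonneg)
    show "(\<integral>\<^sup>+ \<theta>. ennreal (D \<theta>) \<partial>\<mu>) < \<infinity>"
      using eq[of UNIV] N.emeasure_finite[of UNIV] by (simp add: top.not_eq_extremum)
  qed (auto simp: nn)
  have "sq_avg D \<delta> \<theta> = measure \<nu> (sq \<theta> \<delta>) / measure \<mu> (sq \<theta> \<delta>)" for \<delta> \<theta>
  proof -
    have "ennreal (\<integral>y. indicator (sq \<theta> \<delta>) y * D y \<partial>\<mu>) = (\<integral>\<^sup>+ y. ennreal (indicator (sq \<theta> \<delta>) y * D y) \<partial>\<mu>)"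
      using integrable_mult_indicator[OF _ int, of "sq \<theta> \<delta>"]
      by (intro nn_integral_eq_integral[symmetric]) (auto simp: sets_planar nn)
    also have "\<dots> = emeasure \<nu> (sq \<theta> \<delta>)"
      unfolding eq[OF sq_measurable] by (intro nn_integral_cong) (auto simp: indicator_def)
    finally have "(\<integral>y. indicator (sq \<theta> \<delta>) y * D y \<partial>\<mu>) = measure \<nu> (sq \<theta> \<delta>)"
      using nn by (subst (asm) N.emeasure_eq_measure, subst (asm) ennreal_inj) (auto intro!: integral_nonneg_AE)
    then show ?thesis by (simp add: sq_avg_def)
  qed
  with density_eq_sq_limit[OF int]
  have "AE \<theta> in \<mu>. \<forall>c. (\<lambda>k. measure \<nu> (sq \<theta> (1 / Suc k)) / measure \<mu> (sq \<theta> (1 / Suc k))) \<longlonglongrightarrow> c \<longrightarrow> c = D \<theta>"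
    by simp
  with D nn eq show ?thesis by (rule that)
qed

end

context prob_space
begin

text \<open>The law of a pair of weights restricted to an event, as a measure dominated by the law of the pair.\<close>

lemma restricted_pair_law:
  fixes T T' :: "'a \<Rightarrow> real"
  assumes [measurable]: "T \<in> borel_measurable M" "T' \<in> borel_measurable M" "Measurable.pred M A"
  defines "\<nu> \<equiv> distr (density M (indicator {\<omega>\<in>space M. A \<omega>})) borel (\<lambda>\<omega>. (T \<omega>, T' \<omega>))"
  shows "B \<in> sets borel \<Longrightarrow> emeasure \<nu> B = ennreal \<P>(\<omega> in M. A \<omega> \<and> (T \<omega>, T' \<omega>) \<in> B)"
    and "B \<in> sets borel \<Longrightarrow> measure \<nu> B = \<P>(\<omega> in M. A \<omega> \<and> (T \<omega>, T' \<omega>) \<in> B)"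
    and "finite_measure \<nu>"
    and "absolutely_continuous (distr M borel (\<lambda>\<omega>. (T \<omega>, T' \<omega>))) \<nu>"
proof -
  have *: "emeasure \<nu> B = ennreal \<P>(\<omega> in M. A \<omega> \<and> (T \<omega>, T' \<omega>) \<in> B)" if [measurable]: "B \<in> sets borel" for B
  proof -
    have "emeasure \<nu> B = (\<integral>\<^sup>+ \<omega>. indicator {\<omega>\<in>space M. A \<omega>} \<omega> * indicator ((\<lambda>\<omega>. (T \<omega>, T' \<omega>)) -` B \<inter> space M) \<omega> \<partial>M)"
      unfolding \<nu>_def by (subst emeasure_distr) (auto simp: emeasure_density)
    also have "\<dots> = (\<integral>\<^sup>+ \<omega>. indicator {\<omega>\<in>space M. A \<omega> \<and> (T \<omega>, T' \<omega>) \<in> B} \<omega> \<partial>M)"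
      by (intro nn_integral_cong) (auto simp: indicator_def)
    finally show ?thesis by (simp add: emeasure_eq_measure)
  qed
  show "B \<in> sets borel \<Longrightarrow> emeasure \<nu> B = ennreal \<P>(\<omega> in M. A \<omega> \<and> (T \<omega>, T' \<omega>) \<in> B)"
    by (rule *)
  show "B \<in> sets borel \<Longrightarrow> measure \<nu> B = \<P>(\<omega> in M. A \<omega> \<and> (T \<omega>, T' \<omega>) \<in> B)"
    using * by (simp add: measure_def)
  show "finite_measure \<nu>"
    using *[of UNIV] by (intro finite_measureI) (auto simp: \<nu>_def)
  show "absolutely_continuous (distr M borel (\<lambda>\<omega>. (T \<omega>, T' \<omega>))) \<nu>"
    unfolding absolutely_continuous_def
  proof
    fix B assume "B \<in> null_sets (distr M borel (\<lambda>\<omega>. (T \<omega>, T' \<omega>)))"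
    then have B [measurable]: "B \<in> sets borel" and 0: "emeasure M ((\<lambda>\<omega>. (T \<omega>, T' \<omega>)) -` B \<inter> space M) = 0"
      by (auto simp: null_sets_def emeasure_distr)
    have "\<P>(\<omega> in M. A \<omega> \<and> (T \<omega>, T' \<omega>) \<in> B) \<le> measure M ((\<lambda>\<omega>. (T \<omega>, T' \<omega>)) -` B \<inter> space M)"
      by (intro finite_measure_mono) auto
    also have "\<dots> = 0" using 0 by (simp add: measure_def)
    finally have "\<P>(\<omega> in M. A \<omega> \<and> (T \<omega>, T' \<omega>) \<in> B) = 0"
      by (simp add: measure_le_0_iff)
    then show "B \<in> null_sets \<nu>"
      using *[OF B] B by (auto simp: null_sets_def \<nu>_def)
  qed
qed

text \<open>An inequality between pointwise conditional probabilities integrates to an inequality between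
  joint probabilities, because both limits are densities with respect to the law of the weights.\<close>

lemma cond2_compare:
  fixes T T' :: "'a \<Rightarrow> real"
  assumes T [measurable]: "T \<in> borel_measurable M" "T' \<in> borel_measurable M"
    and A [measurable]: "Measurable.pred M A1" "Measurable.pred M A2"
    and K: "0 \<le> K"
    and ex: "AE \<omega> in M. cond2_exists M A1 T T' (T \<omega>, T' \<omega>) \<and> cond2_exists M A2 T T' (T \<omega>, T' \<omega>)"
    and le: "AE \<omega> in M. cond2 M A1 T T' (T \<omega>, T' \<omega>) \<le> K * cond2 M A2 T T' (T \<omega>, T' \<omega>)"
    and B [measurable]: "B \<in> sets borel"
  shows "\<P>(\<omega> in M. A1 \<omega> \<and> (T \<omega>, T' \<omega>) \<in> B) \<le> K * \<P>(\<omega> in M. A2 \<omega> \<and> (T \<omega>, T' \<omega>) \<in> B)"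
proof -
  define W where "W \<omega> = (T \<omega>, T' \<omega>)" for \<omega>
  have W [measurable]: "W \<in> borel_measurable M" unfolding W_def by measurable
  define \<mu> where "\<mu> = distr M borel W"
  interpret mu: prob_space \<mu> unfolding \<mu>_def by (rule prob_space_distr) measurable
  interpret planar_measure \<mu> by unfold_locales (simp add: \<mu>_def)
  have key: "\<exists>D. D \<in> borel_measurable borel \<and> (\<forall>\<theta>. 0 \<le> D \<theta>)
      \<and> (\<forall>B\<in>sets borel. ennreal \<P>(\<omega> in M. A \<omega> \<and> W \<omega> \<in> B) = (\<integral>\<^sup>+ \<omega>. ennreal (D (W \<omega>)) * indicator B (W \<omega>) \<partial>M))
      \<and> (AE \<omega> in M. cond2_exists M A T T' (W \<omega>) \<longrightarrow> cond2 M A T T' (W \<omega>) = D (W \<omega>))"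
    if A [measurable]: "Measurable.pred M A" for A
  proof -
    define \<nu> where "\<nu> = distr (density M (indicator {\<omega>\<in>space M. A \<omega>})) borel W"
    note law = restricted_pair_law[OF T A, folded W_def, folded \<nu>_def]
    obtain D where D: "D \<in> borel_measurable \<mu>" "\<And>\<theta>. 0 \<le> D \<theta>"
      "\<And>B. B \<in> sets borel \<Longrightarrow> emeasure \<nu> B = (\<integral>\<^sup>+ \<theta>. ennreal (D \<theta>) * indicator B \<theta> \<partial>\<mu>)"
      "AE \<theta> in \<mu>. \<forall>c. (\<lambda>k. measure \<nu> (sq \<theta> (1 / Suc k)) / measure \<mu> (sq \<theta> (1 / Suc k))) \<longlonglongrightarrow> c \<longrightarrow> c = D \<theta>"
      using density_of_sq_limit[OF law(3) _ law(4)[folded \<mu>_def]] by (auto simp: \<nu>_def)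
    have Db [measurable]: "D \<in> borel_measurable borel"
      using D(1) by (simp cong: measurable_cong_sets add: sets_planar)
    have "ennreal \<P>(\<omega> in M. A \<omega> \<and> W \<omega> \<in> B) = (\<integral>\<^sup>+ \<omega>. ennreal (D (W \<omega>)) * indicator B (W \<omega>) \<partial>M)"
      if [measurable]: "B \<in> sets borel" for B
    proof -
      have "ennreal \<P>(\<omega> in M. A \<omega> \<and> W \<omega> \<in> B) = (\<integral>\<^sup>+ \<theta>. ennreal (D \<theta>) * indicator B \<theta> \<partial>\<mu>)"
        using law(1)[OF that] D(3)[OF that] by simp
      also have "\<dots> = (\<integral>\<^sup>+ \<omega>. ennreal (D (W \<omega>)) * indicator B (W \<omega>) \<partial>M)"
        unfolding \<mu>_def by (intro nn_integral_distr) measurable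
      finally show ?thesis .
    qed
    moreover have "AE \<omega> in M. cond2_exists M A T T' (W \<omega>) \<longrightarrow> cond2 M A T T' (W \<omega>) = D (W \<omega>)"
      using AE_distrD[OF W D(4)[unfolded \<mu>_def]]
    proof eventually_elim
      case (elim \<omega>)
      show ?case
      proof
        assume "cond2_exists M A T T' (W \<omega>)"
        then obtain p where p: "(cond2_approx M A T T' (W \<omega>) \<longlongrightarrow> p) (at_right 0)"
          by (auto simp: cond2_exists_def)
        have fl: "filterlim (\<lambda>k. 1 / real (Suc k)) (at_right 0) sequentially"
          unfolding filterlim_at using LIMSEQ_Suc[OF lim_1_over_n] by (simp add: always_eventually)
        have "cond2_approx M A T T' \<theta> \<delta> = measure \<nu> (sq \<theta> \<delta>) / measure \<mu> (sq \<theta> \<delta>)" for \<theta> \<delta>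
        proof -
          have "measure \<mu> (sq \<theta> \<delta>) = \<P>(\<omega> in M. W \<omega> \<in> sq \<theta> \<delta>)"
            unfolding \<mu>_def by (subst measure_distr) (auto intro!: arg_cong[where f="measure M"])
          then show ?thesis
            unfolding cond2_approx_def cond_prob_def law(2)[OF sq_measurable]
            by (simp add: W_def sq_def)
        qed
        with filterlim_compose[OF p fl]
        have "(\<lambda>k. measure \<nu> (sq (W \<omega>) (1 / Suc k)) / measure \<mu> (sq (W \<omega>) (1 / Suc k))) \<longlonglongrightarrow> p"
          by simp
        with elim[folded \<mu>_def] have "p = D (W \<omega>)" by blast
        then show "cond2 M A T T' (W \<omega>) = D (W \<omega>)"
          using p unfolding cond2_def by (simp add: tendsto_Lim)
      qed
    qed
    ultimately show ?thesis using Db D(2) by blast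
  qed
  obtain D1 where D1 [measurable]: "D1 \<in> borel_measurable borel" and D1_nn: "\<And>\<theta>. 0 \<le> D1 \<theta>"
    and D1_eq: "\<And>B. B \<in> sets borel \<Longrightarrow> ennreal \<P>(\<omega> in M. A1 \<omega> \<and> W \<omega> \<in> B) = (\<integral>\<^sup>+ \<omega>. ennreal (D1 (W \<omega>)) * indicator B (W \<omega>) \<partial>M)"
    and D1_AE: "AE \<omega> in M. cond2_exists M A1 T T' (W \<omega>) \<longrightarrow> cond2 M A1 T T' (W \<omega>) = D1 (W \<omega>)"
    using key[OF A(1)] by blast
  obtain D2 where D2 [measurable]: "D2 \<in> borel_measurable borel" and D2_nn: "\<And>\<theta>. 0 \<le> D2 \<theta>"
    and D2_eq: "\<And>B. B \<in> sets borel \<Longrightarrow> ennreal \<P>(\<omega> in M. A2 \<omega> \<and> W \<omega> \<in> B) = (\<integral>\<^sup>+ \<omega>. ennreal (D2 (W \<omega>)) * indicator B (W \<omega>) \<partial>M)"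
    and D2_AE: "AE \<omega> in M. cond2_exists M A2 T T' (W \<omega>) \<longrightarrow> cond2 M A2 T T' (W \<omega>) = D2 (W \<omega>)"
    using key[OF A(2)] by blast
  have leD: "AE \<omega> in M. D1 (W \<omega>) \<le> K * D2 (W \<omega>)"
    using D1_AE D2_AE ex le unfolding W_def by eventually_elim auto
  have "ennreal \<P>(\<omega> in M. A1 \<omega> \<and> W \<omega> \<in> B) \<le> (\<integral>\<^sup>+ \<omega>. ennreal K * (ennreal (D2 (W \<omega>)) * indicator B (W \<omega>)) \<partial>M)"
    unfolding D1_eq[OF B]
  proof (intro nn_integral_mono_AE)
    show "AE \<omega> in M. ennreal (D1 (W \<omega>)) * indicator B (W \<omega>) \<le> ennreal K * (ennreal (D2 (W \<omega>)) * indicator B (W \<omega>))"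
      using leD
    proof eventually_elim
      case (elim \<omega>)
      then have "ennreal (D1 (W \<omega>)) \<le> ennreal K * ennreal (D2 (W \<omega>))"
        using K D2_nn[of "W \<omega>"] by (simp add: ennreal_mult'[symmetric] ennreal_leI)
      then show ?case by (auto simp: indicator_def)
    qed
  qed
  also have "\<dots> = ennreal K * ennreal \<P>(\<omega> in M. A2 \<omega> \<and> W \<omega> \<in> B)"
    unfolding D2_eq[OF B] by (intro nn_integral_cmult) measurable
  finally show ?thesis
    using K by (simp add: ennreal_mult'[symmetric] W_def)
qed

text \<open>Conditioning on one weight is conditioning on a pair whose second entry is constant.\<close>

lemma cond1_approx_eq_cond2_approx:
  "\<delta> > 0 \<Longrightarrow> cond1_approx M A T \<theta> \<delta> = cond2_approx M A T (\<lambda>_. 0) (\<theta>, 0) \<delta>"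
  by (simp add: cond1_approx_def cond2_approx_def)

lemma cond1_limit_iff:
  "(cond1_approx M A T \<theta> \<longlongrightarrow> p) (at_right 0) \<longleftrightarrow> (cond2_approx M A T (\<lambda>_. 0) (\<theta>, 0) \<longlongrightarrow> p) (at_right 0)"
  by (intro tendsto_cong) (auto simp: eventually_at_filter cond1_approx_eq_cond2_approx)

lemma cond1_compare:
  fixes T :: "'a \<Rightarrow> real"
  assumes T [measurable]: "T \<in> borel_measurable M"
    and A [measurable]: "Measurable.pred M A1" "Measurable.pred M A2"
    and K: "0 \<le> K"
    and ex: "AE \<omega> in M. cond1_exists M A1 T (T \<omega>) \<and> cond1_exists M A2 T (T \<omega>)"
    and le: "AE \<omega> in M. cond1 M A1 T (T \<omega>) \<le> K * cond1 M A2 T (T \<omega>)"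
    and B [measurable]: "B \<in> sets borel"
  shows "\<P>(\<omega> in M. A1 \<omega> \<and> T \<omega> \<in> B) \<le> K * \<P>(\<omega> in M. A2 \<omega> \<and> T \<omega> \<in> B)"
proof -
  have eq: "cond1 M A T \<theta> = cond2 M A T (\<lambda>_. 0) (\<theta>, 0)" for A \<theta>
    unfolding cond1_def cond2_def t2_space_class.Lim_def by (simp add: cond1_limit_iff)
  have "\<P>(\<omega> in M. A1 \<omega> \<and> (T \<omega>, 0::real) \<in> B \<times> UNIV) \<le> K * \<P>(\<omega> in M. A2 \<omega> \<and> (T \<omega>, 0::real) \<in> B \<times> UNIV)"
  proof (rule cond2_compare[where T'="\<lambda>_. 0"])
    show "B \<times> (UNIV :: real set) \<in> sets borel"
      unfolding borel_prod[symmetric] by measurable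
  qed (use ex le K in \<open>auto simp: cond1_exists_def cond2_exists_def cond1_limit_iff eq\<close>)
  then show ?thesis by simp
qed

end

section \<open>Supports and random levels\<close>

context prob_space
begin

lemma AE_rv_support:
  assumes T [measurable]: "T \<in> borel_measurable M"
  shows "AE \<omega> in M. T \<omega> \<in> rv_support M T"
proof -
  define W where "W \<omega> = (T \<omega>, 0::real)" for \<omega>
  have W [measurable]: "W \<in> borel_measurable M" unfolding W_def by measurable
  interpret mu: prob_space "distr M borel W" by (rule prob_space_distr) measurable
  interpret planar_measure "distr M borel W" by unfold_locales simp
  have eq: "measure (distr M borel W) (sq (W \<omega>) \<delta>) = \<P>(\<omega>' in M. T \<omega>' \<in> {T \<omega> - \<delta>..T \<omega> + \<delta>})"
    if "\<delta> > 0" for \<omega> \<delta>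
    using that by (subst measure_distr[OF W]) (auto simp: W_def mem_sq intro!: arg_cong[where f="measure M"])
  show ?thesis
    using AE_distrD[OF W AE_sq_pos] by eventually_elim (auto simp: rv_support_def eq)
qed

lemma rv_support_cong:
  assumes [measurable]: "T \<in> borel_measurable M" "T' \<in> borel_measurable M"
    and eq: "distr M borel T = distr M borel T'"
  shows "rv_support M T = rv_support M T'"
proof -
  have "\<P>(\<omega> in M. T \<omega> \<in> {a..b}) = \<P>(\<omega> in M. T' \<omega> \<in> {a..b})" for a b :: real
  proof -
    have "\<P>(\<omega> in M. T \<omega> \<in> {a..b}) = measure (distr M borel T) {a..b}"
      by (subst measure_distr) (auto intro!: arg_cong[where f="measure M"])
    also have "\<dots> = \<P>(\<omega> in M. T' \<omega> \<in> {a..b})"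
      unfolding eq by (subst measure_distr) (auto intro!: arg_cong[where f="measure M"])
    finally show ?thesis .
  qed
  then show ?thesis by (simp add: rv_support_def)
qed

lemma prob_le_add:
  assumes [measurable]: "Measurable.pred M A" "Measurable.pred M B"
    and sub: "AE \<omega> in M. E \<omega> \<longrightarrow> A \<omega> \<or> B \<omega>"
  shows "\<P>(\<omega> in M. E \<omega>) \<le> \<P>(\<omega> in M. A \<omega>) + \<P>(\<omega> in M. B \<omega>)"
proof -
  have "\<P>(\<omega> in M. E \<omega>) \<le> measure M ({\<omega>\<in>space M. A \<omega>} \<union> {\<omega>\<in>space M. B \<omega>})"
    by (rule finite_measure_mono_AE) (use sub in auto)
  also have "\<dots> \<le> \<P>(\<omega> in M. A \<omega>) + \<P>(\<omega> in M. B \<omega>)"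
    by (intro measure_Un_le) measurable
  finally show ?thesis .
qed

text \<open>A comparison of the joint laws of \<open>(Z1, W)\<close> and \<open>(Z2, W)\<close> at constant levels passes to levels \<open>u W\<close>
  that depend on \<open>W\<close>. Replacing \<open>u\<close> by a dyadic function \<open>U l > u\<close> splits the events into countably many
  pieces with constant level, and as \<open>U l\<close> decreases to \<open>u\<close> the events increase to those at level \<open>u W\<close>.
  The event \<open>A\<close> carries a condition on a further variable; it is \<open>True\<close> where there is none.\<close>

lemma prob_staircase_le:
  fixes Z1 Z2 W :: "'a \<Rightarrow> real"
  assumes [measurable]: "Z1 \<in> borel_measurable M" "Z2 \<in> borel_measurable M" "W \<in> borel_measurable M"
      "Measurable.pred M A" "u \<in> borel_measurable borel" "D \<in> sets borel"
    and K: "0 \<le> K"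
    and le: "\<And>r B. r \<ge> r0 \<Longrightarrow> B \<in> sets borel \<Longrightarrow>
      \<P>(\<omega> in M. A \<omega> \<and> r < Z1 \<omega> \<and> W \<omega> \<in> B) \<le> K * \<P>(\<omega> in M. r < Z2 \<omega> \<and> W \<omega> \<in> B)"
    and u: "\<And>w. w \<in> D \<Longrightarrow> r0 \<le> u w"
  shows "\<P>(\<omega> in M. A \<omega> \<and> u (W \<omega>) < Z1 \<omega> \<and> W \<omega> \<in> D) \<le> K * \<P>(\<omega> in M. u (W \<omega>) < Z2 \<omega> \<and> W \<omega> \<in> D)"
proof -
  define U where "U l w = (of_int \<lfloor>2 ^ l * u w\<rfloor> + 1) / (2 ^ l :: real)" for l :: nat and w
  have U_gt: "u w < U l w" for l w
  proof -
    have "2 ^ l * u w < of_int \<lfloor>2 ^ l * u w\<rfloor> + 1" by linarith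
    then show ?thesis by (simp add: U_def field_simps)
  qed
  have U_dec: "U (Suc l) w \<le> U l w" for l w
  proof -
    have "\<lfloor>2 * y\<rfloor> < 2 * (\<lfloor>y\<rfloor> + 1)" for y :: real
      unfolding floor_less_iff by simp linarith
    then have "\<lfloor>2 * y\<rfloor> + 1 \<le> 2 * (\<lfloor>y\<rfloor> + 1)" for y :: real by (simp add: zless_imp_add1_zle)
    then have "real_of_int (\<lfloor>2 * (2 ^ l * u w)\<rfloor> + 1) \<le> real_of_int (2 * (\<lfloor>2 ^ l * u w\<rfloor> + 1))"
      by (simp only: of_int_le_iff)
    then have "real_of_int (\<lfloor>2 * (2 ^ l * u w)\<rfloor> + 1) / (2 * 2 ^ l) \<le> real_of_int (2 * (\<lfloor>2 ^ l * u w\<rfloor> + 1)) / (2 * 2 ^ l)"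
      by (intro divide_right_mono) auto
    then show ?thesis by (simp add: U_def mult.assoc add_divide_distrib)
  qed
  have U_lim: "\<exists>l. U l w < z" if "u w < z" for w z
  proof -
    obtain l :: nat where l: "1 / (z - u w) < 2 ^ l"
      using real_arch_pow[of 2 "1 / (z - u w)"] by auto
    have "of_int \<lfloor>2 ^ l * u w\<rfloor> \<le> 2 ^ l * u w" by linarith
    then have "U l w \<le> u w + 1 / 2 ^ l" by (simp add: U_def field_simps)
    moreover have "1 / 2 ^ l < z - u w" using l that by (simp add: field_simps)
    ultimately show ?thesis by (intro exI[of _ l]) linarith
  qed
  have [measurable]: "U l \<in> borel_measurable borel" for l
    unfolding U_def[abs_def] by measurable
  have step: "\<P>(\<omega> in M. A \<omega> \<and> U l (W \<omega>) < Z1 \<omega> \<and> W \<omega> \<in> D) \<le> K * \<P>(\<omega> in M. U l (W \<omega>) < Z2 \<omega> \<and> W \<omega> \<in> D)" for l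
  proof -
    define q where "q k = (of_int (int_decode k) + 1) / (2 ^ l :: real)" for k
    define B where "B k = {w \<in> D. \<lfloor>2 ^ l * u w\<rfloor> = int_decode k}" for k
    have B [measurable]: "B k \<in> sets borel" for k unfolding B_def by measurable
    have BU: "U l w = q k" if "w \<in> B k" for w k using that by (simp add: B_def U_def q_def)
    have B_ex: "\<exists>k. w \<in> B k" if "w \<in> D" for w
      using that by (intro exI[of _ "int_encode \<lfloor>2 ^ l * u w\<rfloor>"]) (simp add: B_def)
    have B_un: "k = k'" if "w \<in> B k" "w \<in> B k'" for w k k'
      using that by (simp add: B_def) (metis int_decode_inverse)
    have dec: "(\<lambda>k. \<P>(\<omega> in M. C \<omega> \<and> q k < Z \<omega> \<and> W \<omega> \<in> B k)) sums \<P>(\<omega> in M. C \<omega> \<and> U l (W \<omega>) < Z \<omega> \<and> W \<omega> \<in> D)"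
      if [measurable]: "Measurable.pred M C" "Z \<in> borel_measurable M" for C and Z :: "'a \<Rightarrow> real"
    proof -
      have "(\<lambda>k. \<P>(\<omega> in M. C \<omega> \<and> q k < Z \<omega> \<and> W \<omega> \<in> B k)) sums
          measure M (\<Union>k. {\<omega> \<in> space M. C \<omega> \<and> q k < Z \<omega> \<and> W \<omega> \<in> B k})"
        by (intro finite_measure_UNION) (auto simp: disjoint_family_on_def dest: B_un)
      also have "(\<Union>k. {\<omega> \<in> space M. C \<omega> \<and> q k < Z \<omega> \<and> W \<omega> \<in> B k})
          = {\<omega> \<in> space M. C \<omega> \<and> U l (W \<omega>) < Z \<omega> \<and> W \<omega> \<in> D}"
      proof (safe, goal_cases)
        case (1 x k) then show ?case using BU by metis
      next
        case (2 x k) then show ?case by (simp add: B_def)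
      next
        case (3 x)
        then obtain k where "W x \<in> B k" using B_ex by blast
        with 3 BU show ?case by force
      qed
      finally show ?thesis .
    qed
    have "\<P>(\<omega> in M. A \<omega> \<and> q k < Z1 \<omega> \<and> W \<omega> \<in> B k) \<le> K * \<P>(\<omega> in M. True \<and> q k < Z2 \<omega> \<and> W \<omega> \<in> B k)" for k
    proof (cases "B k = {}")
      case False
      then obtain w where w: "w \<in> B k" by blast
      then have "r0 \<le> q k" using u[of w] U_gt[of w l] BU[OF w] by (simp add: B_def)
      then show ?thesis using le B by simp
    qed simp
    then have "\<P>(\<omega> in M. A \<omega> \<and> U l (W \<omega>) < Z1 \<omega> \<and> W \<omega> \<in> D) \<le> K * \<P>(\<omega> in M. True \<and> U l (W \<omega>) < Z2 \<omega> \<and> W \<omega> \<in> D)"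
      by (rule sums_le[OF _ dec sums_mult[OF dec]]) measurable
    then show ?thesis by simp
  qed
  have "(\<lambda>l. \<P>(\<omega> in M. A \<omega> \<and> U l (W \<omega>) < Z1 \<omega> \<and> W \<omega> \<in> D))
      \<longlonglongrightarrow> measure M (\<Union>l. {\<omega> \<in> space M. A \<omega> \<and> U l (W \<omega>) < Z1 \<omega> \<and> W \<omega> \<in> D})"
    by (intro finite_Lim_measure_incseq incseq_SucI) (auto intro: le_less_trans[OF U_dec])
  also have "(\<Union>l. {\<omega> \<in> space M. A \<omega> \<and> U l (W \<omega>) < Z1 \<omega> \<and> W \<omega> \<in> D})
      = {\<omega> \<in> space M. A \<omega> \<and> u (W \<omega>) < Z1 \<omega> \<and> W \<omega> \<in> D}"
    using U_lim by (auto intro: less_trans[OF U_gt])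
  finally show ?thesis
  proof (rule LIMSEQ_le_const2, intro exI allI impI)
    fix l
    have "\<P>(\<omega> in M. U l (W \<omega>) < Z2 \<omega> \<and> W \<omega> \<in> D) \<le> \<P>(\<omega> in M. u (W \<omega>) < Z2 \<omega> \<and> W \<omega> \<in> D)"
      by (intro finite_measure_mono) (auto intro: less_trans[OF U_gt])
    then show "\<P>(\<omega> in M. A \<omega> \<and> U l (W \<omega>) < Z1 \<omega> \<and> W \<omega> \<in> D) \<le> K * \<P>(\<omega> in M. u (W \<omega>) < Z2 \<omega> \<and> W \<omega> \<in> D)"
      using step[of l] K by (meson mult_left_mono order_trans)
  qed
qed

end

section \<open>The tail of one product\<close>

text \<open>The three tail conditions as one-sided inequalities for a function. For the tail of a distribution
  satisfying \<^const>\<open>pos_tail\<close> they are equivalent to membership in the three classes, because tails decrease.\<close>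

definition dominated_tail :: "(real \<Rightarrow> real) \<Rightarrow> bool"
  where "dominated_tail f \<longleftrightarrow> (\<forall>v. 0 < v \<and> v < 1 \<longrightarrow> (\<exists>K. \<forall>\<^sub>F x in at_top. f (v * x) \<le> K * f x))"

definition long_tail :: "(real \<Rightarrow> real) \<Rightarrow> bool"
  where "long_tail f \<longleftrightarrow> (\<forall>a>0. \<forall>e>0. \<forall>\<^sub>F x in at_top. f (x - a) \<le> (1 + e) * f x)"

definition consistent_tail :: "(real \<Rightarrow> real) \<Rightarrow> bool"
  where "consistent_tail f \<longleftrightarrow> (\<forall>e>0. \<exists>v. 0 < v \<and> v < 1 \<and> (\<forall>\<^sub>F x in at_top. f (v * x) \<le> (1 + e) * f x))"

text \<open>One variable \<open>X\<close> with its weight \<open>T\<close>. The joint law is nearly of product form far out in \<open>X\<close>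
  (assumption \<open>near_product\<close>, which follows from \<open>P(X > x | T = \<theta>) \<sim> h(\<theta>) P(X > x)\<close> uniformly in \<open>\<theta>\<close> and
  does not mention \<open>h\<close>), and weights above \<open>b x\<close> are negligible compared with the tail of the product.\<close>

locale weighted_variable = prob_space +
  fixes X T :: "'a \<Rightarrow> real" and b :: "real \<Rightarrow> real"
  assumes X_meas [measurable]: "X \<in> borel_measurable M"
    and T_meas [measurable]: "T \<in> borel_measurable M"
    and T_nonneg: "AE \<omega> in M. 0 \<le> T \<omega>"
    and X_tail_pos: "\<And>x. 0 < \<P>(\<omega> in M. x < X \<omega>)"
    and near_product: "\<And>e. e > 0 \<Longrightarrow> \<exists>x0. \<forall>r\<ge>x0. \<forall>r'\<ge>x0. \<forall>B\<in>sets borel.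
      \<P>(\<omega> in M. r < X \<omega> \<and> T \<omega> \<in> B) * \<P>(\<omega> in M. r' < X \<omega>)
        \<le> (1 + e) * \<P>(\<omega> in M. r < X \<omega>) * \<P>(\<omega> in M. r' < X \<omega> \<and> T \<omega> \<in> B)"
    and b_pos: "\<And>x. x \<ge> 0 \<Longrightarrow> b x > 0"
    and b_lim: "((\<lambda>x. b x / x) \<longlongrightarrow> 0) at_top"
    and T_negligible: "\<And>e. e > 0 \<Longrightarrow> \<forall>\<^sub>F x in at_top. \<P>(\<omega> in M. b x < T \<omega>) \<le> e * \<P>(\<omega> in M. x < T \<omega> * X \<omega>)"
    and T_pos: "\<exists>t>0. \<forall>\<^sub>F r in at_top. 0 < \<P>(\<omega> in M. r < X \<omega> \<and> t < T \<omega>)"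
begin

definition F :: "real \<Rightarrow> real" where "F x = \<P>(\<omega> in M. x < X \<omega>)"
definition H :: "real \<Rightarrow> real" where "H x = \<P>(\<omega> in M. x < T \<omega> * X \<omega>)"

lemma F_pos: "F x > 0" unfolding F_def by (rule X_tail_pos)
lemma F_mono: "x \<le> y \<Longrightarrow> F y \<le> F x" unfolding F_def by (intro finite_measure_mono) auto
lemma H_nonneg: "H x \<ge> 0" unfolding H_def by simp
lemma H_mono: "x \<le> y \<Longrightarrow> H y \<le> H x" unfolding H_def by (intro finite_measure_mono) auto

text \<open>On the event \<open>T \<le> b x\<close> the level \<open>x / T\<close> tends to infinity uniformly, which is what
  allows the use of the uniform hypotheses.\<close>

lemma ratio_b_at_top: "\<forall>\<^sub>F x in at_top. \<forall>w. 0 < w \<and> w \<le> b x \<longrightarrow> R \<le> x / w"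
proof -
  define R' where "R' = max R 1"
  have "\<forall>\<^sub>F x in at_top. b x / x < 1 / R'"
    by (rule order_tendstoD(2)[OF b_lim]) (auto simp: R'_def)
  then show ?thesis
    using eventually_gt_at_top[of 0]
  proof eventually_elim
    case (elim x)
    have R': "R' > 0" by (simp add: R'_def)
    show ?case
    proof (intro allI impI)
      fix w assume w: "0 < w \<and> w \<le> b x"
      have "R' * b x \<le> x" using elim R' by (simp add: field_simps)
      moreover have "R' * w \<le> R' * b x" using w R' by simp
      ultimately have "R' \<le> x / w" using w by (simp add: field_simps)
      then show "R \<le> x / w" by (simp add: R'_def)
    qed
  qed
qed

lemma product_tail_le:
  assumes "y \<ge> 0"
  shows "\<P>(\<omega> in M. y < T \<omega> * X \<omega>) \<le> \<P>(\<omega> in M. c < T \<omega>) + \<P>(\<omega> in M. y / T \<omega> < X \<omega> \<and> T \<omega> \<in> {0<..c})"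
proof (rule prob_le_add)
  show "AE \<omega> in M. y < T \<omega> * X \<omega> \<longrightarrow> c < T \<omega> \<or> y / T \<omega> < X \<omega> \<and> T \<omega> \<in> {0<..c}"
    using T_nonneg
  proof eventually_elim
    case (elim \<omega>)
    then show ?case using assms by (cases "T \<omega> = 0") (auto simp: field_simps)
  qed
qed measurable

lemma product_tail_ge:
  assumes "D \<subseteq> {0<..}" "D \<in> sets borel"
  shows "\<P>(\<omega> in M. y / T \<omega> < X \<omega> \<and> T \<omega> \<in> D) \<le> H y"
  unfolding H_def using assms
  by (intro finite_measure_mono) (auto simp: field_simps)

text \<open>Scaling estimates pass from the tail of \<open>X\<close> to that of \<open>T X\<close>; dominated and consistent variation
  of the product both follow.\<close>

lemma H_scale_le:
  assumes v: "0 < v" "v < 1" and K: "0 \<le> K" and F: "\<forall>\<^sub>F x in at_top. F (v * x) \<le> K * F x" and e: "e > 0"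
  shows "\<forall>\<^sub>F x in at_top. H (v * x) \<le> ((1 + e) * K + e) * H x"
proof -
  obtain x1 where x1: "\<And>x. x \<ge> x1 \<Longrightarrow> F (v * x) \<le> K * F x"
    using F by (auto simp: eventually_at_top_linorder)
  obtain x0 where x0: "\<And>r r' B. r \<ge> x0 \<Longrightarrow> r' \<ge> x0 \<Longrightarrow> B \<in> sets borel \<Longrightarrow>
      \<P>(\<omega> in M. r < X \<omega> \<and> T \<omega> \<in> B) * F r' \<le> (1 + e) * F r * \<P>(\<omega> in M. r' < X \<omega> \<and> T \<omega> \<in> B)"
    using near_product[OF e] unfolding F_def by blast
  define R where "R = max x1 (max x0 (x0 / v))"
  have near: "\<P>(\<omega> in M. True \<and> r < X \<omega> / v \<and> T \<omega> \<in> B) \<le> ((1 + e) * K) * \<P>(\<omega> in M. r < X \<omega> \<and> T \<omega> \<in> B)"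
    if r: "r \<ge> R" and B: "B \<in> sets borel" for r B
  proof -
    have r': "r \<ge> x1" "r \<ge> x0" "v * r \<ge> x0"
      using r v by (auto simp: R_def field_simps)
    have "\<P>(\<omega> in M. v * r < X \<omega> \<and> T \<omega> \<in> B) * F r \<le> (1 + e) * F (v * r) * \<P>(\<omega> in M. r < X \<omega> \<and> T \<omega> \<in> B)"
      by (intro x0 r' B)
    also have "\<dots> \<le> (1 + e) * (K * F r) * \<P>(\<omega> in M. r < X \<omega> \<and> T \<omega> \<in> B)"
      using e by (intro mult_right_mono mult_left_mono x1 r') auto
    finally have "\<P>(\<omega> in M. v * r < X \<omega> \<and> T \<omega> \<in> B) * F r
        \<le> ((1 + e) * K * \<P>(\<omega> in M. r < X \<omega> \<and> T \<omega> \<in> B)) * F r" by (simp add: mult_ac)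
    then have "\<P>(\<omega> in M. v * r < X \<omega> \<and> T \<omega> \<in> B) \<le> (1 + e) * K * \<P>(\<omega> in M. r < X \<omega> \<and> T \<omega> \<in> B)"
      using F_pos[of r] by simp
    moreover have "v * r < X \<omega> \<longleftrightarrow> r < X \<omega> / v" for \<omega>
      using v pos_less_divide_eq[of v r "X \<omega>"] by (simp add: mult.commute)
    ultimately show ?thesis by simp
  qed
  show ?thesis
    using ratio_b_at_top[of R] T_negligible[OF e] eventually_ge_at_top[of 0]
  proof eventually_elim
    case (elim x)
    have "H (v * x) \<le> \<P>(\<omega> in M. b x < T \<omega>) + \<P>(\<omega> in M. v * x / T \<omega> < X \<omega> \<and> T \<omega> \<in> {0<..b x})"
      unfolding H_def using elim v by (intro product_tail_le) auto
    moreover have "\<P>(\<omega> in M. v * x / T \<omega> < X \<omega> \<and> T \<omega> \<in> {0<..b x})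
        = \<P>(\<omega> in M. True \<and> x / T \<omega> < X \<omega> / v \<and> T \<omega> \<in> {0<..b x})"
    proof -
      have "v * x / T \<omega> < X \<omega> \<longleftrightarrow> x / T \<omega> < X \<omega> / v" for \<omega>
        using v pos_less_divide_eq[of v "x / T \<omega>" "X \<omega>"] by (simp add: mult.commute)
      then show ?thesis by simp
    qed
    moreover have "\<P>(\<omega> in M. True \<and> x / T \<omega> < X \<omega> / v \<and> T \<omega> \<in> {0<..b x})
        \<le> ((1 + e) * K) * \<P>(\<omega> in M. x / T \<omega> < X \<omega> \<and> T \<omega> \<in> {0<..b x})"
    proof (rule prob_staircase_le[where ?r0.0=R])
      show "\<P>(\<omega> in M. True \<and> r < X \<omega> / v \<and> T \<omega> \<in> B) \<le> ((1 + e) * K) * \<P>(\<omega> in M. r < X \<omega> \<and> T \<omega> \<in> B)"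
        if "R \<le> r" "B \<in> sets borel" for r B using that by (rule near)
      show "0 \<le> (1 + e) * K" using e K by simp
      show "R \<le> x / w" if "w \<in> {0<..b x}" for w using that by (intro elim(1)[rule_format]) auto
    qed (measurable; fail)+
    moreover have "((1 + e) * K) * \<P>(\<omega> in M. x / T \<omega> < X \<omega> \<and> T \<omega> \<in> {0<..b x}) \<le> ((1 + e) * K) * H x"
      using e K by (intro mult_left_mono product_tail_ge) auto
    ultimately have "H (v * x) \<le> e * H x + ((1 + e) * K) * H x"
      using elim(2) unfolding H_def by linarith
    then show ?case by (simp add: algebra_simps)
  qed
qed

lemma H_dominated:
  assumes "dominated_tail F"
  shows "dominated_tail H"
  unfolding dominated_tail_def
proof (intro allI impI)
  fix v :: real assume v: "0 < v \<and> v < 1"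
  then obtain K where K: "\<forall>\<^sub>F x in at_top. F (v * x) \<le> K * F x"
    using assms by (auto simp: dominated_tail_def)
  then have "\<forall>\<^sub>F x in at_top. F (v * x) \<le> max K 0 * F x"
  proof eventually_elim
    case (elim x)
    have "K * F x \<le> max K 0 * F x" using F_pos[of x] by (intro mult_right_mono) auto
    with elim show ?case by linarith
  qed
  then have "\<forall>\<^sub>F x in at_top. H (v * x) \<le> ((1 + 1) * max K 0 + 1) * H x"
    using v by (intro H_scale_le) auto
  then show "\<exists>K. \<forall>\<^sub>F x in at_top. H (v * x) \<le> K * H x" ..
qed

lemma H_consistent:
  assumes "consistent_tail F"
  shows "consistent_tail H"
  unfolding consistent_tail_def
proof (intro allI impI)
  fix e :: real assume e: "e > 0"
  define d where "d = min 1 (e / 4)"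
  have d: "d > 0" "(1 + d) * (1 + d) + d \<le> 1 + e"
  proof -
    show "d > 0" using e by (simp add: d_def)
    have "d * d \<le> d" using e by (intro mult_left_le) (auto simp: d_def)
    moreover have "d \<le> e / 4" by (simp add: d_def)
    ultimately show "(1 + d) * (1 + d) + d \<le> 1 + e" by (simp add: algebra_simps)
  qed
  obtain v where v: "0 < v" "v < 1" "\<forall>\<^sub>F x in at_top. F (v * x) \<le> (1 + d) * F x"
    using assms d by (auto simp: consistent_tail_def)
  have "\<forall>\<^sub>F x in at_top. H (v * x) \<le> ((1 + d) * (1 + d) + d) * H x"
    using v d by (intro H_scale_le) auto
  then have "\<forall>\<^sub>F x in at_top. H (v * x) \<le> (1 + e) * H x"
  proof eventually_elim
    case (elim x)
    have "((1 + d) * (1 + d) + d) * H x \<le> (1 + e) * H x" by (intro mult_right_mono d H_nonneg)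
    with elim show ?case by linarith
  qed
  with v show "\<exists>v. 0 < v \<and> v < 1 \<and> (\<forall>\<^sub>F x in at_top. H (v * x) \<le> (1 + e) * H x)" by blast
qed

text \<open>Up to a constant, the product is not lighter than \<open>X\<close>, since the weight exceeds some \<open>t > 0\<close> with positive
  probability even when \<open>X\<close> is large.\<close>

lemma F_le_H:
  assumes "dominated_tail F"
  shows "\<exists>C>0. \<forall>\<^sub>F x in at_top. F x \<le> C * H x"
proof -
  obtain t where t: "t > 0" "\<forall>\<^sub>F r in at_top. 0 < \<P>(\<omega> in M. r < X \<omega> \<and> t < T \<omega>)"
    using T_pos by blast
  obtain x0 where x0: "\<And>r r' B. r \<ge> x0 \<Longrightarrow> r' \<ge> x0 \<Longrightarrow> B \<in> sets borel \<Longrightarrow>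
      \<P>(\<omega> in M. r < X \<omega> \<and> T \<omega> \<in> B) * F r' \<le> (1 + 1) * F r * \<P>(\<omega> in M. r' < X \<omega> \<and> T \<omega> \<in> B)"
    using near_product[of 1] unfolding F_def by auto
  have "\<forall>\<^sub>F r in at_top. r \<ge> x0 \<and> 0 < \<P>(\<omega> in M. r < X \<omega> \<and> t < T \<omega>)"
    using t(2) eventually_ge_at_top[of x0] by eventually_elim auto
  then obtain x1 where x1: "x1 \<ge> x0" "0 < \<P>(\<omega> in M. x1 < X \<omega> \<and> t < T \<omega>)"
    using eventually_happens'[OF trivial_limit_at_top_linorder] by blast
  define p where "p = \<P>(\<omega> in M. x1 < X \<omega> \<and> t < T \<omega>)"
  have p: "p > 0" using x1 by (simp add: p_def)
  have *: "F (x / t) \<le> (2 * F x1 / p) * H x" if x: "x \<ge> 0" "x / t \<ge> x0" for x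
  proof -
    have "p * F (x / t) \<le> (1 + 1) * F x1 * \<P>(\<omega> in M. x / t < X \<omega> \<and> T \<omega> \<in> {t<..})"
      using x0[of x1 "x / t" "{t<..}"] x1 x by (simp add: p_def)
    also have "\<dots> \<le> (1 + 1) * F x1 * H x"
    proof (rule mult_left_mono)
      show "\<P>(\<omega> in M. x / t < X \<omega> \<and> T \<omega> \<in> {t<..}) \<le> H x"
        unfolding H_def
      proof (intro finite_measure_mono; safe?)
        fix \<omega> assume w: "x / t < X \<omega>" "t < T \<omega>"
        have "x < t * X \<omega>" using w t by (simp add: field_simps)
        also have "\<dots> \<le> T \<omega> * X \<omega>"
        proof (rule mult_right_mono)
          have "0 \<le> x / t" using x t by simp
          then show "0 \<le> X \<omega>" using w by linarith
        qed (use w in simp)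
        finally show "x < T \<omega> * X \<omega>" .
      qed measurable
    qed (use F_pos[of x1] in simp)
    finally show ?thesis using p by (simp add: field_simps)
  qed
  obtain K where K: "\<forall>\<^sub>F x in at_top. F x \<le> K * F (x / t)"
  proof (cases "t < 1")
    case True
    then obtain K y0 where K: "\<And>y. y \<ge> y0 \<Longrightarrow> F (t * y) \<le> K * F y"
      using assms t unfolding dominated_tail_def eventually_at_top_linorder by blast
    have "\<forall>\<^sub>F x in at_top. F x \<le> K * F (x / t)"
      using eventually_ge_at_top[of "y0 * t"]
    proof eventually_elim
      case (elim x)
      then show ?case using K[of "x / t"] t by (simp add: field_simps)
    qed
    with that show ?thesis by blast
  next
    case False
    have "\<forall>\<^sub>F x in at_top. F x \<le> 1 * F (x / t)"
      using eventually_ge_at_top[of 0]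
    proof eventually_elim
      case (elim x)
      then have "x * 1 \<le> x * t" using False by (intro mult_left_mono) auto
      then have "x / t \<le> x" using t by (simp add: pos_divide_le_eq)
      then show ?case using F_mono by simp
    qed
    with that show ?thesis by blast
  qed
  define C where "C = max K 1 * (2 * F x1 / p)"
  have C: "C > 0" using p F_pos[of x1] by (auto simp: C_def)
  have "\<forall>\<^sub>F x in at_top. x / t \<ge> x0"
    using eventually_ge_at_top[of "x0 * t"] by eventually_elim (use t in \<open>simp add: field_simps\<close>)
  then have "\<forall>\<^sub>F x in at_top. F x \<le> C * H x"
    using K eventually_ge_at_top[of 0]
  proof eventually_elim
    case (elim x)
    have "F x \<le> max K 1 * F (x / t)"
    proof -
      have "K * F (x / t) \<le> max K 1 * F (x / t)" using F_pos[of "x / t"] by (intro mult_right_mono) auto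
      with elim show ?thesis by linarith
    qed
    also have "\<dots> \<le> max K 1 * ((2 * F x1 / p) * H x)"
      using elim by (intro mult_left_mono *) auto
    finally show ?case by (simp add: C_def mult_ac)
  qed
  with C show ?thesis by blast
qed

text \<open>A shift of the product by \<open>a\<close> is a shift of \<open>X\<close> by \<open>a / T\<close>. It is bounded by \<open>a / t\<close> when \<open>T > t\<close>;
  the part \<open>T \<le> t\<close> is made negligible by choosing \<open>t\<close> small, and here dominated variation is needed.\<close>

lemma H_long:
  assumes D: "dominated_tail F" and L: "long_tail F"
  shows "long_tail H"
  unfolding long_tail_def
proof (intro allI impI)
  fix a e :: real assume a: "a > 0" and e: "e > 0"
  define d where "d = min 1 (e / 6)"
  have d: "d > 0" "(1 + d) * (1 + d) + 2 * d \<le> 1 + e"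
  proof -
    show "d > 0" using e by (simp add: d_def)
    have "d * d \<le> d" using e by (intro mult_left_le) (auto simp: d_def)
    moreover have "5 * d \<le> e" using e by (simp add: d_def)
    ultimately show "(1 + d) * (1 + d) + 2 * d \<le> 1 + e" by (simp add: algebra_simps)
  qed
  obtain C where C: "C > 0" "\<forall>\<^sub>F x in at_top. F x \<le> C * H x" using F_le_H[OF D] by blast
  obtain x0 where x0: "\<And>r r' B. r \<ge> x0 \<Longrightarrow> r' \<ge> x0 \<Longrightarrow> B \<in> sets borel \<Longrightarrow>
      \<P>(\<omega> in M. r < X \<omega> \<and> T \<omega> \<in> B) * F r' \<le> (1 + d) * F r * \<P>(\<omega> in M. r' < X \<omega> \<and> T \<omega> \<in> B)"
    using near_product[OF d(1)] unfolding F_def by blast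
  \<comment> \<open>The threshold \<open>t\<close> is a reciprocal integer for which \<open>P(0 < T \<le> t)\<close> is small.\<close>
  have "(\<lambda>k. \<P>(\<omega> in M. T \<omega> \<in> {0<..1 / Suc k})) \<longlonglongrightarrow> measure M (\<Inter>k. {\<omega>\<in>space M. T \<omega> \<in> {0<..1 / Suc k}})"
  proof (intro finite_Lim_measure_decseq decseq_SucI)
    fix k
    have "1 / real (Suc (Suc k)) \<le> 1 / real (Suc k)" by (intro divide_left_mono) auto
    then show "{\<omega>\<in>space M. T \<omega> \<in> {0<..1 / Suc (Suc k)}} \<subseteq> {\<omega>\<in>space M. T \<omega> \<in> {0<..1 / Suc k}}"
      by auto
  qed (rule image_subsetI, measurable)
  also have "(\<Inter>k. {\<omega>\<in>space M. T \<omega> \<in> {0<..1 / Suc k}}) = {}"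
  proof (safe, goal_cases)
    case (1 \<omega>)
    then have pos: "T \<omega> > 0" and le: "\<And>k. T \<omega> \<le> 1 / Suc k" by auto
    obtain k :: nat where "1 / Suc k < T \<omega>" using pos by (metis nat_approx_posE)
    with le[of k] show ?case by simp
  qed
  finally have "(\<lambda>k. \<P>(\<omega> in M. T \<omega> \<in> {0<..1 / Suc k})) \<longlonglongrightarrow> 0" by simp
  moreover have "d * F x0 / (8 * C) > 0" using d C F_pos by simp
  ultimately have "\<forall>\<^sub>F k in sequentially. \<P>(\<omega> in M. T \<omega> \<in> {0<..1 / Suc k}) < d * F x0 / (8 * C)"
    by (rule order_tendstoD)
  then obtain k where k: "\<P>(\<omega> in M. T \<omega> \<in> {0<..1 / Suc k}) < d * F x0 / (8 * C)"
    by (auto simp: eventually_sequentially)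
  define t where "t = 1 / real (Suc k)"
  have t: "0 < t" "t \<le> 1" "\<P>(\<omega> in M. T \<omega> \<in> {0<..t}) \<le> d * F x0 / (8 * C)"
    using k by (auto simp: t_def)
  have "\<forall>\<^sub>F x in at_top. F (x - a / t) \<le> (1 + d) * F x"
    using L a t d by (auto simp: long_tail_def)
  then obtain x1 where x1: "\<And>x. x \<ge> x1 \<Longrightarrow> F (x - a / t) \<le> (1 + d) * F x"
    by (auto simp: eventually_at_top_linorder)
  define R where "R = max x1 (max x0 (x0 + a / t))"
  have near: "\<P>(\<omega> in M. True \<and> r < X \<omega> + a / t \<and> T \<omega> \<in> B) \<le> ((1 + d) * (1 + d)) * \<P>(\<omega> in M. r < X \<omega> \<and> T \<omega> \<in> B)"
    if r: "r \<ge> R" and B: "B \<in> sets borel" for r B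
  proof -
    have r': "r \<ge> x1" "r \<ge> x0" "r - a / t \<ge> x0" using r by (auto simp: R_def)
    have "\<P>(\<omega> in M. r - a / t < X \<omega> \<and> T \<omega> \<in> B) * F r \<le> (1 + d) * F (r - a / t) * \<P>(\<omega> in M. r < X \<omega> \<and> T \<omega> \<in> B)"
      by (intro x0 r' B)
    also have "\<dots> \<le> (1 + d) * ((1 + d) * F r) * \<P>(\<omega> in M. r < X \<omega> \<and> T \<omega> \<in> B)"
      using d by (intro mult_right_mono mult_left_mono x1 r') auto
    finally have "\<P>(\<omega> in M. r - a / t < X \<omega> \<and> T \<omega> \<in> B) * F r
        \<le> ((1 + d) * (1 + d) * \<P>(\<omega> in M. r < X \<omega> \<and> T \<omega> \<in> B)) * F r" by (simp add: mult_ac)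
    then have "\<P>(\<omega> in M. r - a / t < X \<omega> \<and> T \<omega> \<in> B) \<le> (1 + d) * (1 + d) * \<P>(\<omega> in M. r < X \<omega> \<and> T \<omega> \<in> B)"
      using F_pos[of r] by simp
    then show ?thesis by (simp add: diff_less_eq)
  qed
  have F2: "\<forall>\<^sub>F x in at_top. F (x - a) \<le> (1 + 1) * F x"
    using L a zero_less_one unfolding long_tail_def by blast
  show "\<forall>\<^sub>F x in at_top. H (x - a) \<le> (1 + e) * H x"
    using ratio_b_at_top[of R] T_negligible[OF d(1)] C(2) F2
      eventually_ge_at_top[of a] eventually_ge_at_top[of "max x0 0 + a"]
  proof eventually_elim
    case (elim x)
    have "H (x - a) \<le> \<P>(\<omega> in M. b x < T \<omega>) + \<P>(\<omega> in M. (x - a) / T \<omega> < X \<omega> \<and> T \<omega> \<in> {0<..b x})"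
      unfolding H_def using elim by (intro product_tail_le) auto
    also have "\<P>(\<omega> in M. (x - a) / T \<omega> < X \<omega> \<and> T \<omega> \<in> {0<..b x})
        \<le> \<P>(\<omega> in M. (x - a) / t < X \<omega> \<and> T \<omega> \<in> {0<..t})
          + \<P>(\<omega> in M. True \<and> x / T \<omega> < X \<omega> + a / t \<and> T \<omega> \<in> {t<..b x})"
    proof (rule prob_le_add, goal_cases)
      case 3
      show ?case
      proof (intro AE_I2 impI)
        fix \<omega> assume "(x - a) / T \<omega> < X \<omega> \<and> T \<omega> \<in> {0<..b x}"
        then have w: "(x - a) / T \<omega> < X \<omega>" "0 < T \<omega>" "T \<omega> \<le> b x" by auto
        show "(x - a) / t < X \<omega> \<and> T \<omega> \<in> {0<..t} \<or> True \<and> x / T \<omega> < X \<omega> + a / t \<and> T \<omega> \<in> {t<..b x}"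
        proof (cases "T \<omega> \<le> t")
          case True
          then have "(x - a) / t \<le> (x - a) / T \<omega>" using w elim by (intro divide_left_mono) auto
          with True w show ?thesis by auto
        next
          case False
          then have "a / T \<omega> \<le> a / t" using a t by (intro divide_left_mono) auto
          with False w show ?thesis by (auto simp: diff_divide_distrib)
        qed
      qed
    qed measurable
    finally have 1: "H (x - a) \<le> \<P>(\<omega> in M. b x < T \<omega>)
        + (\<P>(\<omega> in M. (x - a) / t < X \<omega> \<and> T \<omega> \<in> {0<..t})
        + \<P>(\<omega> in M. True \<and> x / T \<omega> < X \<omega> + a / t \<and> T \<omega> \<in> {t<..b x}))" by simp
    have "\<P>(\<omega> in M. True \<and> x / T \<omega> < X \<omega> + a / t \<and> T \<omega> \<in> {t<..b x})
        \<le> ((1 + d) * (1 + d)) * \<P>(\<omega> in M. x / T \<omega> < X \<omega> \<and> T \<omega> \<in> {t<..b x})"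
    proof (rule prob_staircase_le[where ?r0.0=R])
      show "\<P>(\<omega> in M. True \<and> r < X \<omega> + a / t \<and> T \<omega> \<in> B) \<le> ((1 + d) * (1 + d)) * \<P>(\<omega> in M. r < X \<omega> \<and> T \<omega> \<in> B)"
        if "R \<le> r" "B \<in> sets borel" for r B using that by (rule near)
      show "0 \<le> (1 + d) * (1 + d)" using d by simp
      show "R \<le> x / w" if "w \<in> {t<..b x}" for w using that t by (intro elim(1)[rule_format]) auto
    qed (measurable; fail)+
    also have "\<dots> \<le> ((1 + d) * (1 + d)) * H x"
      using d t by (intro mult_left_mono product_tail_ge) auto
    finally have 2: "\<P>(\<omega> in M. True \<and> x / T \<omega> < X \<omega> + a / t \<and> T \<omega> \<in> {t<..b x}) \<le> ((1 + d) * (1 + d)) * H x" .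
    have "(x - a) * t \<le> (x - a) * 1" using t elim by (intro mult_left_mono) auto
    then have xa: "(x - a) / t \<ge> x - a" using t by (simp add: pos_le_divide_eq)
    have "\<P>(\<omega> in M. (x - a) / t < X \<omega> \<and> T \<omega> \<in> {0<..t}) * F x0
        \<le> (1 + d) * F ((x - a) / t) * \<P>(\<omega> in M. x0 < X \<omega> \<and> T \<omega> \<in> {0<..t})"
      using xa elim by (intro x0) auto
    also have "\<dots> \<le> 2 * (2 * (C * H x)) * (d * F x0 / (8 * C))"
    proof (intro mult_mono)
      show "1 + d \<le> 2" by (simp add: d_def)
      have "F ((x - a) / t) \<le> F (x - a)" by (intro F_mono xa)
      also have "\<dots> \<le> 2 * F x" using elim(4) by simp
      also have "\<dots> \<le> 2 * (C * H x)" using elim(3) by simp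
      finally show "F ((x - a) / t) \<le> 2 * (C * H x)" .
      have "\<P>(\<omega> in M. x0 < X \<omega> \<and> T \<omega> \<in> {0<..t}) \<le> \<P>(\<omega> in M. T \<omega> \<in> {0<..t})"
        by (intro finite_measure_mono) auto
      then show "\<P>(\<omega> in M. x0 < X \<omega> \<and> T \<omega> \<in> {0<..t}) \<le> d * F x0 / (8 * C)" using t by linarith
    qed (use C H_nonneg F_pos less_imp_le in auto)
    also have "\<dots> = (d * H x / 2) * F x0" using C by (simp add: field_simps)
    finally have "\<P>(\<omega> in M. (x - a) / t < X \<omega> \<and> T \<omega> \<in> {0<..t}) \<le> d * H x / 2"
      using F_pos[of x0] by simp
    moreover have "d * H x \<ge> 0" using d H_nonneg by simp
    ultimately have "H (x - a) \<le> ((1 + d) * (1 + d) + 2 * d) * H x"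
      using 1 2 elim(2) by (simp add: H_def algebra_simps)
    also have "\<dots> \<le> (1 + e) * H x" by (intro mult_right_mono d H_nonneg)
    finally show ?case .
  qed
qed

lemma H_pos:
  assumes "dominated_tail F"
  shows "H x > 0"
proof -
  obtain C where C: "C > 0" "\<forall>\<^sub>F x in at_top. F x \<le> C * H x" using F_le_H[OF assms] by blast
  have "\<forall>\<^sub>F y in at_top. F y \<le> C * H y \<and> y \<ge> x"
    using C(2) eventually_ge_at_top[of x] by eventually_elim auto
  then obtain y where y: "F y \<le> C * H y" "y \<ge> x"
    using eventually_happens'[OF trivial_limit_at_top_linorder] by blast
  have "0 < C * H y" using y F_pos[of y] by linarith
  then have "0 < H y" using C by (simp add: zero_less_mult_iff)
  then show ?thesis using H_mono[OF y(2)] by linarith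
qed

end

section \<open>Product bounds from conditional probabilities\<close>

lemma eventually_min_at_top:
  "eventually P min_at_top \<longleftrightarrow> (\<exists>z. \<forall>x\<ge>z. \<forall>y\<ge>z. P (x, y))"
  unfolding min_at_top_def eventually_filtercomap eventually_at_top_linorder
proof safe
  fix Q and z :: real
  assume "\<forall>x\<ge>z. Q x" "\<forall>x. Q (case x of (x, y) \<Rightarrow> min x y) \<longrightarrow> P x"
  then show "\<exists>z. \<forall>x\<ge>z. \<forall>y\<ge>z. P (x, y)"
    by (intro exI[of _ z]) auto
next
  fix z :: real assume *: "\<forall>x\<ge>z. \<forall>y\<ge>z. P (x, y)"
  show "\<exists>Q. (\<exists>N. \<forall>n\<ge>N. Q n) \<and> (\<forall>x. Q (case x of (x, y) \<Rightarrow> min x y) \<longrightarrow> P x)"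
    using * by (intro exI[of _ "\<lambda>m. z \<le> m"]) auto
qed

lemma ratio_bounds:
  fixes c q d :: real
  assumes "dist (c / q) 1 < d" "d < 1" "q \<ge> 0"
  shows "0 < q" "(1 - d) * q \<le> c" "c \<le> (1 + d) * q"
proof -
  have *: "\<bar>c / q - 1\<bar> < d" using assms by (simp add: dist_real_def)
  have "q \<noteq> 0" using * assms by auto
  then show q: "0 < q" using assms by simp
  have "1 - d \<le> c / q" "c / q \<le> 1 + d" using * by linarith+
  then show "(1 - d) * q \<le> c" "c \<le> (1 + d) * q"
    using q by (simp_all add: field_simps)
qed

context prob_space
begin

text \<open>The function \<open>h\<close>, which need not be measurable, cancels when two levels \<open>r\<close> and \<open>r'\<close> are compared.\<close>

lemma near_product_of_cond1:
  fixes X T :: "'a \<Rightarrow> real" and S :: "real set"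
  assumes [measurable]: "X \<in> borel_measurable M" "T \<in> borel_measurable M"
    and S: "AE \<omega> in M. T \<omega> \<in> S"
    and ex: "\<forall>\<^sub>F x in at_top. \<forall>\<theta>\<in>S. cond1_exists M (\<lambda>\<omega>. x < X \<omega>) T \<theta>"
    and equiv: "uniform_equiv at_top S (\<lambda>x \<theta>. cond1 M (\<lambda>\<omega>. x < X \<omega>) T \<theta>) (\<lambda>x \<theta>. h \<theta> * \<P>(\<omega> in M. x < X \<omega>))"
    and h: "\<And>\<theta>. \<theta> \<in> S \<Longrightarrow> 0 < h \<theta>"
    and X_pos: "\<And>x. 0 < \<P>(\<omega> in M. x < X \<omega>)"
    and e: "e > 0"
  shows "\<exists>x0. \<forall>r\<ge>x0. \<forall>r'\<ge>x0. \<forall>B\<in>sets borel.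
      \<P>(\<omega> in M. r < X \<omega> \<and> T \<omega> \<in> B) * \<P>(\<omega> in M. r' < X \<omega>)
        \<le> (1 + e) * \<P>(\<omega> in M. r < X \<omega>) * \<P>(\<omega> in M. r' < X \<omega> \<and> T \<omega> \<in> B)"
proof -
  define F where "F x = \<P>(\<omega> in M. x < X \<omega>)" for x
  define d where "d = e / (2 + e)"
  have d: "0 < d" "d < 1" "(1 + d) = (1 + e) * (1 - d)"
    using e by (simp_all add: d_def field_simps)
  have "\<forall>\<^sub>F x in at_top. \<forall>\<theta>\<in>S. dist (cond1 M (\<lambda>\<omega>. x < X \<omega>) T \<theta> / (h \<theta> * F x)) 1 < d"
    using equiv d unfolding uniform_equiv_def uniform_limit_iff F_def by auto
  with ex have "\<forall>\<^sub>F x in at_top. \<forall>\<theta>\<in>S. cond1_exists M (\<lambda>\<omega>. x < X \<omega>) T \<theta> \<and>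
      dist (cond1 M (\<lambda>\<omega>. x < X \<omega>) T \<theta> / (h \<theta> * F x)) 1 < d"
    by eventually_elim auto
  then obtain x0 where x0: "\<And>x \<theta>. x \<ge> x0 \<Longrightarrow> \<theta> \<in> S \<Longrightarrow> cond1_exists M (\<lambda>\<omega>. x < X \<omega>) T \<theta>"
    "\<And>x \<theta>. x \<ge> x0 \<Longrightarrow> \<theta> \<in> S \<Longrightarrow> dist (cond1 M (\<lambda>\<omega>. x < X \<omega>) T \<theta> / (h \<theta> * F x)) 1 < d"
    unfolding eventually_at_top_linorder by blast
  have F: "F x > 0" for x using X_pos by (simp add: F_def)
  show ?thesis
  proof (intro exI allI impI ballI)
    fix r r' and B :: "real set" assume r: "r \<ge> x0" "r' \<ge> x0" and B: "B \<in> sets borel"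
    define K where "K = (1 + e) * F r / F r'"
    have K: "K \<ge> 0" using e F[of r] F[of r'] by (simp add: K_def)
    have le: "cond1 M (\<lambda>\<omega>. r < X \<omega>) T \<theta> \<le> K * cond1 M (\<lambda>\<omega>. r' < X \<omega>) T \<theta>" if "\<theta> \<in> S" for \<theta>
    proof -
      note b = ratio_bounds[OF x0(2)[OF r(1) that] d(2)] ratio_bounds[OF x0(2)[OF r(2) that] d(2)]
      have nn: "h \<theta> * F x \<ge> 0" for x using h[OF that] F[of x] by simp
      have "cond1 M (\<lambda>\<omega>. r < X \<omega>) T \<theta> \<le> (1 + d) * (h \<theta> * F r)" using b nn by blast
      also have "\<dots> = K * ((1 - d) * (h \<theta> * F r'))"
        using F[of r'] d(3) by (simp add: K_def)
      also have "\<dots> \<le> K * cond1 M (\<lambda>\<omega>. r' < X \<omega>) T \<theta>"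
        using b nn K by (intro mult_left_mono) blast+
      finally show ?thesis .
    qed
    have "\<P>(\<omega> in M. r < X \<omega> \<and> T \<omega> \<in> B) \<le> K * \<P>(\<omega> in M. r' < X \<omega> \<and> T \<omega> \<in> B)"
    proof (rule cond1_compare)
      show "AE \<omega> in M. cond1_exists M (\<lambda>\<omega>. r < X \<omega>) T (T \<omega>) \<and> cond1_exists M (\<lambda>\<omega>. r' < X \<omega>) T (T \<omega>)"
        using S by eventually_elim (auto intro: x0 r)
      show "AE \<omega> in M. cond1 M (\<lambda>\<omega>. r < X \<omega>) T (T \<omega>) \<le> K * cond1 M (\<lambda>\<omega>. r' < X \<omega>) T (T \<omega>)"
        using S by eventually_elim (rule le)
    qed (use K B in measurable)
    then show "\<P>(\<omega> in M. r < X \<omega> \<and> T \<omega> \<in> B) * \<P>(\<omega> in M. r' < X \<omega>)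
        \<le> (1 + e) * \<P>(\<omega> in M. r < X \<omega>) * \<P>(\<omega> in M. r' < X \<omega> \<and> T \<omega> \<in> B)"
      unfolding F_def[symmetric] using F[of r'] by (simp add: K_def field_simps)
  qed
qed

lemma joint_positive_of_cond1:
  fixes X T :: "'a \<Rightarrow> real" and S :: "real set"
  assumes [measurable]: "X \<in> borel_measurable M" "T \<in> borel_measurable M"
    and ex: "\<forall>\<^sub>F x in at_top. \<forall>\<theta>\<in>S. cond1_exists M (\<lambda>\<omega>. x < X \<omega>) T \<theta>"
    and equiv: "uniform_equiv at_top S (\<lambda>x \<theta>. cond1 M (\<lambda>\<omega>. x < X \<omega>) T \<theta>) (\<lambda>x \<theta>. h \<theta> * \<P>(\<omega> in M. x < X \<omega>))"
    and h: "\<And>\<theta>. \<theta> \<in> S \<Longrightarrow> 0 < h \<theta>"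
    and X_pos: "\<And>x. 0 < \<P>(\<omega> in M. x < X \<omega>)"
    and \<theta>: "\<theta> \<in> S" "0 < \<theta>"
  shows "\<forall>\<^sub>F x in at_top. 0 < \<P>(\<omega> in M. x < X \<omega> \<and> \<theta> / 2 < T \<omega>)"
proof -
  have "\<forall>\<^sub>F x in at_top. \<forall>\<theta>\<in>S. dist (cond1 M (\<lambda>\<omega>. x < X \<omega>) T \<theta> / (h \<theta> * \<P>(\<omega> in M. x < X \<omega>))) 1 < 1/2"
    using equiv[unfolded uniform_equiv_def uniform_limit_iff, rule_format, of "1/2"] by simp
  with ex show ?thesis
  proof eventually_elim
    case (elim x)
    define q where "q = h \<theta> * \<P>(\<omega> in M. x < X \<omega>)"
    have q: "q > 0" using h[OF \<theta>(1)] X_pos by (simp add: q_def)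
    have d: "dist (cond1 M (\<lambda>\<omega>. x < X \<omega>) T \<theta> / q) 1 < 1/2" using elim \<theta> by (simp add: q_def)
    have "(1 - 1/2) * q \<le> cond1 M (\<lambda>\<omega>. x < X \<omega>) T \<theta>" using ratio_bounds(2)[OF d] q by simp
    then have pos: "0 < cond1 M (\<lambda>\<omega>. x < X \<omega>) T \<theta>" using q by simp
    obtain p where p: "(cond1_approx M (\<lambda>\<omega>. x < X \<omega>) T \<theta> \<longlongrightarrow> p) (at_right 0)"
      using elim \<theta> by (auto simp: cond1_exists_def)
    then have "cond1 M (\<lambda>\<omega>. x < X \<omega>) T \<theta> = p" unfolding cond1_def by (simp add: tendsto_Lim)
    with pos have "p > 0" by simp
    then have "\<forall>\<^sub>F \<delta> in at_right 0. 0 < cond1_approx M (\<lambda>\<omega>. x < X \<omega>) T \<theta> \<delta>"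
      using p by (rule order_tendstoD(1)[rotated])
    moreover have "\<forall>\<^sub>F \<delta> in at_right 0. \<delta> < \<theta> / 2"
      using \<theta> by (intro eventually_at_rightI[of 0 "\<theta> / 2"]) auto
    ultimately have "\<forall>\<^sub>F \<delta> in at_right 0. 0 < cond1_approx M (\<lambda>\<omega>. x < X \<omega>) T \<theta> \<delta> \<and> \<delta> < \<theta> / 2"
      by eventually_elim auto
    then obtain \<delta> where \<delta>: "0 < cond1_approx M (\<lambda>\<omega>. x < X \<omega>) T \<theta> \<delta>" "\<delta> < \<theta> / 2"
      using eventually_happens'[OF trivial_limit_at_right_real] by blast
    then have "0 < \<P>(\<omega> in M. x < X \<omega> \<and> T \<omega> \<in> {\<theta> - \<delta>..\<theta> + \<delta>})"
      unfolding cond1_approx_def cond_prob_def by (simp add: zero_less_divide_iff zero_less_measure_iff)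
    also have "\<dots> \<le> \<P>(\<omega> in M. x < X \<omega> \<and> \<theta> / 2 < T \<omega>)"
      using \<delta> by (intro finite_measure_mono) auto
    finally show ?case .
  qed
qed

text \<open>Up to a constant, the law of two variables and two weights is of product form far out. The law of the
  weights is represented by its restriction to the event \<open>A w\<close> at a reference level \<open>w\<close>, which may be chosen
  arbitrarily large.\<close>

definition joint_product_bound ::
    "('a \<Rightarrow> real) \<Rightarrow> ('a \<Rightarrow> real) \<Rightarrow> ('a \<Rightarrow> real) \<Rightarrow> ('a \<Rightarrow> real) \<Rightarrow> (real \<Rightarrow> 'a \<Rightarrow> bool) \<Rightarrow> bool"
  where "joint_product_bound Xi Xj Ti Tj A \<longleftrightarrow>
    (\<exists>z. \<forall>w\<ge>z. \<exists>C\<ge>0. \<forall>r\<ge>z. \<forall>r'\<ge>z. \<forall>B\<in>sets borel.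
      \<P>(\<omega> in M. r < \<bar>Xi \<omega>\<bar> \<and> r' < Xj \<omega> \<and> (Ti \<omega>, Tj \<omega>) \<in> B)
        \<le> C * \<P>(\<omega> in M. r < \<bar>Xi \<omega>\<bar> \<and> r' < Xj \<omega>) * \<P>(\<omega> in M. A w \<omega> \<and> (Ti \<omega>, Tj \<omega>) \<in> B))"

text \<open>The reference event may involve \<open>|Xi|\<close>. It may involve \<open>Xi\<close> itself by the lower bound with
  constant \<open>L\<close>, provided that joint exceedances have positive probability.\<close>

lemma pair_bound_of_cond2:
  fixes Xi Xj Ti Tj :: "'a \<Rightarrow> real" and S :: "real set"
  assumes [measurable]: "Xi \<in> borel_measurable M" "Xj \<in> borel_measurable M"
      "Ti \<in> borel_measurable M" "Tj \<in> borel_measurable M"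
    and S: "AE \<omega> in M. Ti \<omega> \<in> S" "AE \<omega> in M. Tj \<omega> \<in> S"
    and ex: "\<forall>\<^sub>F (x, y) in min_at_top. \<forall>\<theta>\<in>S \<times> S.
        cond2_exists M (\<lambda>\<omega>. x < \<bar>Xi \<omega>\<bar> \<and> y < Xj \<omega>) Ti Tj \<theta> \<and>
        cond2_exists M (\<lambda>\<omega>. x < Xi \<omega> \<and> y < Xj \<omega>) Ti Tj \<theta>"
    and equiv: "uniform_equiv min_at_top (S \<times> S)
        (\<lambda>(x, y) \<theta>. cond2 M (\<lambda>\<omega>. x < \<bar>Xi \<omega>\<bar> \<and> y < Xj \<omega>) Ti Tj \<theta>)
        (\<lambda>(x, y) \<theta>. g \<theta> * \<P>(\<omega> in M. x < \<bar>Xi \<omega>\<bar> \<and> y < Xj \<omega>))"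
    and lower: "uniform_lesssim min_at_top (S \<times> S)
        (\<lambda>(x, y) \<theta>. L * g \<theta> * \<P>(\<omega> in M. x < Xi \<omega> \<and> y < Xj \<omega>))
        (\<lambda>(x, y) \<theta>. cond2 M (\<lambda>\<omega>. x < Xi \<omega> \<and> y < Xj \<omega>) Ti Tj \<theta>)"
    and L: "L > 0"
    and g: "\<And>\<theta>. \<theta> \<in> S \<times> S \<Longrightarrow> 0 < g \<theta>"
  shows "joint_product_bound Xi Xj Ti Tj (\<lambda>w \<omega>. w < \<bar>Xi \<omega>\<bar> \<and> w < Xj \<omega>)"
    and "(\<And>x. 0 < \<P>(\<omega> in M. x < Xi \<omega> \<and> x < Xj \<omega>)) \<Longrightarrow>
      joint_product_bound Xi Xj Ti Tj (\<lambda>w \<omega>. w < Xi \<omega> \<and> w < Xj \<omega>)"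
proof -
  define G where "G x y = \<P>(\<omega> in M. x < \<bar>Xi \<omega>\<bar> \<and> y < Xj \<omega>)" for x y
  define G' where "G' x y = \<P>(\<omega> in M. x < Xi \<omega> \<and> y < Xj \<omega>)" for x y
  define c where "c x y = cond2 M (\<lambda>\<omega>. x < \<bar>Xi \<omega>\<bar> \<and> y < Xj \<omega>) Ti Tj" for x y
  define c' where "c' x y = cond2 M (\<lambda>\<omega>. x < Xi \<omega> \<and> y < Xj \<omega>) Ti Tj" for x y
  have G_nn: "G x y \<ge> 0" "G' x y \<ge> 0" for x y by (simp_all add: G_def G'_def)
  have "AE \<omega> in M. (Ti \<omega>, Tj \<omega>) \<in> S \<times> S" using S by eventually_elim auto
  then have SS: "AE \<omega> in M. (Ti \<omega>, Tj \<omega>) \<in> S \<times> S" .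
  have "\<exists>\<theta>. \<theta> \<in> S \<times> S"
  proof (rule ccontr)
    assume "\<not> ?thesis"
    then have "AE \<omega> in M. (Ti \<omega>, Tj \<omega>) \<in> S \<times> S \<longrightarrow> False" by (intro AE_I2) blast
    with SS have "AE \<omega> in M. False" by (rule AE_mp)
    then show False by simp
  qed
  then obtain \<theta>0 where \<theta>0: "\<theta>0 \<in> S \<times> S" by blast
  have ev1: "\<forall>\<^sub>F p in min_at_top. \<forall>\<theta>\<in>S \<times> S. dist (c (fst p) (snd p) \<theta> / (g \<theta> * G (fst p) (snd p))) 1 < 1/2"
    unfolding G_def c_def
    by (rule equiv[unfolded uniform_equiv_def uniform_limit_iff case_prod_unfold, rule_format]) simp
  have ev2: "\<forall>\<^sub>F p in min_at_top. \<forall>\<theta>\<in>S \<times> S.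
        cond2_exists M (\<lambda>\<omega>. fst p < \<bar>Xi \<omega>\<bar> \<and> snd p < Xj \<omega>) Ti Tj \<theta> \<and>
        cond2_exists M (\<lambda>\<omega>. fst p < Xi \<omega> \<and> snd p < Xj \<omega>) Ti Tj \<theta>"
    using ex unfolding case_prod_unfold .
  obtain z1 where z1':
    "\<forall>x\<ge>z1. \<forall>y\<ge>z1. (\<forall>\<theta>\<in>S \<times> S. dist (c x y \<theta> / (g \<theta> * G x y)) 1 < 1/2) \<and> (\<forall>\<theta>\<in>S \<times> S.
        cond2_exists M (\<lambda>\<omega>. x < \<bar>Xi \<omega>\<bar> \<and> y < Xj \<omega>) Ti Tj \<theta> \<and>
        cond2_exists M (\<lambda>\<omega>. x < Xi \<omega> \<and> y < Xj \<omega>) Ti Tj \<theta>)"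
    using eventually_conj[OF ev1 ev2] unfolding eventually_min_at_top fst_conv snd_conv by (rule exE)
  have z1: "cond2_exists M (\<lambda>\<omega>. x < \<bar>Xi \<omega>\<bar> \<and> y < Xj \<omega>) Ti Tj \<theta>"
    "cond2_exists M (\<lambda>\<omega>. x < Xi \<omega> \<and> y < Xj \<omega>) Ti Tj \<theta>"
    "dist (c x y \<theta> / (g \<theta> * G x y)) 1 < 1/2"
    if "x \<ge> z1" "y \<ge> z1" "\<theta> \<in> S \<times> S" for x y \<theta>
    using z1'[rule_format, OF that(1,2)] that(3) by blast+
  \<comment> \<open>The relative error \<open>1/2\<close> gives the factor \<open>(1 + 1/2) / (1 - 1/2) = 3\<close>.\<close>
  have c_bounds: "0 < G x y" "g \<theta> * G x y \<le> 2 * c x y \<theta>" "2 * c x y \<theta> \<le> 3 * (g \<theta> * G x y)"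
    if "x \<ge> z1" "y \<ge> z1" "\<theta> \<in> S \<times> S" for x y \<theta>
  proof -
    have nn: "g \<theta> * G x y \<ge> 0" using g[OF that(3)] G_nn by simp
    note b = ratio_bounds[OF z1(3)[OF that] _ nn]
    show "0 < G x y" using b(1) g[OF that(3)] by (simp add: zero_less_mult_iff)
    show "g \<theta> * G x y \<le> 2 * c x y \<theta>" "2 * c x y \<theta> \<le> 3 * (g \<theta> * G x y)" using b(2,3) by simp_all
  qed
  have reference: "\<exists>C\<ge>0. \<forall>r\<ge>z1. \<forall>r'\<ge>z1. \<forall>B\<in>sets borel.
      \<P>(\<omega> in M. r < \<bar>Xi \<omega>\<bar> \<and> r' < Xj \<omega> \<and> (Ti \<omega>, Tj \<omega>) \<in> B)
        \<le> C * G r r' * \<P>(\<omega> in M. A \<omega> \<and> (Ti \<omega>, Tj \<omega>) \<in> B)"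
    if A [measurable]: "Measurable.pred M A" and \<kappa>: "\<kappa> > 0"
      and A_ex: "\<And>\<theta>. \<theta> \<in> S \<times> S \<Longrightarrow> cond2_exists M A Ti Tj \<theta>"
      and A_ge: "\<And>\<theta>. \<theta> \<in> S \<times> S \<Longrightarrow> g \<theta> * \<kappa> \<le> 2 * cond2 M A Ti Tj \<theta>" for A \<kappa>
  proof (intro exI[of _ "3 / \<kappa>"] conjI allI impI ballI)
    show "0 \<le> 3 / \<kappa>" using \<kappa> by simp
    fix r r' and B :: "(real \<times> real) set" assume r: "r \<ge> z1" "r' \<ge> z1" and B: "B \<in> sets borel"
    have K: "0 \<le> 3 / \<kappa> * G r r'" using \<kappa> G_nn by simp
    have "\<P>(\<omega> in M. (r < \<bar>Xi \<omega>\<bar> \<and> r' < Xj \<omega>) \<and> (Ti \<omega>, Tj \<omega>) \<in> B)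
        \<le> 3 / \<kappa> * G r r' * \<P>(\<omega> in M. A \<omega> \<and> (Ti \<omega>, Tj \<omega>) \<in> B)"
    proof (rule cond2_compare)
      show "AE \<omega> in M. cond2_exists M (\<lambda>\<omega>. r < \<bar>Xi \<omega>\<bar> \<and> r' < Xj \<omega>) Ti Tj (Ti \<omega>, Tj \<omega>) \<and>
          cond2_exists M A Ti Tj (Ti \<omega>, Tj \<omega>)"
        using SS by eventually_elim (use z1(1)[OF r] A_ex in blast)
      show "AE \<omega> in M. cond2 M (\<lambda>\<omega>. r < \<bar>Xi \<omega>\<bar> \<and> r' < Xj \<omega>) Ti Tj (Ti \<omega>, Tj \<omega>)
          \<le> 3 / \<kappa> * G r r' * cond2 M A Ti Tj (Ti \<omega>, Tj \<omega>)"
        using SS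
      proof eventually_elim
        case (elim \<omega>)
        have "3 * (g (Ti \<omega>, Tj \<omega>) * G r r') = 3 / \<kappa> * G r r' * (g (Ti \<omega>, Tj \<omega>) * \<kappa>)" using \<kappa> by simp
        also have "\<dots> \<le> 3 / \<kappa> * G r r' * (2 * cond2 M A Ti Tj (Ti \<omega>, Tj \<omega>))"
          by (intro mult_left_mono A_ge elim K)
        finally show ?case using c_bounds(3)[OF r elim] unfolding c_def by simp
      qed
    qed (use K B in measurable)
    then show "\<P>(\<omega> in M. r < \<bar>Xi \<omega>\<bar> \<and> r' < Xj \<omega> \<and> (Ti \<omega>, Tj \<omega>) \<in> B)
        \<le> 3 / \<kappa> * G r r' * \<P>(\<omega> in M. A \<omega> \<and> (Ti \<omega>, Tj \<omega>) \<in> B)" by (simp add: conj_assoc)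
  qed
  show "joint_product_bound Xi Xj Ti Tj (\<lambda>w \<omega>. w < \<bar>Xi \<omega>\<bar> \<and> w < Xj \<omega>)"
    unfolding joint_product_bound_def G_def[symmetric]
  proof (rule exI[of _ z1], intro allI impI reference)
    fix w assume w: "w \<ge> z1"
    show "0 < G w w" by (rule c_bounds(1)[OF w w \<theta>0])
    show "cond2_exists M (\<lambda>\<omega>. w < \<bar>Xi \<omega>\<bar> \<and> w < Xj \<omega>) Ti Tj \<theta>" if "\<theta> \<in> S \<times> S" for \<theta>
      by (rule z1(1)[OF w w that])
    show "g \<theta> * G w w \<le> 2 * cond2 M (\<lambda>\<omega>. w < \<bar>Xi \<omega>\<bar> \<and> w < Xj \<omega>) Ti Tj \<theta>" if "\<theta> \<in> S \<times> S" for \<theta>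
      using c_bounds(2)[OF w w that] unfolding c_def .
  qed measurable
  show "joint_product_bound Xi Xj Ti Tj (\<lambda>w \<omega>. w < Xi \<omega> \<and> w < Xj \<omega>)"
    if pos: "\<And>x. 0 < \<P>(\<omega> in M. x < Xi \<omega> \<and> x < Xj \<omega>)"
  proof -
    have "Limsup min_at_top (\<lambda>p. SUP \<theta>\<in>S \<times> S. ereal (L * g \<theta> * G' (fst p) (snd p)) / ereal (c' (fst p) (snd p) \<theta>)) \<le> 1"
      using lower unfolding uniform_lesssim_def G'_def c'_def by (simp add: case_prod_unfold)
    also have "1 < (2 :: ereal)" by simp
    finally have "\<forall>\<^sub>F p in min_at_top. (SUP \<theta>\<in>S \<times> S. ereal (L * g \<theta> * G' (fst p) (snd p)) / ereal (c' (fst p) (snd p) \<theta>)) < 2"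
      by (rule Limsup_lessD)
    then obtain z2 where z2: "\<And>x y. x \<ge> z2 \<Longrightarrow> y \<ge> z2 \<Longrightarrow>
        (SUP \<theta>\<in>S \<times> S. ereal (L * g \<theta> * G' x y) / ereal (c' x y \<theta>)) < 2"
      unfolding eventually_min_at_top by auto
    define z where "z = max z1 z2"
    have c'_bound: "L * g \<theta> * G' w w \<le> 2 * c' w w \<theta>" if w: "w \<ge> z" and \<theta>: "\<theta> \<in> S \<times> S" for w \<theta>
    proof -
      have w': "w \<ge> z1" "w \<ge> z2" using w by (auto simp: z_def)
      obtain p where p: "(cond2_approx M (\<lambda>\<omega>. w < Xi \<omega> \<and> w < Xj \<omega>) Ti Tj \<theta> \<longlongrightarrow> p) (at_right 0)"
        using z1(2)[OF w'(1) w'(1) \<theta>] by (auto simp: cond2_exists_def)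
      have "p \<ge> 0"
        by (rule tendsto_lowerbound[OF p]) (auto simp: cond2_approx_def cond_prob_def)
      moreover have "c' w w \<theta> = p" using p unfolding c'_def cond2_def by (simp add: tendsto_Lim)
      ultimately have nn: "c' w w \<theta> \<ge> 0" by simp
      have a: "L * g \<theta> * G' w w > 0" using L g[OF \<theta>] pos[of w] by (simp add: G'_def)
      have less: "ereal (L * g \<theta> * G' w w) / ereal (c' w w \<theta>) < 2"
        using z2[OF w'(2) w'(2)] \<theta> by (meson SUP_upper le_less_trans)
      show ?thesis
      proof (cases "c' w w \<theta> = 0")
        case True
        then show ?thesis using less a by (auto split: if_splits)
      next
        case False
        then have "L * g \<theta> * G' w w / c' w w \<theta> < 2" using less by simp
        then show ?thesis using False nn by (simp add: field_simps)
      qed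
    qed
    have "\<exists>C\<ge>0. \<forall>r\<ge>z1. \<forall>r'\<ge>z1. \<forall>B\<in>sets borel.
      \<P>(\<omega> in M. r < \<bar>Xi \<omega>\<bar> \<and> r' < Xj \<omega> \<and> (Ti \<omega>, Tj \<omega>) \<in> B)
        \<le> C * G r r' * \<P>(\<omega> in M. (w < Xi \<omega> \<and> w < Xj \<omega>) \<and> (Ti \<omega>, Tj \<omega>) \<in> B)" if w: "w \<ge> z" for w
    proof (rule reference)
      show "0 < L * G' w w" using L pos[of w] by (simp add: G'_def)
      show "cond2_exists M (\<lambda>\<omega>. w < Xi \<omega> \<and> w < Xj \<omega>) Ti Tj \<theta>" if "\<theta> \<in> S \<times> S" for \<theta>
        using w by (intro z1(2) that) (auto simp: z_def)
      show "g \<theta> * (L * G' w w) \<le> 2 * cond2 M (\<lambda>\<omega>. w < Xi \<omega> \<and> w < Xj \<omega>) Ti Tj \<theta>" if "\<theta> \<in> S \<times> S" for \<theta>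
        using c'_bound[OF w that] unfolding c'_def by (simp add: mult_ac)
    qed measurable
    moreover have "z1 \<le> z" by (simp add: z_def)
    ultimately show ?thesis
      unfolding joint_product_bound_def G_def[symmetric] by (meson order_trans)
  qed
qed

text \<open>One of the two weights may be separated from the joint exceedance, provided that the reference event bounds
  the variable \<open>Z\<close> belonging to this weight from below: \<open>near_product\<close> then turns the reference level into any
  level \<open>q\<close>.\<close>

lemma joint_le_weight:
  assumes var: "weighted_variable M Z T b" and bound: "joint_product_bound Xi Xj Ti Tj A"
    and A: "\<And>w \<omega>. A w \<omega> \<Longrightarrow> w < Z \<omega>"
    and T: "\<And>\<omega>. T \<omega> = \<phi> (Ti \<omega>, Tj \<omega>)" and \<phi>: "\<phi> \<in> borel_measurable borel"
  shows "\<exists>C\<ge>0. \<exists>z. \<forall>r\<ge>z. \<forall>r'\<ge>z. \<forall>q\<ge>z. \<forall>B\<in>sets borel.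
      \<P>(\<omega> in M. r < \<bar>Xi \<omega>\<bar> \<and> r' < Xj \<omega> \<and> T \<omega> \<in> B) * \<P>(\<omega> in M. q < Z \<omega>)
        \<le> C * \<P>(\<omega> in M. r < \<bar>Xi \<omega>\<bar> \<and> r' < Xj \<omega>) * \<P>(\<omega> in M. q < Z \<omega> \<and> T \<omega> \<in> B)"
proof -
  interpret weighted_variable M Z T b by fact
  obtain z1 where z1: "\<And>w. w \<ge> z1 \<Longrightarrow> \<exists>C\<ge>0. \<forall>r\<ge>z1. \<forall>r'\<ge>z1. \<forall>B\<in>sets borel.
      \<P>(\<omega> in M. r < \<bar>Xi \<omega>\<bar> \<and> r' < Xj \<omega> \<and> (Ti \<omega>, Tj \<omega>) \<in> B)
        \<le> C * \<P>(\<omega> in M. r < \<bar>Xi \<omega>\<bar> \<and> r' < Xj \<omega>) * \<P>(\<omega> in M. A w \<omega> \<and> (Ti \<omega>, Tj \<omega>) \<in> B)"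
    using bound unfolding joint_product_bound_def by blast
  obtain z2 where z2: "\<And>r r' B. r \<ge> z2 \<Longrightarrow> r' \<ge> z2 \<Longrightarrow> B \<in> sets borel \<Longrightarrow>
      \<P>(\<omega> in M. r < Z \<omega> \<and> T \<omega> \<in> B) * F r' \<le> (1 + 1) * F r * \<P>(\<omega> in M. r' < Z \<omega> \<and> T \<omega> \<in> B)"
    using near_product[of 1] unfolding F_def by auto
  define z where "z = max z1 z2"
  obtain C where C: "C \<ge> 0" "\<And>r r' B. r \<ge> z1 \<Longrightarrow> r' \<ge> z1 \<Longrightarrow> B \<in> sets borel \<Longrightarrow>
      \<P>(\<omega> in M. r < \<bar>Xi \<omega>\<bar> \<and> r' < Xj \<omega> \<and> (Ti \<omega>, Tj \<omega>) \<in> B)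
        \<le> C * \<P>(\<omega> in M. r < \<bar>Xi \<omega>\<bar> \<and> r' < Xj \<omega>) * \<P>(\<omega> in M. A z \<omega> \<and> (Ti \<omega>, Tj \<omega>) \<in> B)"
    using z1[of z] by (auto simp: z_def)
  have "\<P>(\<omega> in M. r < \<bar>Xi \<omega>\<bar> \<and> r' < Xj \<omega> \<and> T \<omega> \<in> B) * F q
      \<le> (C * (2 * F z)) * \<P>(\<omega> in M. r < \<bar>Xi \<omega>\<bar> \<and> r' < Xj \<omega>) * \<P>(\<omega> in M. q < Z \<omega> \<and> T \<omega> \<in> B)"
    if r: "r \<ge> z" "r' \<ge> z" "q \<ge> z" and B [measurable]: "B \<in> sets borel" for r r' q B
  proof -
    define p where "p = \<P>(\<omega> in M. r < \<bar>Xi \<omega>\<bar> \<and> r' < Xj \<omega>)"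
    have \<phi>B: "\<phi> -` B \<in> sets borel" using measurable_sets[OF \<phi> B] by simp
    have "\<P>(\<omega> in M. r < \<bar>Xi \<omega>\<bar> \<and> r' < Xj \<omega> \<and> T \<omega> \<in> B) \<le> C * p * \<P>(\<omega> in M. A z \<omega> \<and> T \<omega> \<in> B)"
      using C(2)[OF _ _ \<phi>B, of r r'] r by (simp add: p_def z_def T)
    also have "\<dots> \<le> C * p * \<P>(\<omega> in M. z < Z \<omega> \<and> T \<omega> \<in> B)"
      using C A by (intro mult_left_mono finite_measure_mono) (auto simp: p_def)
    finally have "\<P>(\<omega> in M. r < \<bar>Xi \<omega>\<bar> \<and> r' < Xj \<omega> \<and> T \<omega> \<in> B) * F q
        \<le> (C * p * \<P>(\<omega> in M. z < Z \<omega> \<and> T \<omega> \<in> B)) * F q"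
      using F_pos[of q] by (intro mult_right_mono) auto
    also have "\<dots> = C * p * (\<P>(\<omega> in M. z < Z \<omega> \<and> T \<omega> \<in> B) * F q)" by (simp add: mult_ac)
    also have "\<dots> \<le> C * p * ((1 + 1) * F z * \<P>(\<omega> in M. q < Z \<omega> \<and> T \<omega> \<in> B))"
      using r C by (intro mult_left_mono z2 B) (auto simp: z_def p_def)
    finally show ?thesis by (simp add: p_def mult_ac)
  qed
  moreover have "0 \<le> C * (2 * F z)" using C F_pos[of z] by simp
  ultimately show ?thesis unfolding F_def[symmetric] by blast
qed

end

section \<open>Joint exceedances of two products\<close>

context weighted_variable
begin

text \<open>The staircase comparison for the levels \<open>x / T\<close>.\<close>

lemma product_part_le:
  assumes [measurable]: "Z \<in> borel_measurable M" "Measurable.pred M A"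
    and e: "0 \<le> e"
    and le: "\<And>r B. r \<ge> R \<Longrightarrow> B \<in> sets borel \<Longrightarrow>
      \<P>(\<omega> in M. A \<omega> \<and> r < Z \<omega> \<and> T \<omega> \<in> B) \<le> e * \<P>(\<omega> in M. r < X \<omega> \<and> T \<omega> \<in> B)"
    and x: "\<forall>w. 0 < w \<and> w \<le> b x \<longrightarrow> R \<le> x / w"
  shows "\<P>(\<omega> in M. A \<omega> \<and> x / T \<omega> < Z \<omega> \<and> T \<omega> \<in> {0<..b x}) \<le> e * H x"
proof -
  have "\<P>(\<omega> in M. A \<omega> \<and> x / T \<omega> < Z \<omega> \<and> T \<omega> \<in> {0<..b x})
      \<le> e * \<P>(\<omega> in M. x / T \<omega> < X \<omega> \<and> T \<omega> \<in> {0<..b x})"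
  proof (rule prob_staircase_le[where ?r0.0=R])
    show "R \<le> x / w" if "w \<in> {0<..b x}" for w using that by (intro x[rule_format]) auto
    show "\<P>(\<omega> in M. A \<omega> \<and> r < Z \<omega> \<and> T \<omega> \<in> B) \<le> e * \<P>(\<omega> in M. r < X \<omega> \<and> T \<omega> \<in> B)"
      if "R \<le> r" "B \<in> sets borel" for r B using that by (rule le)
    show "0 \<le> e" by fact
  qed (measurable; fail)+
  also have "\<dots> \<le> e * H x"
    by (intro mult_left_mono product_tail_ge e) auto
  finally show ?thesis .
qed

end

text \<open>Two weighted variables whose joint law has product bounds. Weights above \<open>b x\<close> are negligible even compared
  with a joint exceedance of the products.\<close>

locale weighted_pair = prob_space M +
  i: weighted_variable M Xi Ti b + j: weighted_variable M Xj Tj b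
  for M :: "'a measure" and Xi Ti Xj Tj :: "'a \<Rightarrow> real" and b :: "real \<Rightarrow> real" +
  assumes negligible_pair: "\<And>e. e > 0 \<Longrightarrow> \<exists>z. \<forall>x\<ge>z. \<forall>y\<ge>z.
      \<P>(\<omega> in M. b x < Ti \<omega>) \<le> e * \<P>(\<omega> in M. x < Ti \<omega> * Xi \<omega> \<and> y < Tj \<omega> * Xj \<omega>) \<and>
      \<P>(\<omega> in M. b y < Tj \<omega>) \<le> e * \<P>(\<omega> in M. x < Ti \<omega> * Xi \<omega> \<and> y < Tj \<omega> * Xj \<omega>)"
    and joint_bound: "joint_product_bound Xi Xj Ti Tj (\<lambda>w \<omega>. w < \<bar>Xi \<omega>\<bar> \<and> w < Xj \<omega>)"
    and joint_bound_pos: "(\<And>x. 0 < \<P>(\<omega> in M. x < Xi \<omega> \<and> x < Xj \<omega>)) \<Longrightarrow>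
      joint_product_bound Xi Xj Ti Tj (\<lambda>w \<omega>. w < Xi \<omega> \<and> w < Xj \<omega>)"
begin

lemma joint_le_second:
  "\<exists>C\<ge>0. \<exists>z. \<forall>r\<ge>z. \<forall>r'\<ge>z. \<forall>q\<ge>z. \<forall>B\<in>sets borel.
      \<P>(\<omega> in M. r < \<bar>Xi \<omega>\<bar> \<and> r' < Xj \<omega> \<and> Tj \<omega> \<in> B) * j.F q
        \<le> C * \<P>(\<omega> in M. r < \<bar>Xi \<omega>\<bar> \<and> r' < Xj \<omega>) * \<P>(\<omega> in M. q < Xj \<omega> \<and> Tj \<omega> \<in> B)"
  unfolding j.F_def
  by (rule joint_le_weight[OF j.weighted_variable_axioms joint_bound, where \<phi>=snd]) auto

text \<open>Here the reference event must bound \<open>Xi\<close> from below, because \<open>Xi < - w\<close> gives no information on the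
  dependence between \<open>Ti\<close> and large values of \<open>Xi\<close>.\<close>

lemma joint_le_first:
  assumes pos: "\<And>x. 0 < \<P>(\<omega> in M. x < Xi \<omega> \<and> x < Xj \<omega>)"
  shows "\<exists>C\<ge>0. \<exists>z. \<forall>r\<ge>z. \<forall>r'\<ge>z. \<forall>q\<ge>z. \<forall>B\<in>sets borel.
      \<P>(\<omega> in M. r < \<bar>Xi \<omega>\<bar> \<and> r' < Xj \<omega> \<and> Ti \<omega> \<in> B) * i.F q
        \<le> C * \<P>(\<omega> in M. r < \<bar>Xi \<omega>\<bar> \<and> r' < Xj \<omega>) * \<P>(\<omega> in M. q < Xi \<omega> \<and> Ti \<omega> \<in> B)"
  unfolding i.F_def
  by (rule joint_le_weight[OF i.weighted_variable_axioms joint_bound_pos[OF pos], where \<phi>=fst]) auto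

lemma scaled_bound:
  fixes q f p s C e :: real
  assumes "q * f \<le> C * p * s" "p \<le> e / (C + 1) * f" "f > 0" "C \<ge> 0" "s \<ge> 0" "e \<ge> 0"
  shows "q \<le> e * s"
proof -
  have "C * p \<le> C * (e / (C + 1) * f)" using assms by (intro mult_left_mono)
  also have "\<dots> = (C / (C + 1)) * (e * f)" by simp
  also have "\<dots> \<le> 1 * (e * f)" using assms by (intro mult_right_mono) (auto simp: field_simps)
  finally have "C * p * s \<le> (e * f) * s" using assms by (intro mult_right_mono) auto
  with assms(1) have "q * f \<le> (e * s) * f" by (simp add: mult_ac)
  then show ?thesis using assms by simp
qed

text \<open>On \<open>Ti \<le> b x\<close> the event \<open>|Ti Xi| > x\<close> forces \<open>|Xi| > x / b x\<close>, a level independent of \<open>Ti\<close>; thus only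
  the weight \<open>Tj\<close> has to be separated.\<close>

lemma products_pTAI:
  assumes X: "\<And>e. e > 0 \<Longrightarrow> \<exists>z. \<forall>x\<ge>z. \<forall>y\<ge>z. \<P>(\<omega> in M. x < \<bar>Xi \<omega>\<bar> \<and> y < Xj \<omega>) \<le> e * j.F y"
    and e: "e > 0"
  shows "\<exists>z. \<forall>x\<ge>z. \<forall>y\<ge>z. \<P>(\<omega> in M. x < \<bar>Ti \<omega> * Xi \<omega>\<bar> \<and> y < Tj \<omega> * Xj \<omega>) \<le> e * j.H y"
proof -
  obtain C z1 where C: "C \<ge> 0" and z1: "\<And>r r' B. r \<ge> z1 \<Longrightarrow> r' \<ge> z1 \<Longrightarrow> B \<in> sets borel \<Longrightarrow>
      \<P>(\<omega> in M. r < \<bar>Xi \<omega>\<bar> \<and> r' < Xj \<omega> \<and> Tj \<omega> \<in> B) * j.F r'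
        \<le> C * \<P>(\<omega> in M. r < \<bar>Xi \<omega>\<bar> \<and> r' < Xj \<omega>) * \<P>(\<omega> in M. r' < Xj \<omega> \<and> Tj \<omega> \<in> B)"
    using joint_le_second by blast
  have "e / 3 / (C + 1) > 0" using e C by simp
  from X[OF this] obtain z2 where z2: "\<And>x y. x \<ge> z2 \<Longrightarrow> y \<ge> z2 \<Longrightarrow>
      \<P>(\<omega> in M. x < \<bar>Xi \<omega>\<bar> \<and> y < Xj \<omega>) \<le> e / 3 / (C + 1) * j.F y" by blast
  define R where "R = max z1 z2"
  obtain z3 where z3: "\<And>x y. x \<ge> z3 \<Longrightarrow> y \<ge> z3 \<Longrightarrow>
      \<P>(\<omega> in M. b x < Ti \<omega>) \<le> e / 3 * \<P>(\<omega> in M. x < Ti \<omega> * Xi \<omega> \<and> y < Tj \<omega> * Xj \<omega>) \<and>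
      \<P>(\<omega> in M. b y < Tj \<omega>) \<le> e / 3 * \<P>(\<omega> in M. x < Ti \<omega> * Xi \<omega> \<and> y < Tj \<omega> * Xj \<omega>)"
    using negligible_pair[of "e / 3"] e by auto
  obtain z4 where z4: "\<And>x. x \<ge> z4 \<Longrightarrow> \<forall>w. 0 < w \<and> w \<le> b x \<longrightarrow> R \<le> x / w"
    using i.ratio_b_at_top[of R] unfolding eventually_at_top_linorder by blast
  define z where "z = max 0 (max z3 z4)"
  show ?thesis
  proof (intro exI[of _ z] allI impI)
    fix x y assume x: "x \<ge> z" and y: "y \<ge> z"
    define u where "u = x / b x"
    have bx: "b x > 0" using i.b_pos x by (simp add: z_def)
    have u: "u \<ge> R" using z4[of x] x bx by (simp add: u_def z_def)
    have near: "\<P>(\<omega> in M. u < \<bar>Xi \<omega>\<bar> \<and> r < Xj \<omega> \<and> Tj \<omega> \<in> B) \<le> e / 3 * \<P>(\<omega> in M. r < Xj \<omega> \<and> Tj \<omega> \<in> B)"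
      if "r \<ge> R" "B \<in> sets borel" for r B
      using that u C e j.F_pos[of r] by (intro scaled_bound[OF z1 z2]) (auto simp: R_def)
    have 3: "\<P>(\<omega> in M. u < \<bar>Xi \<omega>\<bar> \<and> y / Tj \<omega> < Xj \<omega> \<and> Tj \<omega> \<in> {0<..b y}) \<le> e / 3 * j.H y"
    proof (rule j.product_part_le[where R=R])
      show "\<forall>w. 0 < w \<and> w \<le> b y \<longrightarrow> R \<le> y / w" using y by (intro z4) (simp add: z_def)
    qed (use near e in auto)
    have joint: "\<P>(\<omega> in M. x < Ti \<omega> * Xi \<omega> \<and> y < Tj \<omega> * Xj \<omega>) \<le> j.H y"
      unfolding j.H_def by (intro finite_measure_mono) auto
    have "e / 3 * \<P>(\<omega> in M. x < Ti \<omega> * Xi \<omega> \<and> y < Tj \<omega> * Xj \<omega>) \<le> e / 3 * j.H y"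
      using e by (intro mult_left_mono joint) auto
    then have 12: "\<P>(\<omega> in M. b x < Ti \<omega>) \<le> e / 3 * j.H y" "\<P>(\<omega> in M. b y < Tj \<omega>) \<le> e / 3 * j.H y"
      using z3[of x y] x y by (auto simp: z_def)
    have "\<P>(\<omega> in M. x < \<bar>Ti \<omega> * Xi \<omega>\<bar> \<and> y < Tj \<omega> * Xj \<omega>) \<le> \<P>(\<omega> in M. b x < Ti \<omega>)
        + \<P>(\<omega> in M. b y < Tj \<omega> \<or> u < \<bar>Xi \<omega>\<bar> \<and> y / Tj \<omega> < Xj \<omega> \<and> Tj \<omega> \<in> {0<..b y})"
    proof (rule prob_le_add, goal_cases)
      case 3
      show ?case
        using i.T_nonneg j.T_nonneg
      proof eventually_elim
        case (elim \<omega>)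
        have "u < \<bar>Xi \<omega>\<bar> \<and> y / Tj \<omega> < Xj \<omega> \<and> 0 < Tj \<omega>"
          if *: "x < \<bar>Ti \<omega> * Xi \<omega>\<bar>" "y < Tj \<omega> * Xj \<omega>" "Ti \<omega> \<le> b x"
        proof -
          have "x < Ti \<omega> * \<bar>Xi \<omega>\<bar>" using * elim by (simp add: abs_mult)
          also have "\<dots> \<le> b x * \<bar>Xi \<omega>\<bar>" using * by (intro mult_right_mono) auto
          finally have "u < \<bar>Xi \<omega>\<bar>" using bx by (simp add: u_def pos_divide_less_eq mult.commute)
          moreover have "Tj \<omega> \<noteq> 0" using * y by (auto simp: z_def)
          then have "Tj \<omega> > 0" using elim by simp
          ultimately show ?thesis using * by (simp add: pos_divide_less_eq mult.commute)
        qed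
        then show ?case by force
      qed
    qed measurable
    also have "\<P>(\<omega> in M. b y < Tj \<omega> \<or> u < \<bar>Xi \<omega>\<bar> \<and> y / Tj \<omega> < Xj \<omega> \<and> Tj \<omega> \<in> {0<..b y})
        \<le> \<P>(\<omega> in M. b y < Tj \<omega>) + \<P>(\<omega> in M. u < \<bar>Xi \<omega>\<bar> \<and> y / Tj \<omega> < Xj \<omega> \<and> Tj \<omega> \<in> {0<..b y})"
      by (rule prob_le_add) auto
    finally show "\<P>(\<omega> in M. x < \<bar>Ti \<omega> * Xi \<omega>\<bar> \<and> y < Tj \<omega> * Xj \<omega>) \<le> e * j.H y"
      using 12 3 by simp
  qed
qed

text \<open>If \<open>Xi\<close> and \<open>Xj\<close> are never large together, a joint exceedance of the products needs a weight
  above \<open>b x\<close>. These two events together have at most half the probability of the joint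
  exceedance, so all these probabilities vanish.\<close>

lemma weights_bounded:
  assumes 0: "\<P>(\<omega> in M. x1 < Xi \<omega> \<and> x1 < Xj \<omega>) = 0"
  shows "\<exists>m. (AE \<omega> in M. Ti \<omega> \<le> m) \<and> (AE \<omega> in M. Tj \<omega> \<le> m)"
proof -
  have "(0 :: real) < 1 / 4" by simp
  from negligible_pair[OF this] obtain z3 where z3': "\<forall>x\<ge>z3. \<forall>y\<ge>z3.
      \<P>(\<omega> in M. b x < Ti \<omega>) \<le> 1 / 4 * \<P>(\<omega> in M. x < Ti \<omega> * Xi \<omega> \<and> y < Tj \<omega> * Xj \<omega>) \<and>
      \<P>(\<omega> in M. b y < Tj \<omega>) \<le> 1 / 4 * \<P>(\<omega> in M. x < Ti \<omega> * Xi \<omega> \<and> y < Tj \<omega> * Xj \<omega>)"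
    by (rule exE)
  have z3: "\<P>(\<omega> in M. b x < Ti \<omega>) \<le> 1 / 4 * \<P>(\<omega> in M. x < Ti \<omega> * Xi \<omega> \<and> x < Tj \<omega> * Xj \<omega>) \<and>
      \<P>(\<omega> in M. b x < Tj \<omega>) \<le> 1 / 4 * \<P>(\<omega> in M. x < Ti \<omega> * Xi \<omega> \<and> x < Tj \<omega> * Xj \<omega>)"
    if "x \<ge> z3" for x
    by (rule z3'[rule_format, OF that that])
  obtain z4 where z4: "\<And>x. x \<ge> z4 \<Longrightarrow> \<forall>w. 0 < w \<and> w \<le> b x \<longrightarrow> x1 \<le> x / w"
    using i.ratio_b_at_top[of x1] unfolding eventually_at_top_linorder by blast
  define x where "x = max 0 (max z3 z4)"
  have x: "x \<ge> 0" "x \<ge> z3" "x \<ge> z4" by (auto simp: x_def)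
  define q where "q = \<P>(\<omega> in M. x < Ti \<omega> * Xi \<omega> \<and> x < Tj \<omega> * Xj \<omega>)"
  have "q \<le> \<P>(\<omega> in M. b x < Ti \<omega>) + \<P>(\<omega> in M. b x < Tj \<omega> \<or> x1 < Xi \<omega> \<and> x1 < Xj \<omega>)"
    unfolding q_def
  proof (rule prob_le_add, goal_cases)
    case 3
    show ?case
      using i.T_nonneg j.T_nonneg
    proof eventually_elim
      case (elim \<omega>)
      have *: "x1 < X" if "0 \<le> T" "T \<le> b x" "x < T * X" for T X :: real
      proof -
        have "T > 0" using that x by (cases "T = 0") auto
        then have "x1 \<le> x / T" using z4[OF x(3)] that by blast
        also have "\<dots> < X" using that \<open>T > 0\<close> by (simp add: pos_divide_less_eq mult.commute)
        finally show ?thesis .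
      qed
      show ?case using elim *[of "Ti \<omega>" "Xi \<omega>"] *[of "Tj \<omega>" "Xj \<omega>"]
        by (cases "Ti \<omega> \<le> b x"; cases "Tj \<omega> \<le> b x") auto
    qed
  qed measurable
  also have "\<P>(\<omega> in M. b x < Tj \<omega> \<or> x1 < Xi \<omega> \<and> x1 < Xj \<omega>)
      \<le> \<P>(\<omega> in M. b x < Tj \<omega>) + \<P>(\<omega> in M. x1 < Xi \<omega> \<and> x1 < Xj \<omega>)"
    by (rule prob_le_add) auto
  finally have "q \<le> 1 / 4 * q + 1 / 4 * q"
    using z3[OF x(2)] 0 unfolding q_def by linarith
  moreover have "q \<ge> 0" by (simp add: q_def)
  ultimately have "q = 0" by linarith
  then have "\<P>(\<omega> in M. b x < Ti \<omega>) = 0" "\<P>(\<omega> in M. b x < Tj \<omega>) = 0"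
    using z3[OF x(2)] by (simp_all add: q_def measure_le_0_iff)
  then have "AE \<omega> in M. \<not> b x < Ti \<omega>" "AE \<omega> in M. \<not> b x < Tj \<omega>"
    by (simp_all add: prob_Collect_eq_0)
  then have "AE \<omega> in M. Ti \<omega> \<le> b x" "AE \<omega> in M. Tj \<omega> \<le> b x" by (simp_all add: not_less)
  then show ?thesis by blast
qed

text \<open>Only equal levels are controlled here. The larger of the two weights determines the smaller of the levels
  \<open>x / Ti\<close>, \<open>x / Tj\<close>, at which both variables exceed; so either weight may have to be separated. If this is
  impossible for \<open>Ti\<close>, the weights are bounded and a single level \<open>x / m\<close> suffices.\<close>

lemma products_pQAI:
  assumes X: "\<And>e. e > 0 \<Longrightarrow> \<forall>\<^sub>F x in at_top. \<P>(\<omega> in M. x < \<bar>Xi \<omega>\<bar> \<and> x < Xj \<omega>) \<le> e * j.F x"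
    and F_eq: "i.F = j.F" and H_eq: "i.H = j.H"
    and D: "dominated_tail j.F"
    and e: "e > 0"
  shows "\<forall>\<^sub>F x in at_top. \<P>(\<omega> in M. x < \<bar>Ti \<omega> * Xi \<omega>\<bar> \<and> x < Tj \<omega> * Xj \<omega>) \<le> e * j.H x"
proof (cases "\<forall>x. 0 < \<P>(\<omega> in M. x < Xi \<omega> \<and> x < Xj \<omega>)")
  case True
  obtain C1 z1 where C1: "C1 \<ge> 0" and z1: "\<And>r r' B. r \<ge> z1 \<Longrightarrow> r' \<ge> z1 \<Longrightarrow> B \<in> sets borel \<Longrightarrow>
      \<P>(\<omega> in M. r < \<bar>Xi \<omega>\<bar> \<and> r' < Xj \<omega> \<and> Tj \<omega> \<in> B) * j.F r'
        \<le> C1 * \<P>(\<omega> in M. r < \<bar>Xi \<omega>\<bar> \<and> r' < Xj \<omega>) * \<P>(\<omega> in M. r' < Xj \<omega> \<and> Tj \<omega> \<in> B)"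
    using joint_le_second by blast
  obtain C2 z2 where C2: "C2 \<ge> 0" and z2: "\<And>r B. r \<ge> z2 \<Longrightarrow> B \<in> sets borel \<Longrightarrow>
      \<P>(\<omega> in M. r < \<bar>Xi \<omega>\<bar> \<and> r < Xj \<omega> \<and> Ti \<omega> \<in> B) * i.F r
        \<le> C2 * \<P>(\<omega> in M. r < \<bar>Xi \<omega>\<bar> \<and> r < Xj \<omega>) * \<P>(\<omega> in M. r < Xi \<omega> \<and> Ti \<omega> \<in> B)"
    using joint_le_first True by blast
  have "e / 4 / (C1 + 1) > 0" "e / 4 / (C2 + 1) > 0" using e C1 C2 by simp_all
  then have "\<forall>\<^sub>F x in at_top. \<P>(\<omega> in M. x < \<bar>Xi \<omega>\<bar> \<and> x < Xj \<omega>) \<le> e / 4 / (C1 + 1) * j.F x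
      \<and> \<P>(\<omega> in M. x < \<bar>Xi \<omega>\<bar> \<and> x < Xj \<omega>) \<le> e / 4 / (C2 + 1) * i.F x"
    unfolding F_eq by (intro eventually_conj X)
  then obtain z3 where z3: "\<And>x. x \<ge> z3 \<Longrightarrow> \<P>(\<omega> in M. x < \<bar>Xi \<omega>\<bar> \<and> x < Xj \<omega>) \<le> e / 4 / (C1 + 1) * j.F x"
    "\<And>x. x \<ge> z3 \<Longrightarrow> \<P>(\<omega> in M. x < \<bar>Xi \<omega>\<bar> \<and> x < Xj \<omega>) \<le> e / 4 / (C2 + 1) * i.F x"
    unfolding eventually_at_top_linorder by blast
  define R where "R = max z1 (max z2 z3)"
  have near_j: "\<P>(\<omega> in M. True \<and> r < min \<bar>Xi \<omega>\<bar> (Xj \<omega>) \<and> Tj \<omega> \<in> B) \<le> e / 4 * \<P>(\<omega> in M. r < Xj \<omega> \<and> Tj \<omega> \<in> B)"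
    if "r \<ge> R" "B \<in> sets borel" for r B
    using scaled_bound[OF z1[of r r B] z3(1)[of r]] that C1 e j.F_pos[of r] by (simp add: R_def)
  have near_i: "\<P>(\<omega> in M. True \<and> r < min \<bar>Xi \<omega>\<bar> (Xj \<omega>) \<and> Ti \<omega> \<in> B) \<le> e / 4 * \<P>(\<omega> in M. r < Xi \<omega> \<and> Ti \<omega> \<in> B)"
    if "r \<ge> R" "B \<in> sets borel" for r B
    using scaled_bound[OF z2[of r B] z3(2)[of r]] that C2 e i.F_pos[of r] by (simp add: R_def)
  have e4: "e / 4 > 0" using e by simp
  show ?thesis
    using i.ratio_b_at_top[of R] eventually_ge_at_top[of 0] i.T_negligible[OF e4] j.T_negligible[OF e4]
  proof eventually_elim
    case (elim x)
    have 1: "\<P>(\<omega> in M. True \<and> x / Tj \<omega> < min \<bar>Xi \<omega>\<bar> (Xj \<omega>) \<and> Tj \<omega> \<in> {0<..b x}) \<le> e / 4 * j.H x"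
      by (rule j.product_part_le[where R=R, OF _ _ _ near_j elim(1)]) (use e in auto)
    have 2: "\<P>(\<omega> in M. True \<and> x / Ti \<omega> < min \<bar>Xi \<omega>\<bar> (Xj \<omega>) \<and> Ti \<omega> \<in> {0<..b x}) \<le> e / 4 * i.H x"
      by (rule i.product_part_le[where R=R, OF _ _ _ near_i elim(1)]) (use e in auto)
    define A3 where "A3 \<omega> \<longleftrightarrow> True \<and> x / Tj \<omega> < min \<bar>Xi \<omega>\<bar> (Xj \<omega>) \<and> Tj \<omega> \<in> {0<..b x}" for \<omega>
    define A4 where "A4 \<omega> \<longleftrightarrow> True \<and> x / Ti \<omega> < min \<bar>Xi \<omega>\<bar> (Xj \<omega>) \<and> Ti \<omega> \<in> {0<..b x}" for \<omega>
    have [measurable]: "Measurable.pred M A3" "Measurable.pred M A4"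
      unfolding A3_def A4_def by measurable
    have "\<P>(\<omega> in M. x < \<bar>Ti \<omega> * Xi \<omega>\<bar> \<and> x < Tj \<omega> * Xj \<omega>)
        \<le> \<P>(\<omega> in M. b x < Ti \<omega> \<or> b x < Tj \<omega>) + \<P>(\<omega> in M. A3 \<omega> \<or> A4 \<omega>)"
    proof (rule prob_le_add, goal_cases)
      case 3
      show ?case
        using i.T_nonneg j.T_nonneg
      proof (eventually_elim, intro impI)
        fix \<omega> assume nn: "0 \<le> Ti \<omega>" "0 \<le> Tj \<omega>"
          and "x < \<bar>Ti \<omega> * Xi \<omega>\<bar> \<and> x < Tj \<omega> * Xj \<omega>"
        then have w: "x < Ti \<omega> * \<bar>Xi \<omega>\<bar>" "x < Tj \<omega> * Xj \<omega>" by (auto simp: abs_mult)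
        have "Ti \<omega> \<noteq> 0" "Tj \<omega> \<noteq> 0" using w elim(2) by auto
        then have pos: "0 < Ti \<omega>" "0 < Tj \<omega>" using nn by simp_all
        have lt: "x / Ti \<omega> < \<bar>Xi \<omega>\<bar>" "x / Tj \<omega> < Xj \<omega>"
          using w pos by (simp_all add: pos_divide_less_eq mult.commute)
        show "(b x < Ti \<omega> \<or> b x < Tj \<omega>) \<or> A3 \<omega> \<or> A4 \<omega>"
        proof (cases "Ti \<omega> \<le> b x \<and> Tj \<omega> \<le> b x")
          case le: True
          show ?thesis
          proof (cases "Ti \<omega> \<le> Tj \<omega>")
            case True
            then have "x / Tj \<omega> \<le> x / Ti \<omega>" using elim(2) pos by (intro divide_left_mono) auto
            with lt le w pos show ?thesis by (simp add: A3_def)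
          next
            case False
            then have "x / Ti \<omega> \<le> x / Tj \<omega>" using elim(2) pos by (intro divide_left_mono) auto
            with lt le w pos show ?thesis by (simp add: A4_def)
          qed
        next
          case False
          then show ?thesis by auto
        qed
      qed
    qed measurable
    also have "\<dots> \<le> (\<P>(\<omega> in M. b x < Ti \<omega>) + \<P>(\<omega> in M. b x < Tj \<omega>))
        + (\<P>(\<omega> in M. A3 \<omega>) + \<P>(\<omega> in M. A4 \<omega>))"
      by (intro add_mono prob_le_add) auto
    also have "\<dots> \<le> (e / 4 * j.H x + e / 4 * j.H x) + (e / 4 * j.H x + e / 4 * j.H x)"
    proof (intro add_mono)
      show "\<P>(\<omega> in M. b x < Ti \<omega>) \<le> e / 4 * j.H x" using elim(3) unfolding H_eq[symmetric] i.H_def .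
      show "\<P>(\<omega> in M. b x < Tj \<omega>) \<le> e / 4 * j.H x" using elim(4) unfolding j.H_def .
      show "\<P>(\<omega> in M. A3 \<omega>) \<le> e / 4 * j.H x" using 1 unfolding A3_def .
      show "\<P>(\<omega> in M. A4 \<omega>) \<le> e / 4 * j.H x" using 2 unfolding A4_def H_eq .
    qed
    finally show ?case by simp
  qed
next
  case False
  then obtain x1 where "\<P>(\<omega> in M. x1 < Xi \<omega> \<and> x1 < Xj \<omega>) = 0"
    by (metis measure_nonneg order_less_le)
  then obtain m' where m': "AE \<omega> in M. Ti \<omega> \<le> m'" "AE \<omega> in M. Tj \<omega> \<le> m'"
    using weights_bounded by blast
  define m where "m = max 2 m'"
  have m: "m > 1" "AE \<omega> in M. Ti \<omega> \<le> m" "AE \<omega> in M. Tj \<omega> \<le> m"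
    using m' by (auto simp: m_def elim: eventually_mono)
  obtain K where K: "\<forall>\<^sub>F x in at_top. j.F (1 / m * x) \<le> K * j.F x"
    using D m(1) unfolding dominated_tail_def by (meson divide_less_eq_1_pos less_trans zero_less_divide_1_iff zero_less_one)
  obtain C where C: "C > 0" "\<forall>\<^sub>F x in at_top. j.F x \<le> C * j.H x"
    using j.F_le_H[OF D] by blast
  define e' where "e' = e / (max K 1 * C)"
  have e': "e' > 0" using e C by (simp add: e'_def less_max_iff_disj)
  obtain z where z: "\<And>x. x \<ge> z \<Longrightarrow> \<P>(\<omega> in M. x < \<bar>Xi \<omega>\<bar> \<and> x < Xj \<omega>) \<le> e' * j.F x"
    using X[OF e'] unfolding eventually_at_top_linorder by blast
  show ?thesis
    using K C(2) eventually_ge_at_top[of 0] eventually_ge_at_top[of "z * m"]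
  proof eventually_elim
    case (elim x)
    have "\<P>(\<omega> in M. x < \<bar>Ti \<omega> * Xi \<omega>\<bar> \<and> x < Tj \<omega> * Xj \<omega>)
        \<le> \<P>(\<omega> in M. 1 / m * x < \<bar>Xi \<omega>\<bar> \<and> 1 / m * x < Xj \<omega>)"
    proof (rule finite_measure_mono_AE)
      show "AE \<omega> in M. \<omega> \<in> {\<omega>\<in>space M. x < \<bar>Ti \<omega> * Xi \<omega>\<bar> \<and> x < Tj \<omega> * Xj \<omega>} \<longrightarrow>
          \<omega> \<in> {\<omega>\<in>space M. 1 / m * x < \<bar>Xi \<omega>\<bar> \<and> 1 / m * x < Xj \<omega>}"
        using i.T_nonneg j.T_nonneg m(2,3)
      proof eventually_elim
        case w: (elim \<omega>)
        have *: "1 / m * x < X" if "0 \<le> T" "T \<le> m" "x < T * X" for T X :: real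
        proof -
          have "0 < T * X" using that elim(3) by linarith
          then have "X > 0" using that(1) by (simp add: zero_less_mult_iff)
          then have "T * X \<le> m * X" using that by (intro mult_right_mono) auto
          then have "x < m * X" using that by linarith
          then show ?thesis using m(1) by (simp add: pos_divide_less_eq mult.commute)
        qed
        show ?case
          using *[of "Ti \<omega>" "\<bar>Xi \<omega>\<bar>"] *[of "Tj \<omega>" "Xj \<omega>"] w by (auto simp: abs_mult)
      qed
    qed measurable
    also have "\<dots> \<le> e' * j.F (1 / m * x)"
      using elim(4) m(1) by (intro z) (simp add: field_simps)
    also have "\<dots> \<le> e' * (max K 1 * (C * j.H x))"
    proof (intro mult_left_mono)
      have "j.F (1 / m * x) \<le> K * j.F x" by (rule elim(1))
      also have "\<dots> \<le> max K 1 * j.F x" using j.F_pos[of x] by (intro mult_right_mono) auto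
      also have "\<dots> \<le> max K 1 * (C * j.H x)" using elim(2) by (intro mult_left_mono) auto
      finally show "j.F (1 / m * x) \<le> max K 1 * (C * j.H x)" .
    qed (use e' in simp)
    also have "\<dots> = e * j.H x"
    proof -
      have "max K 1 * C \<noteq> 0" using C by simp
      then show ?thesis by (simp add: e'_def)
    qed
    finally show ?case .
  qed
qed

end

section \<open>Sums with a single large term\<close>

context prob_space
begin

text \<open>The events "\<open>Y j\<close> is large and all other terms are moderate" are disjoint for different \<open>j\<close>.\<close>

lemma prob_one_large_ge:
  fixes Y :: "'i \<Rightarrow> 'a \<Rightarrow> real"
  assumes I: "finite I" and Y [measurable]: "\<And>i. i \<in> I \<Longrightarrow> Y i \<in> borel_measurable M"
    and le: "y \<le> z" "t \<le> z"
  shows "(\<Sum>j\<in>I. \<P>(\<omega> in M. z < Y j \<omega>)) - (\<Sum>j\<in>I. \<Sum>i\<in>I - {j}. \<P>(\<omega> in M. t < \<bar>Y i \<omega>\<bar> \<and> y < Y j \<omega>))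
    \<le> \<P>(\<omega> in M. \<exists>j\<in>I. z < Y j \<omega> \<and> (\<forall>i\<in>I - {j}. \<bar>Y i \<omega>\<bar> \<le> t))"
proof -
  have [simp]: "finite I" by (rule I)
  define G where "G j = {\<omega>\<in>space M. z < Y j \<omega> \<and> (\<forall>i\<in>I - {j}. \<bar>Y i \<omega>\<bar> \<le> t)}" for j
  define B where "B j i = {\<omega>\<in>space M. t < \<bar>Y i \<omega>\<bar> \<and> y < Y j \<omega>}" for j i
  have G [measurable]: "G j \<in> sets M" if "j \<in> I" for j
    unfolding G_def using that by measurable
  have B [measurable]: "B j i \<in> sets M" if "j \<in> I" "i \<in> I" for j i
    unfolding B_def using that by measurable
  have UB: "(\<Union>i\<in>I - {j}. B j i) \<in> sets M" if "j \<in> I" for j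
    by (intro sets.finite_UN) (use I that B in auto)
  have disj: "disjoint_family_on G I"
    unfolding disjoint_family_on_def
  proof (intro ballI impI, rule ccontr)
    fix i j assume ij: "i \<in> I" "j \<in> I" "i \<noteq> j" and "G i \<inter> G j \<noteq> {}"
    then obtain \<omega> where "\<omega> \<in> G i" "\<omega> \<in> G j" by blast
    then have "z < Y i \<omega>" "\<bar>Y i \<omega>\<bar> \<le> t" using ij by (auto simp: G_def)
    then show False using le by linarith
  qed
  have "\<P>(\<omega> in M. z < Y j \<omega>) \<le> measure M (G j) + (\<Sum>i\<in>I - {j}. measure M (B j i))" if j: "j \<in> I" for j
  proof -
    have "\<P>(\<omega> in M. z < Y j \<omega>) \<le> measure M (G j \<union> (\<Union>i\<in>I - {j}. B j i))"
    proof (intro finite_measure_mono subsetI)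
      fix \<omega> assume "\<omega> \<in> {\<omega>\<in>space M. z < Y j \<omega>}"
      then show "\<omega> \<in> G j \<union> (\<Union>i\<in>I - {j}. B j i)"
        using le by (auto simp: G_def B_def not_le)
    qed (intro sets.Un G UB j)
    also have "\<dots> \<le> measure M (G j) + measure M (\<Union>i\<in>I - {j}. B j i)"
      using j UB by (intro measure_Un_le G)
    also have "measure M (\<Union>i\<in>I - {j}. B j i) \<le> (\<Sum>i\<in>I - {j}. measure M (B j i))"
      using I j B by (intro measure_UNION_le) auto
    finally show ?thesis by simp
  qed
  then have "(\<Sum>j\<in>I. \<P>(\<omega> in M. z < Y j \<omega>)) \<le> (\<Sum>j\<in>I. measure M (G j) + (\<Sum>i\<in>I - {j}. measure M (B j i)))"
    by (rule sum_mono)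
  also have "\<dots> = measure M (\<Union>j\<in>I. G j) + (\<Sum>j\<in>I. \<Sum>i\<in>I - {j}. measure M (B j i))"
    using I G disj by (subst finite_measure_finite_Union) (auto simp: sum.distrib)
  also have "(\<Union>j\<in>I. G j) = {\<omega>\<in>space M. \<exists>j\<in>I. z < Y j \<omega> \<and> (\<forall>i\<in>I - {j}. \<bar>Y i \<omega>\<bar> \<le> t)}"
    by (auto simp: G_def)
  finally show ?thesis by (simp add: B_def)
qed

lemma prob_sum_gt_ge:
  fixes Y :: "'i \<Rightarrow> 'a \<Rightarrow> real"
  assumes I: "finite I" "card I \<le> n" "0 < n" and Y [measurable]: "\<And>i. i \<in> I \<Longrightarrow> Y i \<in> borel_measurable M"
    and s: "0 < s" "0 < x"
  shows "(\<Sum>j\<in>I. \<P>(\<omega> in M. x + s < Y j \<omega>))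
      - (\<Sum>j\<in>I. \<Sum>i\<in>I - {j}. \<P>(\<omega> in M. s / n < \<bar>Y i \<omega>\<bar> \<and> x / n < Y j \<omega>))
    \<le> \<P>(\<omega> in M. x < (\<Sum>i\<in>I. Y i \<omega>))"
proof -
  have n: "real n \<ge> 1" using I by simp
  have div: "a / real n \<le> a" if "a > 0" for a
  proof -
    have "a * 1 \<le> a * real n" using n that by (intro mult_left_mono) auto
    then show ?thesis using n by (simp add: pos_divide_le_eq)
  qed
  have "(\<Sum>j\<in>I. \<P>(\<omega> in M. x + s < Y j \<omega>))
      - (\<Sum>j\<in>I. \<Sum>i\<in>I - {j}. \<P>(\<omega> in M. s / n < \<bar>Y i \<omega>\<bar> \<and> x / n < Y j \<omega>))
    \<le> \<P>(\<omega> in M. \<exists>j\<in>I. x + s < Y j \<omega> \<and> (\<forall>i\<in>I - {j}. \<bar>Y i \<omega>\<bar> \<le> s / n))"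
    using div[of x] div[of s] s by (intro prob_one_large_ge I Y) auto
  also have "\<dots> \<le> \<P>(\<omega> in M. x < (\<Sum>i\<in>I. Y i \<omega>))"
  proof (intro finite_measure_mono subsetI)
    fix \<omega> assume "\<omega> \<in> {\<omega>\<in>space M. \<exists>j\<in>I. x + s < Y j \<omega> \<and> (\<forall>i\<in>I - {j}. \<bar>Y i \<omega>\<bar> \<le> s / n)}"
    then obtain j where j: "\<omega> \<in> space M" "j \<in> I" "x + s < Y j \<omega>" "\<And>i. i \<in> I - {j} \<Longrightarrow> \<bar>Y i \<omega>\<bar> \<le> s / n"
      by blast
    have "- (s / n) \<le> Y i \<omega>" if "i \<in> I - {j}" for i using j(4)[OF that] by linarith
    then have "(\<Sum>i\<in>I - {j}. - (s / n)) \<le> (\<Sum>i\<in>I - {j}. Y i \<omega>)" by (rule sum_mono)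
    moreover have "real (card (I - {j})) * (s / n) \<le> real n * (s / n)"
      using I s j by (intro mult_right_mono) auto
    then have "real (card (I - {j})) * (s / n) \<le> s" using n by simp
    ultimately have "- s \<le> (\<Sum>i\<in>I - {j}. Y i \<omega>)" by simp
    moreover have "(\<Sum>i\<in>I. Y i \<omega>) = Y j \<omega> + (\<Sum>i\<in>I - {j}. Y i \<omega>)"
      using I j by (simp add: sum.remove)
    ultimately show "\<omega> \<in> {\<omega>\<in>space M. x < (\<Sum>i\<in>I. Y i \<omega>)}" using j by simp
  qed measurable
  finally show ?thesis .
qed

text \<open>If the positive parts sum to more than \<open>x\<close> but no term exceeds \<open>x - s\<close>, then some term exceeds \<open>x / n\<close> and the
  others still sum to more than \<open>s\<close>, so another one exceeds \<open>s / n\<close>.\<close>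

lemma prob_pos_sum_gt_le:
  fixes Y :: "'i \<Rightarrow> 'a \<Rightarrow> real"
  assumes I: "finite I" "card I \<le> n" "0 < n" and Y [measurable]: "\<And>i. i \<in> I \<Longrightarrow> Y i \<in> borel_measurable M"
    and s: "0 < s" "0 < x"
  shows "\<P>(\<omega> in M. x < (\<Sum>i\<in>I. max (Y i \<omega>) 0))
    \<le> (\<Sum>j\<in>I. \<P>(\<omega> in M. x - s < Y j \<omega>))
      + (\<Sum>j\<in>I. \<Sum>i\<in>I - {j}. \<P>(\<omega> in M. s / n < \<bar>Y i \<omega>\<bar> \<and> x / n < Y j \<omega>))"
proof -
  define A where "A j = {\<omega>\<in>space M. x - s < Y j \<omega>}" for j
  define B where "B j i = {\<omega>\<in>space M. s / n < \<bar>Y i \<omega>\<bar> \<and> x / n < Y j \<omega>}" for j i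
  have A [measurable]: "A j \<in> sets M" if "j \<in> I" for j unfolding A_def using that by measurable
  have B [measurable]: "B j i \<in> sets M" if "j \<in> I" "i \<in> I" for j i
    unfolding B_def using that by measurable
  have UA: "(\<Union>j\<in>I. A j) \<in> sets M" by (intro sets.finite_UN A I)
  have UB: "(\<Union>i\<in>I - {j}. B j i) \<in> sets M" if "j \<in> I" for j
    by (intro sets.finite_UN) (use I that B in auto)
  have UUB: "(\<Union>j\<in>I. \<Union>i\<in>I - {j}. B j i) \<in> sets M" by (intro sets.finite_UN UB I)
  have n: "real n > 0" using I by simp
  have big: "\<exists>i\<in>J. a / n < f i" if "J \<subseteq> I" "0 < a" "a < sum f J" for J a and f :: "'i \<Rightarrow> real"
  proof (rule ccontr)
    assume "\<not> ?thesis"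
    then have "sum f J \<le> (\<Sum>i\<in>J. a / n)" by (intro sum_mono) (auto simp: not_less)
    also have "\<dots> = real (card J) * (a / n)" by simp
    also have "\<dots> \<le> real n * (a / n)"
      using card_mono[OF I(1) that(1)] I that n by (intro mult_right_mono) auto
    also have "\<dots> = a" using n by simp
    finally show False using that by simp
  qed
  have "\<P>(\<omega> in M. x < (\<Sum>i\<in>I. max (Y i \<omega>) 0)) \<le> measure M ((\<Union>j\<in>I. A j) \<union> (\<Union>j\<in>I. \<Union>i\<in>I - {j}. B j i))"
  proof (intro finite_measure_mono subsetI)
    fix \<omega> assume "\<omega> \<in> {\<omega>\<in>space M. x < (\<Sum>i\<in>I. max (Y i \<omega>) 0)}"
    then have w: "\<omega> \<in> space M" "x < (\<Sum>i\<in>I. max (Y i \<omega>) 0)" by auto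
    show "\<omega> \<in> (\<Union>j\<in>I. A j) \<union> (\<Union>j\<in>I. \<Union>i\<in>I - {j}. B j i)"
    proof (cases "\<exists>j\<in>I. x - s < Y j \<omega>")
      case True
      with w show ?thesis by (auto simp: A_def)
    next
      case False
      obtain j where j: "j \<in> I" "x / n < max (Y j \<omega>) 0"
        using big[OF subset_refl s(2) w(2)] by blast
      have "0 < x / n" using s n by simp
      then have Yj: "x / n < Y j \<omega>" "max (Y j \<omega>) 0 = Y j \<omega>" using j by auto
      have "Y j \<omega> \<le> x - s" using False j by (auto simp: not_less)
      moreover have "(\<Sum>i\<in>I. max (Y i \<omega>) 0) = Y j \<omega> + (\<Sum>i\<in>I - {j}. max (Y i \<omega>) 0)"
        using I j Yj by (simp add: sum.remove)
      ultimately have "s < (\<Sum>i\<in>I - {j}. max (Y i \<omega>) 0)" using w by linarith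
      then obtain i where i: "i \<in> I - {j}" "s / n < max (Y i \<omega>) 0"
        using big[of "I - {j}" s] s by blast
      have "0 < s / n" using s n by simp
      then have "s / n < \<bar>Y i \<omega>\<bar>" using i by (auto simp: max_def split: if_splits)
      with i j Yj w show ?thesis by (auto simp: B_def)
    qed
  qed (intro sets.Un UA UUB)
  also have "\<dots> \<le> measure M (\<Union>j\<in>I. A j) + measure M (\<Union>j\<in>I. \<Union>i\<in>I - {j}. B j i)"
    by (intro measure_Un_le UA UUB)
  also have "\<dots> \<le> (\<Sum>j\<in>I. measure M (A j)) + (\<Sum>j\<in>I. \<Sum>i\<in>I - {j}. measure M (B j i))"
    using I A B UB by (intro add_mono measure_UNION_le order_trans[OF measure_UNION_le] sum_mono) auto
  finally show ?thesis by (simp add: A_def B_def)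
qed

text \<open>A single large term dominates. The shift \<open>s\<close> must be small enough not to change the tail \<open>H\<close> and large
  enough to make a second term above \<open>s x / n\<close> negligible.\<close>

lemma sum_tail_bounds:
  fixes Y :: "nat \<Rightarrow> 'a \<Rightarrow> real"
  assumes n: "0 < n" and k: "k \<le> n"
    and Y [measurable]: "\<And>i. i \<in> {1..n} \<Longrightarrow> Y i \<in> borel_measurable M"
    and tails: "\<And>i x. i \<in> {1..n} \<Longrightarrow> \<P>(\<omega> in M. x < Y i \<omega>) = H x"
    and shift: "\<And>e. e > 0 \<Longrightarrow> \<exists>s. \<forall>\<^sub>F x in at_top. 0 < s x \<and> s x \<le> x \<and>
        H (x - s x) \<le> (1 + e) * H x \<and> (1 - e) * H x \<le> H (x + s x) \<and>
        (\<forall>i\<in>{1..n}. \<forall>j\<in>{1..n}. i \<noteq> j \<longrightarrow> \<P>(\<omega> in M. s x / n < \<bar>Y i \<omega>\<bar> \<and> x / n < Y j \<omega>) \<le> e * H x)"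
    and e: "e > 0"
  shows "\<forall>\<^sub>F x in at_top.
      \<P>(\<omega> in M. x < (\<Sum>i=1..k. max (Y i \<omega>) 0)) \<le> (real k + e) * H x \<and>
      (real k - e) * H x \<le> \<P>(\<omega> in M. x < (\<Sum>i=1..k. Y i \<omega>)) \<and>
      (real k - e) * H x \<le> \<P>(\<omega> in M. \<exists>j\<in>{1..k}. x < Y j \<omega>)"
proof -
  \<comment> \<open>The at most \<open>n\<close> main terms change by at most \<open>d * H x\<close> each, and at most \<open>n * n\<close> error terms are
    bounded by \<open>d * H x\<close>.\<close>
  define d where "d = e / (real n + real n * real n)"
  have dn: "d > 0" "d * (real n + real n * real n) = e"
  proof -
    have "real n + real n * real n > 0" using n by (simp add: add_pos_pos)
    then show "d > 0" "d * (real n + real n * real n) = e" using e by (simp_all add: d_def)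
  qed
  obtain s where s: "\<forall>\<^sub>F x in at_top. 0 < s x \<and> s x \<le> x \<and>
        H (x - s x) \<le> (1 + d) * H x \<and> (1 - d) * H x \<le> H (x + s x) \<and>
        (\<forall>i\<in>{1..n}. \<forall>j\<in>{1..n}. i \<noteq> j \<longrightarrow> \<P>(\<omega> in M. s x / n < \<bar>Y i \<omega>\<bar> \<and> x / n < Y j \<omega>) \<le> d * H x)"
    using shift[OF dn(1)] by blast
  define I where "I = {1..k}"
  have I: "finite I" "card I \<le> n" "I \<subseteq> {1..n}" "card I = k" using k by (auto simp: I_def)
  have Y' [measurable]: "Y i \<in> borel_measurable M" if "i \<in> I" for i using that I by (intro Y) auto
  have H_nn: "H x \<ge> 0" for x using tails[of 1 x, symmetric] n by simp
  show ?thesis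
    using s
  proof eventually_elim
    case (elim x)
    then have sx: "0 < s x" "s x \<le> x" "0 < x" by auto
    define R where "R = (\<Sum>j\<in>I. \<Sum>i\<in>I - {j}. \<P>(\<omega> in M. s x / n < \<bar>Y i \<omega>\<bar> \<and> x / n < Y j \<omega>))"
    have "R \<le> (\<Sum>j\<in>I. \<Sum>i\<in>I - {j}. d * H x)"
      unfolding R_def using elim I by (intro sum_mono) blast
    also have "\<dots> \<le> (\<Sum>j\<in>I. \<Sum>i\<in>I. d * H x)"
      using dn H_nn[of x] I by (intro sum_mono sum_mono2) auto
    also have "\<dots> = real k * real k * (d * H x)" using I by (simp add: mult.assoc)
    also have "\<dots> \<le> real n * real n * (d * H x)"
      using k dn H_nn[of x] by (intro mult_right_mono mult_mono) auto
    finally have R: "R \<le> real n * real n * (d * H x)" .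
    have kd: "real k * (d * H x) \<le> real n * (d * H x)"
      using k dn H_nn[of x] by (intro mult_right_mono) auto
    have eH: "real n * (d * H x) + real n * real n * (d * H x) = e * H x"
      unfolding dn(2)[symmetric] by (simp add: algebra_simps)
    have tail_I: "(\<Sum>j\<in>I. \<P>(\<omega> in M. y < Y j \<omega>)) = real k * H y" for y
      using I tails by (simp add: subset_iff)
    have 1: "\<P>(\<omega> in M. x < (\<Sum>i\<in>I. max (Y i \<omega>) 0)) \<le> real k * H (x - s x) + R"
      using prob_pos_sum_gt_le[where Y=Y, OF I(1,2) n Y' sx(1,3)] unfolding tail_I R_def by simp
    have "real k * H (x - s x) \<le> real k * ((1 + d) * H x)"
      using elim by (intro mult_left_mono) auto
    with 1 R kd eH have 1: "\<P>(\<omega> in M. x < (\<Sum>i\<in>I. max (Y i \<omega>) 0)) \<le> (real k + e) * H x"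
      by (simp add: algebra_simps)
    have 2: "real k * H (x + s x) - R \<le> \<P>(\<omega> in M. x < (\<Sum>i\<in>I. Y i \<omega>))"
      using prob_sum_gt_ge[where Y=Y, OF I(1,2) n Y' sx(1,3)] unfolding tail_I R_def by simp
    have "real k * ((1 - d) * H x) \<le> real k * H (x + s x)"
      using elim by (intro mult_left_mono) auto
    with 2 R kd eH have 2: "(real k - e) * H x \<le> \<P>(\<omega> in M. x < (\<Sum>i\<in>I. Y i \<omega>))"
      by (simp add: algebra_simps)
    have div: "a / real n \<le> a" if "a > 0" for a
    proof -
      have "a * 1 \<le> a * real n" using n that by (intro mult_left_mono) auto
      then show ?thesis using n by (simp add: pos_divide_le_eq)
    qed
    have "real k * H x - R \<le> \<P>(\<omega> in M. \<exists>j\<in>I. x < Y j \<omega> \<and> (\<forall>i\<in>I - {j}. \<bar>Y i \<omega>\<bar> \<le> s x / n))"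
      using prob_one_large_ge[where Y=Y, OF I(1) Y' div[OF sx(3)] order_trans[OF div[OF sx(1)] sx(2)]]
      unfolding tail_I R_def by simp
    also have "\<dots> \<le> \<P>(\<omega> in M. \<exists>j\<in>I. x < Y j \<omega>)"
      using I by (intro finite_measure_mono) auto
    finally have 3: "real k * H x - R \<le> \<P>(\<omega> in M. \<exists>j\<in>I. x < Y j \<omega>)" .
    have "real n * (d * H x) \<ge> 0" using dn H_nn[of x] by simp
    with 3 R eH have 3: "(real k - e) * H x \<le> \<P>(\<omega> in M. \<exists>j\<in>I. x < Y j \<omega>)"
      by (simp add: algebra_simps)
    show ?case using 1 2 3 unfolding I_def by blast
  qed
qed

text \<open>An independent bounded random index turns the factor \<open>m\<close> into the expectation.\<close>

lemma random_index_tail: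
  fixes Q :: "nat \<Rightarrow> 'a \<Rightarrow> real" and N :: "'a \<Rightarrow> nat"
  assumes N [measurable]: "N \<in> measurable M (count_space UNIV)"
    and N_le: "\<P>(\<omega> in M. n < N \<omega>) = 0"
    and Q [measurable]: "\<And>m. Q m \<in> borel_measurable M"
    and Q0: "\<And>\<omega>. Q 0 \<omega> = 0"
    and indep: "\<And>m x. \<P>(\<omega> in M. N \<omega> = m \<and> x < Q m \<omega>) = \<P>(\<omega> in M. N \<omega> = m) * \<P>(\<omega> in M. x < Q m \<omega>)"
    and bounds: "\<And>m e. 1 \<le> m \<Longrightarrow> m \<le> n \<Longrightarrow> e > 0 \<Longrightarrow> \<forall>\<^sub>F x in at_top.
        (real m - e) * H x \<le> \<P>(\<omega> in M. x < Q m \<omega>) \<and> \<P>(\<omega> in M. x < Q m \<omega>) \<le> (real m + e) * H x"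
    and H: "\<And>x. H x > 0"
  shows "((\<lambda>x. \<P>(\<omega> in M. x < Q (N \<omega>) \<omega>) / H x) \<longlongrightarrow> (LINT \<omega>|M. real (N \<omega>))) at_top"
proof -
  define p where "p m = \<P>(\<omega> in M. N \<omega> = m)" for m
  have N_AE: "AE \<omega> in M. N \<omega> \<le> n"
  proof -
    have "AE \<omega> in M. \<not> n < N \<omega>" using N_le by (simp add: prob_Collect_eq_0)
    then show ?thesis by (simp add: not_less)
  qed
  have EN: "(LINT \<omega>|M. real (N \<omega>)) = (\<Sum>m=1..n. real m * p m)"
  proof -
    have "(LINT \<omega>|M. real (N \<omega>)) = (LINT \<omega>|M. (\<Sum>m=1..n. real m * indicator {\<omega>\<in>space M. N \<omega> = m} \<omega>))"
    proof (rule integral_cong_AE)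
      show "AE \<omega> in M. real (N \<omega>) = (\<Sum>m=1..n. real m * indicator {\<omega>\<in>space M. N \<omega> = m} \<omega>)"
        using N_AE AE_space
      proof eventually_elim
        case (elim \<omega>)
        have "(\<Sum>m=1..n. real m * indicator {\<omega>\<in>space M. N \<omega> = m} \<omega>)
            = (\<Sum>m=1..n. if m = N \<omega> then real m else 0)"
          using elim by (intro sum.cong) (auto simp: indicator_def)
        also have "\<dots> = real (N \<omega>)" using elim by (cases "N \<omega> = 0") (auto simp: sum.delta)
        finally show ?case by simp
      qed
    qed measurable
    also have "\<dots> = (\<Sum>m=1..n. real m * p m)"
    proof (subst Bochner_Integration.integral_sum)
      show "integrable M (\<lambda>\<omega>. real m * indicator {\<omega>\<in>space M. N \<omega> = m} \<omega>)" for m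
        by (intro integrable_mult_right integrable_real_indicator) (auto simp: emeasure_eq_measure)
    qed (auto simp: p_def)
    finally show ?thesis .
  qed
  have decomp: "\<P>(\<omega> in M. x < Q (N \<omega>) \<omega>) = (\<Sum>m=1..n. p m * \<P>(\<omega> in M. x < Q m \<omega>))" if x: "x \<ge> 0" for x
  proof -
    have "\<P>(\<omega> in M. x < Q (N \<omega>) \<omega>) = measure M (\<Union>m\<in>{1..n}. {\<omega>\<in>space M. N \<omega> = m \<and> x < Q m \<omega>})"
    proof (rule finite_measure_eq_AE)
      show "AE \<omega> in M. (\<omega> \<in> {\<omega> \<in> space M. x < Q (N \<omega>) \<omega>})
          = (\<omega> \<in> (\<Union>m\<in>{1..n}. {\<omega>\<in>space M. N \<omega> = m \<and> x < Q m \<omega>}))"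
        using N_AE
      proof eventually_elim
        case (elim \<omega>)
        then show ?case using x Q0[of \<omega>] by (cases "N \<omega> = 0") auto
      qed
    qed measurable
    also have "\<dots> = (\<Sum>m=1..n. \<P>(\<omega> in M. N \<omega> = m \<and> x < Q m \<omega>))"
      by (intro finite_measure_finite_Union) (auto simp: disjoint_family_on_def)
    finally show ?thesis by (simp add: indep p_def)
  qed
  have p_sum: "(\<Sum>m=1..n. p m) \<le> 1"
  proof -
    have "(\<Sum>m=1..n. p m) = measure M (\<Union>m\<in>{1..n}. {\<omega>\<in>space M. N \<omega> = m})"
      unfolding p_def by (intro finite_measure_finite_Union[symmetric]) (auto simp: disjoint_family_on_def)
    also have "\<dots> \<le> 1" by (rule prob_le_1)
    finally show ?thesis .
  qed
  show ?thesis
  proof (rule tendstoI)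
    fix e :: real assume e: "e > 0"
    have "\<forall>\<^sub>F x in at_top. \<forall>m\<in>{1..n}. (real m - e / 2) * H x \<le> \<P>(\<omega> in M. x < Q m \<omega>) \<and>
        \<P>(\<omega> in M. x < Q m \<omega>) \<le> (real m + e / 2) * H x"
      using e by (intro eventually_ball_finite ballI bounds) auto
    then show "\<forall>\<^sub>F x in at_top. dist (\<P>(\<omega> in M. x < Q (N \<omega>) \<omega>) / H x) (LINT \<omega>|M. real (N \<omega>)) < e"
      using eventually_ge_at_top[of 0]
    proof eventually_elim
      case (elim x)
      have "\<bar>\<P>(\<omega> in M. x < Q m \<omega>) - real m * H x\<bar> \<le> e / 2 * H x" if "m \<in> {1..n}" for m
        using elim(1)[rule_format, OF that] unfolding left_diff_distrib distrib_right by linarith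
      then have *: "p m * \<bar>\<P>(\<omega> in M. x < Q m \<omega>) - real m * H x\<bar> \<le> p m * (e / 2 * H x)" if "m \<in> {1..n}" for m
        using that by (intro mult_left_mono) (auto simp: p_def)
      have "\<bar>\<P>(\<omega> in M. x < Q (N \<omega>) \<omega>) - (LINT \<omega>|M. real (N \<omega>)) * H x\<bar>
          = \<bar>\<Sum>m=1..n. p m * (\<P>(\<omega> in M. x < Q m \<omega>) - real m * H x)\<bar>"
        unfolding EN decomp[OF elim(2)]
        by (simp add: right_diff_distrib sum_subtractf sum_distrib_left sum_distrib_right mult_ac)
      also have "\<dots> \<le> (\<Sum>m=1..n. p m * \<bar>\<P>(\<omega> in M. x < Q m \<omega>) - real m * H x\<bar>)"
        by (rule order_trans[OF sum_abs]) (simp add: abs_mult p_def)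
      also have "\<dots> \<le> (\<Sum>m=1..n. p m * (e / 2 * H x))" by (intro sum_mono *)
      also have "\<dots> = (\<Sum>m=1..n. p m) * (e / 2 * H x)" by (simp add: sum_distrib_right)
      also have "\<dots> \<le> 1 * (e / 2 * H x)" using p_sum e H[of x] by (intro mult_right_mono) auto
      also have "\<dots> < e * H x" using e H[of x] by simp
      finally have "\<bar>\<P>(\<omega> in M. x < Q (N \<omega>) \<omega>) - (LINT \<omega>|M. real (N \<omega>)) * H x\<bar> < e * H x" .
      moreover have "\<P>(\<omega> in M. x < Q (N \<omega>) \<omega>) / H x - (LINT \<omega>|M. real (N \<omega>))
          = (\<P>(\<omega> in M. x < Q (N \<omega>) \<omega>) - (LINT \<omega>|M. real (N \<omega>)) * H x) / H x"
        using H[of x] by (simp add: field_simps)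
      ultimately show ?case
        using H[of x] by (simp add: dist_real_def abs_div_pos[symmetric] pos_divide_less_eq)
    qed
  qed
qed

end

section \<open>Distribution classes and tail equivalence\<close>

lemma class_D_imp_dominated_tail:
  assumes "F \<in> class_D"
  shows "dominated_tail (tail F)"
  unfolding dominated_tail_def
proof (intro allI impI)
  fix v :: real assume "0 < v \<and> v < 1"
  then have "Limsup at_top (\<lambda>x. ereal (tail F (v * x) / tail F x)) < \<infinity>"
    using assms by (simp add: class_D_def)
  then obtain K where K: "Limsup at_top (\<lambda>x. ereal (tail F (v * x) / tail F x)) < ereal K"
    using less_PInf_Ex_of_nat by (metis ereal_dense2)
  from Limsup_lessD[OF K] have "\<forall>\<^sub>F x in at_top. tail F (v * x) / tail F x < K" by simp
  then have "\<forall>\<^sub>F x in at_top. tail F (v * x) \<le> K * tail F x"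
    using eventually_ge_at_top[of 0]
  proof eventually_elim
    case (elim x)
    then have "tail F x > 0" using assms by (simp add: class_D_def pos_tail_def)
    with elim show ?case by (simp add: pos_divide_less_eq)
  qed
  then show "\<exists>K. \<forall>\<^sub>F x in at_top. tail F (v * x) \<le> K * tail F x" ..
qed

lemma class_L_imp_long_tail:
  assumes "F \<in> class_L"
  shows "long_tail (tail F)"
  unfolding long_tail_def
proof (intro allI impI)
  fix a e :: real assume ae: "a > 0" "e > 0"
  then have lim: "((\<lambda>x. tail F (x - a) / tail F x) \<longlongrightarrow> 1) at_top"
    using assms by (simp add: class_L_def)
  have "\<forall>\<^sub>F x in at_top. tail F (x - a) / tail F x < 1 + e"
    using ae by (intro order_tendstoD(2)[OF lim]) simp
  then show "\<forall>\<^sub>F x in at_top. tail F (x - a) \<le> (1 + e) * tail F x"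
    using eventually_ge_at_top[of 0]
  proof eventually_elim
    case (elim x)
    then have "tail F x > 0" using assms by (simp add: class_L_def pos_tail_def)
    with elim show ?case by (simp add: pos_divide_less_eq)
  qed
qed

lemma class_C_imp_consistent_tail:
  assumes "F \<in> class_C"
  shows "consistent_tail (tail F)"
  unfolding consistent_tail_def
proof (intro allI impI)
  fix e :: real assume e: "e > 0"
  have lim: "((\<lambda>v. Limsup at_top (\<lambda>x. ereal (tail F (v * x) / tail F x))) \<longlongrightarrow> 1) (at_left 1)"
    using assms by (simp add: class_C_def)
  have "1 < ereal (1 + e)" using e by (simp add: one_ereal_def)
  then have "\<forall>\<^sub>F v in at_left 1. Limsup at_top (\<lambda>x. ereal (tail F (v * x) / tail F x)) < ereal (1 + e)"
    by (rule order_tendstoD(2)[OF lim])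
  moreover have "\<forall>\<^sub>F v in at_left 1. v \<in> {0<..<1::real}" by (intro eventually_at_leftI[of 0]) auto
  ultimately have "\<forall>\<^sub>F v in at_left 1. Limsup at_top (\<lambda>x. ereal (tail F (v * x) / tail F x)) < ereal (1 + e) \<and> v \<in> {0<..<1}"
    by (rule eventually_conj)
  then obtain v where v: "Limsup at_top (\<lambda>x. ereal (tail F (v * x) / tail F x)) < ereal (1 + e)" "v \<in> {0<..<1}"
    using eventually_happens'[OF trivial_limit_at_left_real] by blast
  from Limsup_lessD[OF v(1)] have "\<forall>\<^sub>F x in at_top. tail F (v * x) / tail F x < 1 + e" by simp
  then have "\<forall>\<^sub>F x in at_top. tail F (v * x) \<le> (1 + e) * tail F x"
    using eventually_ge_at_top[of 0]
  proof eventually_elim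
    case (elim x)
    then have "tail F x > 0" using assms by (simp add: class_C_def pos_tail_def)
    with elim show ?case by (simp add: pos_divide_less_eq)
  qed
  with v show "\<exists>v. 0 < v \<and> v < 1 \<and> (\<forall>\<^sub>F x in at_top. tail F (v * x) \<le> (1 + e) * tail F x)" by auto
qed

lemma tail_antimono:
  assumes "real_distribution F" "x \<le> y"
  shows "tail F y \<le> tail F x"
proof -
  interpret real_distribution F by fact
  show ?thesis using cdf_nondecreasing[OF assms(2)] by (simp add: tail_def)
qed

lemma class_D_I:
  assumes F: "pos_tail F" and D: "dominated_tail (tail F)"
  shows "F \<in> class_D"
  unfolding class_D_def
proof (intro CollectI conjI allI impI F)
  fix v :: real assume "0 < v \<and> v < 1"
  then obtain K where K: "\<forall>\<^sub>F x in at_top. tail F (v * x) \<le> K * tail F x"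
    using D by (auto simp: dominated_tail_def)
  have "\<forall>\<^sub>F x in at_top. ereal (tail F (v * x) / tail F x) \<le> ereal K"
    using K eventually_ge_at_top[of 0]
  proof eventually_elim
    case (elim x)
    then have "tail F x > 0" using F by (simp add: pos_tail_def)
    with elim show ?case by (simp add: pos_divide_le_eq)
  qed
  then have "Limsup at_top (\<lambda>x. ereal (tail F (v * x) / tail F x)) \<le> ereal K" by (rule Limsup_bounded)
  also have "\<dots> < \<infinity>" by simp
  finally show "Limsup at_top (\<lambda>x. ereal (tail F (v * x) / tail F x)) < \<infinity>" .
qed

lemma class_L_I:
  assumes F: "pos_tail F" and L: "long_tail (tail F)"
  shows "F \<in> class_L"
  unfolding class_L_def
proof (intro CollectI conjI allI impI F)
  fix a :: real assume a: "a > 0"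
  show "((\<lambda>x. tail F (x - a) / tail F x) \<longlongrightarrow> 1) at_top"
  proof (rule tendstoI)
    fix e :: real assume e: "e > 0"
    then have "e / 2 > 0" by simp
    then have "\<forall>\<^sub>F x in at_top. tail F (x - a) \<le> (1 + e / 2) * tail F x"
      using L a unfolding long_tail_def by blast
    then show "\<forall>\<^sub>F x in at_top. dist (tail F (x - a) / tail F x) 1 < e"
      using eventually_ge_at_top[of 0]
    proof eventually_elim
      case (elim x)
      have pos: "tail F x > 0" using F elim by (simp add: pos_tail_def)
      have "tail F x \<le> tail F (x - a)" using F a by (intro tail_antimono) (auto simp: pos_tail_def)
      then have "1 \<le> tail F (x - a) / tail F x" using pos by simp
      moreover have "tail F (x - a) / tail F x \<le> 1 + e / 2" using elim pos by (simp add: pos_divide_le_eq)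
      ultimately show ?case using e by (simp add: dist_real_def)
    qed
  qed
qed

text \<open>The lower bound \<open>1\<close> for the upper limits holds because tails decrease.\<close>

lemma class_C_I:
  assumes F: "pos_tail F" and C: "consistent_tail (tail F)"
  shows "F \<in> class_C"
  unfolding class_C_def
proof (intro CollectI conjI F)
  have pos: "tail F x > 0" if "x \<ge> 0" for x using F that by (simp add: pos_tail_def)
  have mono: "tail F y \<le> tail F x" if "x \<le> y" for x y
    using F that by (intro tail_antimono) (auto simp: pos_tail_def)
  have lower: "1 \<le> Limsup at_top (\<lambda>x. ereal (tail F (v * x) / tail F x))" if "v < 1" for v
  proof -
    have "\<forall>\<^sub>F x in at_top. 1 \<le> ereal (tail F (v * x) / tail F x)"
      using eventually_ge_at_top[of 0]
    proof eventually_elim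
      case (elim x)
      have "v * x \<le> 1 * x" using that elim by (intro mult_right_mono) auto
      then have "tail F x \<le> tail F (v * x)" by (intro mono) simp
      then show ?case using pos[OF elim] by (simp add: one_ereal_def)
    qed
    then have "1 \<le> Liminf at_top (\<lambda>x. ereal (tail F (v * x) / tail F x))" by (rule Liminf_bounded)
    also have "\<dots> \<le> Limsup at_top (\<lambda>x. ereal (tail F (v * x) / tail F x))"
      by (rule Liminf_le_Limsup) simp
    finally show ?thesis .
  qed
  show "((\<lambda>v. Limsup at_top (\<lambda>x. ereal (tail F (v * x) / tail F x))) \<longlongrightarrow> 1) (at_left 1)"
  proof (rule order_tendstoI)
    fix a :: ereal assume "a < 1"
    then have "a < Limsup at_top (\<lambda>x. ereal (tail F (v * x) / tail F x))" if "v < 1" for v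
      using lower[OF that] by (rule less_le_trans)
    then show "\<forall>\<^sub>F v in at_left 1. a < Limsup at_top (\<lambda>x. ereal (tail F (v * x) / tail F x))"
      by (simp add: eventually_at_filter)
  next
    fix a :: ereal assume "1 < a"
    then obtain r where r: "1 < ereal r" "ereal r < a"
      using ereal_dense2 by blast
    define e where "e = r - 1"
    have e: "e > 0" using r by (simp add: e_def one_ereal_def)
    then obtain v0 where v0: "0 < v0" "v0 < 1" "\<forall>\<^sub>F x in at_top. tail F (v0 * x) \<le> (1 + e) * tail F x"
      using C by (auto simp: consistent_tail_def)
    have "Limsup at_top (\<lambda>x. ereal (tail F (v * x) / tail F x)) < a" if "v \<in> {v0<..<1}" for v
    proof -
      have "\<forall>\<^sub>F x in at_top. ereal (tail F (v * x) / tail F x) \<le> ereal r"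
        using v0(3) eventually_ge_at_top[of 0]
      proof eventually_elim
        case (elim x)
        have "v0 * x \<le> v * x" using that elim by (intro mult_right_mono) auto
        then have "tail F (v * x) \<le> tail F (v0 * x)" by (rule mono)
        also have "\<dots> \<le> r * tail F x" using elim by (simp add: e_def)
        finally show ?case using pos[OF elim(2)] by (simp add: pos_divide_le_eq)
      qed
      then have "Limsup at_top (\<lambda>x. ereal (tail F (v * x) / tail F x)) \<le> ereal r" by (rule Limsup_bounded)
      then show ?thesis using r(2) by (rule le_less_trans)
    qed
    moreover have "\<forall>\<^sub>F v in at_left 1. v \<in> {v0<..<1::real}" using v0 by (intro eventually_at_leftI[of v0]) auto
    ultimately show "\<forall>\<^sub>F v in at_left 1. Limsup at_top (\<lambda>x. ereal (tail F (v * x) / tail F x)) < a"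
      by (auto elim: eventually_mono)
  qed
qed

lemma ratio_limit_bounds:
  fixes f H :: "real \<Rightarrow> real"
  assumes lim: "((\<lambda>x. f x / H x) \<longlongrightarrow> c) at_top" and c: "c > 0" and H: "\<And>x. H x > 0" and d: "d > 0"
  shows "\<forall>\<^sub>F x in at_top. c / (1 + d) * H x \<le> f x \<and> f x \<le> (1 + d) * c * H x"
proof -
  have "c / (1 + d) < c" using c d by (simp add: pos_divide_less_eq distrib_left)
  moreover have "c < (1 + d) * c" using c d by (simp add: distrib_right)
  ultimately have "\<forall>\<^sub>F x in at_top. c / (1 + d) < f x / H x" "\<forall>\<^sub>F x in at_top. f x / H x < (1 + d) * c"
    using order_tendstoD[OF lim] by blast+
  then show ?thesis
  proof eventually_elim
    case (elim x)
    then show ?case using H[of x] by (simp add: pos_less_divide_eq pos_divide_less_eq less_imp_le)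
  qed
qed

lemma eventually_scaled_at_top:
  assumes "\<forall>\<^sub>F x in at_top. P x" "0 < (v::real)"
  shows "\<forall>\<^sub>F x in at_top. P (v * x)"
proof -
  obtain z where z: "\<And>x. x \<ge> z \<Longrightarrow> P x" using assms by (auto simp: eventually_at_top_linorder)
  show ?thesis
    using eventually_ge_at_top[of "z / v"]
    by eventually_elim (use z assms(2) in \<open>auto simp: pos_divide_le_eq mult.commute\<close>)
qed

lemma eventually_shifted_at_top:
  assumes "\<forall>\<^sub>F x in at_top. P x"
  shows "\<forall>\<^sub>F x in at_top. P (x - a :: real)"
proof -
  obtain z where z: "\<And>x. x \<ge> z \<Longrightarrow> P x" using assms by (auto simp: eventually_at_top_linorder)
  show ?thesis
    using eventually_ge_at_top[of "z + a"] by eventually_elim (use z in auto)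
qed

text \<open>Estimates of \<open>H\<close> along an argument transformation \<open>u\<close> transfer to every \<open>f\<close> with
  \<open>f / H\<close> convergent to a positive limit.\<close>

lemma ratio_limit_transfer:
  fixes f H :: "real \<Rightarrow> real"
  assumes lim: "((\<lambda>x. f x / H x) \<longlongrightarrow> c) at_top" and c: "c > 0" and H: "\<And>x. H x > 0" and d: "d > 0"
    and K: "K \<ge> 0" "\<forall>\<^sub>F x in at_top. H (u x) \<le> K * H x"
    and u: "\<And>P. (\<forall>\<^sub>F x in at_top. P x) \<Longrightarrow> \<forall>\<^sub>F x in at_top. P (u x)"
  shows "\<forall>\<^sub>F x in at_top. f (u x) \<le> (1 + d) * (1 + d) * K * f x"
proof -
  note b = ratio_limit_bounds[OF lim c H d]
  show ?thesis
    using b u[OF b] K(2)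
  proof eventually_elim
    case (elim x)
    have "f (u x) \<le> (1 + d) * c * H (u x)" using elim by blast
    also have "\<dots> \<le> (1 + d) * c * (K * H x)" using elim c d by (intro mult_left_mono) auto
    also have "\<dots> = (1 + d) * (1 + d) * K * (c / (1 + d) * H x)" using d by (simp add: field_simps)
    also have "\<dots> \<le> (1 + d) * (1 + d) * K * f x" using elim d K by (intro mult_left_mono) auto
    finally show ?case .
  qed
qed

lemma dominated_tail_ratio_limit:
  fixes f H :: "real \<Rightarrow> real"
  assumes lim: "((\<lambda>x. f x / H x) \<longlongrightarrow> c) at_top" and c: "c > 0" and H: "\<And>x. H x > 0"
    and D: "dominated_tail H"
  shows "dominated_tail f"
  unfolding dominated_tail_def
proof (intro allI impI)
  fix v :: real assume v: "0 < v \<and> v < 1"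
  then obtain K where K: "\<forall>\<^sub>F x in at_top. H (v * x) \<le> K * H x"
    using D by (auto simp: dominated_tail_def)
  then have "\<forall>\<^sub>F x in at_top. H (v * x) \<le> max K 0 * H x"
  proof eventually_elim
    case (elim x)
    have "K * H x \<le> max K 0 * H x" using H[of x] by (intro mult_right_mono) auto
    with elim show ?case by linarith
  qed
  from ratio_limit_transfer[OF lim c H zero_less_one _ this eventually_scaled_at_top] v
  show "\<exists>K. \<forall>\<^sub>F x in at_top. f (v * x) \<le> K * f x" by auto
qed

lemma near_one_cube:
  assumes "e > 0"
  obtains d :: real where "d > 0" "(1 + d) * (1 + d) * (1 + d) \<le> 1 + e"
proof
  define d where "d = min 1 (e / 7)"
  show d: "d > 0" using assms by (simp add: d_def)
  have 1: "d * d \<le> d" using d by (intro mult_left_le) (auto simp: d_def)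
  have 2: "d * (d * d) \<le> d * 1" using d 1 by (intro mult_left_mono) (auto simp: d_def)
  have "7 * d \<le> e" using assms by (simp add: d_def)
  then show "(1 + d) * (1 + d) * (1 + d) \<le> 1 + e" using 1 2 by (simp add: algebra_simps)
qed

lemma long_tail_ratio_limit:
  fixes f H :: "real \<Rightarrow> real"
  assumes lim: "((\<lambda>x. f x / H x) \<longlongrightarrow> c) at_top" and c: "c > 0" and H: "\<And>x. H x > 0"
    and f: "\<And>x. f x \<ge> 0" and L: "long_tail H"
  shows "long_tail f"
  unfolding long_tail_def
proof (intro allI impI)
  fix a e :: real assume a: "a > 0" and "e > 0"
  then obtain d where d: "d > 0" "(1 + d) * (1 + d) * (1 + d) \<le> 1 + e" using near_one_cube by blast
  have "\<forall>\<^sub>F x in at_top. H (x - a) \<le> (1 + d) * H x" using L a d by (auto simp: long_tail_def)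
  then have "\<forall>\<^sub>F x in at_top. f (x - a) \<le> (1 + d) * (1 + d) * (1 + d) * f x"
    using d(1) by (intro ratio_limit_transfer[OF lim c H] eventually_shifted_at_top) auto
  then show "\<forall>\<^sub>F x in at_top. f (x - a) \<le> (1 + e) * f x"
  proof eventually_elim
    case (elim x)
    have "(1 + d) * (1 + d) * (1 + d) * f x \<le> (1 + e) * f x" by (intro mult_right_mono d f)
    with elim show ?case by linarith
  qed
qed

lemma consistent_tail_ratio_limit:
  fixes f H :: "real \<Rightarrow> real"
  assumes lim: "((\<lambda>x. f x / H x) \<longlongrightarrow> c) at_top" and c: "c > 0" and H: "\<And>x. H x > 0"
    and f: "\<And>x. f x \<ge> 0" and C: "consistent_tail H"
  shows "consistent_tail f"
  unfolding consistent_tail_def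
proof (intro allI impI)
  fix e :: real assume "e > 0"
  then obtain d where d: "d > 0" "(1 + d) * (1 + d) * (1 + d) \<le> 1 + e" using near_one_cube by blast
  obtain v where v: "0 < v" "v < 1" "\<forall>\<^sub>F x in at_top. H (v * x) \<le> (1 + d) * H x"
    using C d by (auto simp: consistent_tail_def)
  have "\<forall>\<^sub>F x in at_top. f (v * x) \<le> (1 + d) * (1 + d) * (1 + d) * f x"
    using d(1) v by (intro ratio_limit_transfer[OF lim c H] eventually_scaled_at_top) auto
  then have "\<forall>\<^sub>F x in at_top. f (v * x) \<le> (1 + e) * f x"
  proof eventually_elim
    case (elim x)
    have "(1 + d) * (1 + d) * (1 + d) * f x \<le> (1 + e) * f x" by (intro mult_right_mono d f)
    with elim show ?case by linarith
  qed
  with v show "\<exists>v. 0 < v \<and> v < 1 \<and> (\<forall>\<^sub>F x in at_top. f (v * x) \<le> (1 + e) * f x)" by blast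
qed

context prob_space
begin

lemma tail_distr:
  assumes [measurable]: "Z \<in> borel_measurable M"
  shows "tail (distr M borel Z) x = \<P>(\<omega> in M. x < Z \<omega>)"
proof -
  have "cdf (distr M borel Z) x = \<P>(\<omega> in M. Z \<omega> \<le> x)"
    unfolding cdf_def by (subst measure_distr) (auto intro!: arg_cong[where f="measure M"])
  also have "\<dots> = 1 - \<P>(\<omega> in M. x < Z \<omega>)"
    by (subst prob_compl[symmetric]) (auto intro!: arg_cong[where f="measure M"])
  finally show ?thesis by (simp add: tail_def)
qed

lemma pos_tail_distr_ratio_limit:
  assumes Z [measurable]: "Z \<in> borel_measurable M"
    and lim: "((\<lambda>x. \<P>(\<omega> in M. x < Z \<omega>) / H x) \<longlongrightarrow> c) at_top" and c: "c > 0"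
  shows "pos_tail (distr M borel Z)"
  unfolding pos_tail_def
proof (intro conjI allI impI)
  show "real_distribution (distr M borel Z)" by (rule real_distribution_distr) (rule Z)
  fix x :: real
  have "\<forall>\<^sub>F y in at_top. 0 < \<P>(\<omega> in M. y < Z \<omega>) / H y" using lim c by (rule order_tendstoD)
  then have "\<forall>\<^sub>F y in at_top. 0 < \<P>(\<omega> in M. y < Z \<omega>) / H y \<and> x \<le> y"
    using eventually_ge_at_top[of x] by (rule eventually_conj)
  then obtain y where y: "0 < \<P>(\<omega> in M. y < Z \<omega>) / H y" "x \<le> y"
    using eventually_happens'[OF trivial_limit_at_top_linorder] by blast
  then have "\<P>(\<omega> in M. y < Z \<omega>) \<noteq> 0" by auto
  then have "0 < \<P>(\<omega> in M. y < Z \<omega>)" by (simp add: zero_less_measure_iff)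
  also have "\<dots> \<le> \<P>(\<omega> in M. x < Z \<omega>)" using y by (intro finite_measure_mono) auto
  finally show "0 < tail (distr M borel Z) x" by (simp add: tail_distr)
qed

lemma distr_class_ratio_limit:
  assumes Z [measurable]: "Z \<in> borel_measurable M"
    and lim: "((\<lambda>x. \<P>(\<omega> in M. x < Z \<omega>) / H x) \<longlongrightarrow> c) at_top" and c: "c > 0" and H: "\<And>x. H x > 0"
  shows "dominated_tail H \<Longrightarrow> distr M borel Z \<in> class_D"
    and "long_tail H \<Longrightarrow> distr M borel Z \<in> class_L"
    and "consistent_tail H \<Longrightarrow> distr M borel Z \<in> class_C"
proof -
  have eq: "tail (distr M borel Z) = (\<lambda>x. \<P>(\<omega> in M. x < Z \<omega>))" by (rule ext) (rule tail_distr[OF Z])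
  note pos = pos_tail_distr_ratio_limit[OF Z lim c]
  show "dominated_tail H \<Longrightarrow> distr M borel Z \<in> class_D"
    by (rule class_D_I[OF pos]) (simp add: eq dominated_tail_ratio_limit[OF lim c H])
  show "long_tail H \<Longrightarrow> distr M borel Z \<in> class_L"
    by (rule class_L_I[OF pos]) (simp add: eq long_tail_ratio_limit[OF lim c H])
  show "consistent_tail H \<Longrightarrow> distr M borel Z \<in> class_C"
    by (rule class_C_I[OF pos]) (simp add: eq consistent_tail_ratio_limit[OF lim c H])
qed

end

section \<open>Randomly stopped sums and maxima\<close>

text \<open>The three stopped quantities at a fixed time, as functions of the sequence of pairs (variable, weight).
  They depend only on the entries with index at least \<open>1\<close>, the index set used in
  \<^const>\<open>indep_of_seqs\<close>.\<close>

definition path_sum :: "nat \<Rightarrow> (nat \<Rightarrow> real \<times> real) \<Rightarrow> real"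
  where "path_sum m w = (\<Sum>i=1..m. snd (w i) * fst (w i))"

definition path_max :: "nat \<Rightarrow> (nat \<Rightarrow> real \<times> real) \<Rightarrow> real"
  where "path_max m w = (if m = 0 then 0 else Max ((\<lambda>i. snd (w i) * fst (w i)) ` {1..m}))"

definition path_max_sum :: "nat \<Rightarrow> (nat \<Rightarrow> real \<times> real) \<Rightarrow> real"
  where "path_max_sum m w = (if m = 0 then 0 else Max ((\<lambda>k. path_sum k w) ` {1..m}))"

lemma stopped_eq_path:
  "stopped_sum T X N \<omega> = path_sum (N \<omega>) (\<lambda>i. (X i \<omega>, T i \<omega>))"
  "stopped_max T X N \<omega> = path_max (N \<omega>) (\<lambda>i. (X i \<omega>, T i \<omega>))"
  "stopped_max_sum T X N \<omega> = path_max_sum (N \<omega>) (\<lambda>i. (X i \<omega>, T i \<omega>))"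
  by (simp_all add: stopped_sum_def stopped_max_def stopped_max_sum_def wsum_def path_sum_def path_max_def path_max_sum_def)

lemma path_restrict:
  "path_sum m (restrict w {1..}) = path_sum m w"
  "path_max m (restrict w {1..}) = path_max m w"
  "path_max_sum m (restrict w {1..}) = path_max_sum m w"
proof -
  show sum: "path_sum m (restrict w {1..}) = path_sum m w" for m
    unfolding path_sum_def by (intro sum.cong) auto
  show "path_max m (restrict w {1..}) = path_max m w"
    unfolding path_max_def by (auto intro!: arg_cong[where f=Max] image_cong)
  show "path_max_sum m (restrict w {1..}) = path_max_sum m w"
    unfolding path_max_sum_def sum ..
qed

lemma path_measurable:
  fixes \<xi> :: "'b \<Rightarrow> nat \<Rightarrow> real \<times> real"
  assumes [measurable]: "\<And>i. i \<ge> 1 \<Longrightarrow> (\<lambda>\<omega>. \<xi> \<omega> i) \<in> borel_measurable M"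
  shows "(\<lambda>\<omega>. path_sum m (\<xi> \<omega>)) \<in> borel_measurable M"
    and "(\<lambda>\<omega>. path_max m (\<xi> \<omega>)) \<in> borel_measurable M"
    and "(\<lambda>\<omega>. path_max_sum m (\<xi> \<omega>)) \<in> borel_measurable M"
proof -
  have prod: "(\<lambda>\<omega>. snd (\<xi> \<omega> i) * fst (\<xi> \<omega> i)) \<in> borel_measurable M" if "i \<ge> 1" for i
    using that by (intro borel_measurable_times measurable_compose[OF assms snd_borel] measurable_compose[OF assms fst_borel])
  show sum: "(\<lambda>\<omega>. path_sum m (\<xi> \<omega>)) \<in> borel_measurable M" for m
    unfolding path_sum_def by (intro borel_measurable_sum prod) auto
  show "(\<lambda>\<omega>. path_max m (\<xi> \<omega>)) \<in> borel_measurable M"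
    unfolding path_max_def by (cases "m = 0") (auto intro!: borel_measurable_Max prod)
  show "(\<lambda>\<omega>. path_max_sum m (\<xi> \<omega>)) \<in> borel_measurable M"
    unfolding path_max_sum_def by (cases "m = 0") (auto intro!: borel_measurable_Max sum)
qed

lemma path_bounds:
  fixes w :: "nat \<Rightarrow> real \<times> real"
  assumes m: "m \<ge> 1"
  defines "y i \<equiv> snd (w i) * fst (w i)"
  shows "path_sum m w \<le> path_max_sum m w"
    and "path_max_sum m w \<le> (\<Sum>i=1..m. max (y i) 0)"
    and "path_max m w \<le> (\<Sum>i=1..m. max (y i) 0)"
    and "x < path_max m w \<longleftrightarrow> (\<exists>i\<in>{1..m}. x < y i)"
proof -
  have ne: "{1..m} \<noteq> {}" using m by simp
  show "path_sum m w \<le> path_max_sum m w"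
    using m unfolding path_max_sum_def by (auto intro!: Max_ge)
  have le: "path_sum k w \<le> (\<Sum>i=1..m. max (y i) 0)" if "k \<in> {1..m}" for k
  proof -
    have "path_sum k w \<le> (\<Sum>i=1..k. max (y i) 0)"
      unfolding path_sum_def y_def by (intro sum_mono) auto
    also have "\<dots> \<le> (\<Sum>i=1..m. max (y i) 0)"
      using that by (intro sum_mono2) auto
    finally show ?thesis .
  qed
  then show "path_max_sum m w \<le> (\<Sum>i=1..m. max (y i) 0)"
    using m unfolding path_max_sum_def by (auto intro!: Max.boundedI)
  have "y k \<le> (\<Sum>i=1..m. max (y i) 0)" if "k \<in> {1..m}" for k
  proof -
    have "max (y k) 0 \<le> (\<Sum>i=1..m. max (y i) 0)" using that by (intro member_le_sum) auto
    then show ?thesis by simp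
  qed
  then show "path_max m w \<le> (\<Sum>i=1..m. max (y i) 0)"
    using m unfolding path_max_def y_def[symmetric] by (auto intro!: Max.boundedI)
  show "x < path_max m w \<longleftrightarrow> (\<exists>i\<in>{1..m}. x < y i)"
    using m ne unfolding path_max_def y_def[symmetric] by (simp add: Max_gr_iff)
qed

context prob_space
begin

lemma random_path_ratio_limit:
  fixes Xs Ts :: "nat \<Rightarrow> 'a \<Rightarrow> real" and \<Phi> :: "nat \<Rightarrow> (nat \<Rightarrow> real \<times> real) \<Rightarrow> real"
  assumes N [measurable]: "N \<in> measurable M (count_space UNIV)"
    and N_le: "\<P>(\<omega> in M. n < N \<omega>) = 0"
    and indep: "indep_of_seqs M N Xs Ts"
    and X [measurable]: "\<And>i. i \<ge> 1 \<Longrightarrow> Xs i \<in> borel_measurable M"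
    and T [measurable]: "\<And>i. i \<ge> 1 \<Longrightarrow> Ts i \<in> borel_measurable M"
    and \<Phi>: "\<And>m. \<Phi> m \<in> borel_measurable (PiM {1..} (\<lambda>_. borel))"
      "\<And>m w. \<Phi> m (restrict w {1..}) = \<Phi> m w" "\<And>w. \<Phi> 0 w = 0"
    and bounds: "\<And>m e. 1 \<le> m \<Longrightarrow> m \<le> n \<Longrightarrow> e > 0 \<Longrightarrow> \<forall>\<^sub>F x in at_top.
        (real m - e) * H x \<le> \<P>(\<omega> in M. x < \<Phi> m (\<lambda>i. (Xs i \<omega>, Ts i \<omega>))) \<and>
        \<P>(\<omega> in M. x < \<Phi> m (\<lambda>i. (Xs i \<omega>, Ts i \<omega>))) \<le> (real m + e) * H x"
    and H: "\<And>x. H x > 0"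
  shows "(\<lambda>\<omega>. \<Phi> (N \<omega>) (\<lambda>i. (Xs i \<omega>, Ts i \<omega>))) \<in> borel_measurable M"
    and "((\<lambda>x. \<P>(\<omega> in M. x < \<Phi> (N \<omega>) (\<lambda>i. (Xs i \<omega>, Ts i \<omega>))) / H x) \<longlongrightarrow> (LINT \<omega>|M. real (N \<omega>))) at_top"
proof -
  define W where "W \<omega> = (\<lambda>i\<in>{1..}. (Xs i \<omega>, Ts i \<omega>))" for \<omega>
  have W [measurable]: "W \<in> measurable M (PiM {1..} (\<lambda>_. borel))"
    unfolding W_def by (intro measurable_restrict borel_measurable_Pair X T) auto
  define Q where "Q m \<omega> = \<Phi> m (W \<omega>)" for m \<omega>
  have Q_eq: "Q m \<omega> = \<Phi> m (\<lambda>i. (Xs i \<omega>, Ts i \<omega>))" for m \<omega>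
    unfolding Q_def W_def by (rule \<Phi>(2))
  have Q [measurable]: "Q m \<in> borel_measurable M" for m
    unfolding Q_def by (rule measurable_compose[OF W \<Phi>(1)])
  have QN: "(\<lambda>\<omega>. Q (N \<omega>) \<omega>) \<in> borel_measurable M" by measurable
  then show "(\<lambda>\<omega>. \<Phi> (N \<omega>) (\<lambda>i. (Xs i \<omega>, Ts i \<omega>))) \<in> borel_measurable M"
    unfolding Q_eq .
  have ind: "\<P>(\<omega> in M. N \<omega> = m \<and> x < Q m \<omega>) = \<P>(\<omega> in M. N \<omega> = m) * \<P>(\<omega> in M. x < Q m \<omega>)" for m x
  proof -
    have "prob ((N -` {m} \<inter> space M) \<inter> (W -` (\<Phi> m -` {x<..} \<inter> space (PiM {1..} (\<lambda>_. borel))) \<inter> space M))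
        = prob (N -` {m} \<inter> space M) * prob (W -` (\<Phi> m -` {x<..} \<inter> space (PiM {1..} (\<lambda>_. borel))) \<inter> space M)"
    proof (rule indep_setD[OF indep[unfolded indep_of_seqs_def, folded W_def]])
      show "N -` {m} \<inter> space M \<in> sets (vimage_algebra (space M) N (count_space UNIV))"
        by (intro in_vimage_algebra) simp
      show "W -` (\<Phi> m -` {x<..} \<inter> space (PiM {1..} (\<lambda>_. borel))) \<inter> space M
          \<in> sets (vimage_algebra (space M) W (PiM {1..} (\<lambda>_. borel)))"
        by (intro in_vimage_algebra measurable_sets[OF \<Phi>(1)]) simp
    qed
    moreover have "(N -` {m} \<inter> space M) = {\<omega>\<in>space M. N \<omega> = m}" by auto
    moreover have "W -` (\<Phi> m -` {x<..} \<inter> space (PiM {1..} (\<lambda>_. borel))) \<inter> space M = {\<omega>\<in>space M. x < Q m \<omega>}"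
      using measurable_space[OF W] by (auto simp: Q_def)
    moreover have "{\<omega>\<in>space M. N \<omega> = m} \<inter> {\<omega>\<in>space M. x < Q m \<omega>} = {\<omega>\<in>space M. N \<omega> = m \<and> x < Q m \<omega>}" by auto
    ultimately show ?thesis by simp
  qed
  have "((\<lambda>x. \<P>(\<omega> in M. x < Q (N \<omega>) \<omega>) / H x) \<longlongrightarrow> (LINT \<omega>|M. real (N \<omega>))) at_top"
  proof (rule random_index_tail[OF N N_le Q _ ind _ H])
    show "Q 0 \<omega> = 0" for \<omega> by (simp add: Q_def \<Phi>(3))
    show "\<forall>\<^sub>F x in at_top. (real m - e) * H x \<le> \<P>(\<omega> in M. x < Q m \<omega>) \<and> \<P>(\<omega> in M. x < Q m \<omega>) \<le> (real m + e) * H x"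
      if "1 \<le> m" "m \<le> n" "e > 0" for m e
      unfolding Q_eq by (rule bounds[OF that])
  qed
  then show "((\<lambda>x. \<P>(\<omega> in M. x < \<Phi> (N \<omega>) (\<lambda>i. (Xs i \<omega>, Ts i \<omega>))) / H x) \<longlongrightarrow> (LINT \<omega>|M. real (N \<omega>))) at_top"
    unfolding Q_eq .
qed

lemma stopped_ratio_limits:
  fixes Xs Ts :: "nat \<Rightarrow> 'a \<Rightarrow> real"
  assumes N [measurable]: "N \<in> measurable M (count_space UNIV)"
    and N_le: "\<P>(\<omega> in M. n < N \<omega>) = 0"
    and indep: "indep_of_seqs M N Xs Ts"
    and X [measurable]: "\<And>i. i \<ge> 1 \<Longrightarrow> Xs i \<in> borel_measurable M"
    and T [measurable]: "\<And>i. i \<ge> 1 \<Longrightarrow> Ts i \<in> borel_measurable M"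
    and n: "0 < n"
    and tails: "\<And>i x. i \<in> {1..n} \<Longrightarrow> \<P>(\<omega> in M. x < Ts i \<omega> * Xs i \<omega>) = H x"
    and H: "\<And>x. H x > 0"
    and shift: "\<And>e. e > 0 \<Longrightarrow> \<exists>s. \<forall>\<^sub>F x in at_top. 0 < s x \<and> s x \<le> x \<and>
        H (x - s x) \<le> (1 + e) * H x \<and> (1 - e) * H x \<le> H (x + s x) \<and>
        (\<forall>i\<in>{1..n}. \<forall>j\<in>{1..n}. i \<noteq> j \<longrightarrow>
          \<P>(\<omega> in M. s x / n < \<bar>Ts i \<omega> * Xs i \<omega>\<bar> \<and> x / n < Ts j \<omega> * Xs j \<omega>) \<le> e * H x)"
  shows "stopped_sum Ts Xs N \<in> borel_measurable M" "stopped_max_sum Ts Xs N \<in> borel_measurable M"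
      "stopped_max Ts Xs N \<in> borel_measurable M"
    and "((\<lambda>x. \<P>(\<omega> in M. x < stopped_sum Ts Xs N \<omega>) / H x) \<longlongrightarrow> (LINT \<omega>|M. real (N \<omega>))) at_top"
      "((\<lambda>x. \<P>(\<omega> in M. x < stopped_max_sum Ts Xs N \<omega>) / H x) \<longlongrightarrow> (LINT \<omega>|M. real (N \<omega>))) at_top"
      "((\<lambda>x. \<P>(\<omega> in M. x < stopped_max Ts Xs N \<omega>) / H x) \<longlongrightarrow> (LINT \<omega>|M. real (N \<omega>))) at_top"
proof -
  define Y where "Y i \<omega> = Ts i \<omega> * Xs i \<omega>" for i \<omega>
  define w where "w \<omega> i = (Xs i \<omega>, Ts i \<omega>)" for \<omega> i
  have Y_meas [measurable]: "Y i \<in> borel_measurable M" if "i \<ge> 1" for i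
    unfolding Y_def using that by (intro borel_measurable_times X T)
  have w_meas: "(\<lambda>\<omega>. w \<omega> i) \<in> borel_measurable M" if "i \<ge> 1" for i
    unfolding w_def using that by (intro borel_measurable_Pair X T)
  note [measurable] = path_measurable[of w M, OF w_meas]
  have Yw: "snd (w \<omega> i) * fst (w \<omega> i) = Y i \<omega>" for \<omega> i by (simp add: w_def Y_def)
  have meas: "(\<lambda>\<omega>. \<Sum>i=1..m. max (Y i \<omega>) 0) \<in> borel_measurable M" for m
    by (intro borel_measurable_sum borel_measurable_max Y_meas) auto
  have comp: "(\<lambda>w. w i) \<in> borel_measurable (PiM {1..} (\<lambda>_. borel :: (real \<times> real) measure))" if "i \<ge> (1::nat)" for i
    using that by (intro measurable_component_singleton) auto
  note \<Phi>_meas = path_measurable[of "\<lambda>w. w", OF comp]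
  have core: "\<forall>\<^sub>F x in at_top.
      (real m - e) * H x \<le> \<P>(\<omega> in M. x < path_sum m (w \<omega>)) \<and>
      \<P>(\<omega> in M. x < path_sum m (w \<omega>)) \<le> \<P>(\<omega> in M. x < path_max_sum m (w \<omega>)) \<and>
      \<P>(\<omega> in M. x < path_max_sum m (w \<omega>)) \<le> (real m + e) * H x \<and>
      (real m - e) * H x \<le> \<P>(\<omega> in M. x < path_max m (w \<omega>)) \<and>
      \<P>(\<omega> in M. x < path_max m (w \<omega>)) \<le> (real m + e) * H x"
    if m: "1 \<le> m" "m \<le> n" and e: "e > 0" for m e
  proof -
    have "\<forall>\<^sub>F x in at_top.
      \<P>(\<omega> in M. x < (\<Sum>i=1..m. max (Y i \<omega>) 0)) \<le> (real m + e) * H x \<and>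
      (real m - e) * H x \<le> \<P>(\<omega> in M. x < (\<Sum>i=1..m. Y i \<omega>)) \<and>
      (real m - e) * H x \<le> \<P>(\<omega> in M. \<exists>j\<in>{1..m}. x < Y j \<omega>)"
      by (rule sum_tail_bounds[OF n m(2) _ _ _ e])
         (use tails shift in \<open>auto simp: Y_def intro!: borel_measurable_times X T\<close>)
    then show ?thesis
    proof eventually_elim
      case (elim x)
      note pb = path_bounds[OF m(1), where w="w \<omega>" for \<omega>, unfolded Yw]
      have "\<P>(\<omega> in M. x < path_max_sum m (w \<omega>)) \<le> \<P>(\<omega> in M. x < (\<Sum>i=1..m. max (Y i \<omega>) 0))"
        using meas[of m]
        by - (rule finite_measure_mono, blast intro: less_le_trans[OF _ pb(2)], measurable)
      moreover have "\<P>(\<omega> in M. x < path_max m (w \<omega>)) \<le> \<P>(\<omega> in M. x < (\<Sum>i=1..m. max (Y i \<omega>) 0))"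
        using meas[of m]
        by - (rule finite_measure_mono, blast intro: less_le_trans[OF _ pb(3)], measurable)
      moreover have "\<P>(\<omega> in M. x < path_sum m (w \<omega>)) \<le> \<P>(\<omega> in M. x < path_max_sum m (w \<omega>))"
        using meas[of m]
        by - (rule finite_measure_mono, blast intro: less_le_trans[OF _ pb(1)], measurable)
      moreover have "\<P>(\<omega> in M. x < path_sum m (w \<omega>)) = \<P>(\<omega> in M. x < (\<Sum>i=1..m. Y i \<omega>))"
        by (simp add: path_sum_def Yw)
      moreover have "\<P>(\<omega> in M. x < path_max m (w \<omega>)) = \<P>(\<omega> in M. \<exists>j\<in>{1..m}. x < Y j \<omega>)"
        unfolding pb(4) ..
      ultimately show ?case using elim by linarith
    qed
  qed
  have "\<forall>\<^sub>F x in at_top. (real m - e) * H x \<le> \<P>(\<omega> in M. x < path_sum m (\<lambda>i. (Xs i \<omega>, Ts i \<omega>))) \<and>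
      \<P>(\<omega> in M. x < path_sum m (\<lambda>i. (Xs i \<omega>, Ts i \<omega>))) \<le> (real m + e) * H x"
    if "1 \<le> m" "m \<le> n" "e > 0" for m e
    using core[OF that] unfolding w_def by eventually_elim linarith
  note A = random_path_ratio_limit[OF N N_le indep X T \<Phi>_meas(1) path_restrict(1) _ this H, folded w_def]
  have "\<forall>\<^sub>F x in at_top. (real m - e) * H x \<le> \<P>(\<omega> in M. x < path_max_sum m (\<lambda>i. (Xs i \<omega>, Ts i \<omega>))) \<and>
      \<P>(\<omega> in M. x < path_max_sum m (\<lambda>i. (Xs i \<omega>, Ts i \<omega>))) \<le> (real m + e) * H x"
    if "1 \<le> m" "m \<le> n" "e > 0" for m e
    using core[OF that] unfolding w_def by eventually_elim linarith
  note B = random_path_ratio_limit[OF N N_le indep X T \<Phi>_meas(3) path_restrict(3) _ this H, folded w_def]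
  have "\<forall>\<^sub>F x in at_top. (real m - e) * H x \<le> \<P>(\<omega> in M. x < path_max m (\<lambda>i. (Xs i \<omega>, Ts i \<omega>))) \<and>
      \<P>(\<omega> in M. x < path_max m (\<lambda>i. (Xs i \<omega>, Ts i \<omega>))) \<le> (real m + e) * H x"
    if "1 \<le> m" "m \<le> n" "e > 0" for m e
    using core[OF that] unfolding w_def by eventually_elim linarith
  note C = random_path_ratio_limit[OF N N_le indep X T \<Phi>_meas(2) path_restrict(2) _ this H, folded w_def]
  have zero: "path_sum 0 u = 0" "path_max_sum 0 u = 0" "path_max 0 u = 0" for u
    by (simp_all add: path_sum_def path_max_sum_def path_max_def)
  have eq: "stopped_sum Ts Xs N = (\<lambda>\<omega>. path_sum (N \<omega>) (w \<omega>))"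
    "stopped_max_sum Ts Xs N = (\<lambda>\<omega>. path_max_sum (N \<omega>) (w \<omega>))"
    "stopped_max Ts Xs N = (\<lambda>\<omega>. path_max (N \<omega>) (w \<omega>))"
    by (simp_all add: fun_eq_iff stopped_eq_path w_def[abs_def])
  show "stopped_sum Ts Xs N \<in> borel_measurable M" unfolding eq by (rule A(1)) (auto simp: zero)
  show "stopped_max_sum Ts Xs N \<in> borel_measurable M" unfolding eq by (rule B(1)) (auto simp: zero)
  show "stopped_max Ts Xs N \<in> borel_measurable M" unfolding eq by (rule C(1)) (auto simp: zero)
  show "((\<lambda>x. \<P>(\<omega> in M. x < stopped_sum Ts Xs N \<omega>) / H x) \<longlongrightarrow> (LINT \<omega>|M. real (N \<omega>))) at_top"
    unfolding eq by (rule A(2)) (auto simp: zero)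
  show "((\<lambda>x. \<P>(\<omega> in M. x < stopped_max_sum Ts Xs N \<omega>) / H x) \<longlongrightarrow> (LINT \<omega>|M. real (N \<omega>))) at_top"
    unfolding eq by (rule B(2)) (auto simp: zero)
  show "((\<lambda>x. \<P>(\<omega> in M. x < stopped_max Ts Xs N \<omega>) / H x) \<longlongrightarrow> (LINT \<omega>|M. real (N \<omega>))) at_top"
    unfolding eq by (rule C(2)) (auto simp: zero)
qed

lemma shift_lower_bound:
  fixes p q e :: real
  assumes "e > 0" "p > 0" "q > 0" "p \<le> (1 + e) * q"
  shows "(1 - e) * p \<le> q"
proof (cases "e \<le> 1")
  case True
  then have "(1 - e) * p \<le> (1 - e) * ((1 + e) * q)" using assms by (intro mult_left_mono) auto
  also have "\<dots> = q - e * e * q" by (simp add: algebra_simps)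
  also have "\<dots> \<le> q" using assms by simp
  finally show ?thesis .
next
  case False
  then have "(1 - e) * p \<le> 0" using assms by (intro mult_nonpos_nonneg) auto
  then show ?thesis using assms by simp
qed

text \<open>The two choices of the shift: a constant for long tails, a small multiple of the argument
  for consistently varying tails. The first needs control at two independent levels, the second only at
  equal levels.\<close>

lemma constant_shift:
  fixes Y :: "nat \<Rightarrow> 'a \<Rightarrow> real"
  assumes n: "2 \<le> n" and H: "\<And>x. H x > 0" "\<And>x y. x \<le> y \<Longrightarrow> H y \<le> H x"
    and D: "dominated_tail H" and L: "long_tail H"
    and pair: "\<And>e i j. e > 0 \<Longrightarrow> i \<in> {1..n} \<Longrightarrow> j \<in> {1..n} \<Longrightarrow> i \<noteq> j \<Longrightarrow>
      \<exists>z. \<forall>x\<ge>z. \<forall>y\<ge>z. \<P>(\<omega> in M. x < \<bar>Y i \<omega>\<bar> \<and> y < Y j \<omega>) \<le> e * H y"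
    and e: "e > 0"
  shows "\<exists>s. \<forall>\<^sub>F x in at_top. 0 < s x \<and> s x \<le> x \<and>
        H (x - s x) \<le> (1 + e) * H x \<and> (1 - e) * H x \<le> H (x + s x) \<and>
        (\<forall>i\<in>{1..n}. \<forall>j\<in>{1..n}. i \<noteq> j \<longrightarrow> \<P>(\<omega> in M. s x / n < \<bar>Y i \<omega>\<bar> \<and> x / n < Y j \<omega>) \<le> e * H x)"
proof -
  have "0 < 1 / real n \<and> 1 / real n < 1" using n by simp
  then obtain K where K: "\<forall>\<^sub>F x in at_top. H (1 / n * x) \<le> K * H x"
    using D unfolding dominated_tail_def by blast
  define d where "d = e / max K 1"
  have d: "d > 0" using e by (simp add: d_def less_max_iff_disj)
  have "\<exists>z. \<forall>x\<ge>z. \<forall>y\<ge>z. \<forall>i\<in>{1..n}. \<forall>j\<in>{1..n}. i \<noteq> j \<longrightarrow> \<P>(\<omega> in M. x < \<bar>Y i \<omega>\<bar> \<and> y < Y j \<omega>) \<le> d * H y"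
  proof -
    have "\<forall>p\<in>{1..n} \<times> {1..n}. \<exists>z. fst p \<noteq> snd p \<longrightarrow>
        (\<forall>x\<ge>z. \<forall>y\<ge>z. \<P>(\<omega> in M. x < \<bar>Y (fst p) \<omega>\<bar> \<and> y < Y (snd p) \<omega>) \<le> d * H y)"
      using pair[OF d] by (auto simp: mem_Times_iff)
    from bchoice[OF this] obtain z where z: "\<And>p x y. p \<in> {1..n} \<times> {1..n} \<Longrightarrow> fst p \<noteq> snd p \<Longrightarrow>
        x \<ge> z p \<Longrightarrow> y \<ge> z p \<Longrightarrow> \<P>(\<omega> in M. x < \<bar>Y (fst p) \<omega>\<bar> \<and> y < Y (snd p) \<omega>) \<le> d * H y"
      by blast
    define z0 where "z0 = Max (z ` ({1..n} \<times> {1..n}))"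
    have z0: "z p \<le> z0" if "p \<in> {1..n} \<times> {1..n}" for p
      unfolding z0_def using that by (intro Max_ge) auto
    show ?thesis
    proof (intro exI[of _ z0] allI impI ballI)
      fix x y i j assume "z0 \<le> x" "z0 \<le> y" "i \<in> {1..n}" "j \<in> {1..n}" "i \<noteq> j"
      then show "\<P>(\<omega> in M. x < \<bar>Y i \<omega>\<bar> \<and> y < Y j \<omega>) \<le> d * H y"
        using z[of "(i, j)" x y] z0[of "(i, j)"] by auto
    qed
  qed
  then obtain z where z: "\<And>x y i j. x \<ge> z \<Longrightarrow> y \<ge> z \<Longrightarrow> i \<in> {1..n} \<Longrightarrow> j \<in> {1..n} \<Longrightarrow> i \<noteq> j \<Longrightarrow>
      \<P>(\<omega> in M. x < \<bar>Y i \<omega>\<bar> \<and> y < Y j \<omega>) \<le> d * H y" by blast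
  define a where "a = max 1 (real n * z)"
  have a: "a > 0" "a / n \<ge> z" using n by (auto simp: a_def pos_le_divide_eq mult.commute)
  have L1: "\<forall>\<^sub>F x in at_top. H (x - a) \<le> (1 + e) * H x" using L a e by (auto simp: long_tail_def)
  have L2: "\<forall>\<^sub>F x in at_top. H (x - - a - a) \<le> (1 + e) * H (x - - a)"
    by (rule eventually_shifted_at_top[OF L1])
  show ?thesis
  proof (rule exI[of _ "\<lambda>_. a"])
    show "\<forall>\<^sub>F x in at_top. 0 < a \<and> a \<le> x \<and>
        H (x - a) \<le> (1 + e) * H x \<and> (1 - e) * H x \<le> H (x + a) \<and>
        (\<forall>i\<in>{1..n}. \<forall>j\<in>{1..n}. i \<noteq> j \<longrightarrow> \<P>(\<omega> in M. a / n < \<bar>Y i \<omega>\<bar> \<and> x / n < Y j \<omega>) \<le> e * H x)"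
      using L1 L2 K eventually_ge_at_top[of a] eventually_ge_at_top[of "real n * z"]
    proof eventually_elim
      case (elim x)
      have "H x \<le> (1 + e) * H (x + a)" using elim(2) by simp
      then have lower: "(1 - e) * H x \<le> H (x + a)" by (rule shift_lower_bound[OF e H(1) H(1)])
      have xn: "x / n \<ge> z" using elim(5) n by (simp add: pos_le_divide_eq mult.commute)
      have dK: "d * H (x / n) \<le> e * H x"
      proof -
        have "d * H (x / n) \<le> d * (K * H x)" using elim(3) d by (intro mult_left_mono) auto
        also have "\<dots> \<le> d * (max K 1 * H x)" using d H(1)[of x] by (intro mult_left_mono mult_right_mono) auto
        also have "\<dots> = e * H x" by (simp add: d_def)
        finally show ?thesis .
      qed
      have "\<P>(\<omega> in M. a / n < \<bar>Y i \<omega>\<bar> \<and> x / n < Y j \<omega>) \<le> e * H x"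
        if "i \<in> {1..n}" "j \<in> {1..n}" "i \<noteq> j" for i j
        using z[OF a(2) xn that] dK by linarith
      then show ?case using a elim lower by blast
    qed
  qed
qed

lemma proportional_shift:
  fixes Y :: "nat \<Rightarrow> 'a \<Rightarrow> real"
  assumes n: "2 \<le> n" and Y: "\<And>i. i \<in> {1..n} \<Longrightarrow> Y i \<in> borel_measurable M"
    and H: "\<And>x. H x > 0" "\<And>x y. x \<le> y \<Longrightarrow> H y \<le> H x"
    and D: "dominated_tail H" and C: "consistent_tail H"
    and pair: "\<And>e i j. e > 0 \<Longrightarrow> i \<in> {1..n} \<Longrightarrow> j \<in> {1..n} \<Longrightarrow> i \<noteq> j \<Longrightarrow>
      \<forall>\<^sub>F x in at_top. \<P>(\<omega> in M. x < \<bar>Y i \<omega>\<bar> \<and> x < Y j \<omega>) \<le> e * H x"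
    and e: "e > 0"
  shows "\<exists>s. \<forall>\<^sub>F x in at_top. 0 < s x \<and> s x \<le> x \<and>
        H (x - s x) \<le> (1 + e) * H x \<and> (1 - e) * H x \<le> H (x + s x) \<and>
        (\<forall>i\<in>{1..n}. \<forall>j\<in>{1..n}. i \<noteq> j \<longrightarrow> \<P>(\<omega> in M. s x / n < \<bar>Y i \<omega>\<bar> \<and> x / n < Y j \<omega>) \<le> e * H x)"
proof -
  obtain v where v: "0 < v" "v < 1" "\<forall>\<^sub>F x in at_top. H (v * x) \<le> (1 + e) * H x"
    using C e unfolding consistent_tail_def by blast
  define u where "u = (1 - v) / real n"
  have u: "0 < u" "u < 1"
  proof -
    show "0 < u" using v n by (simp add: u_def)
    have "1 - v < real n" using v n by linarith
    then show "u < 1" using n by (simp add: u_def)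
  qed
  then obtain K where K: "\<forall>\<^sub>F x in at_top. H (u * x) \<le> K * H x"
    using D unfolding dominated_tail_def by blast
  define d where "d = e / max K 1"
  have d: "d > 0" using e by (simp add: d_def less_max_iff_disj)
  have "\<forall>\<^sub>F x in at_top. \<forall>i\<in>{1..n}. \<forall>j\<in>{1..n}. i \<noteq> j \<longrightarrow> \<P>(\<omega> in M. x < \<bar>Y i \<omega>\<bar> \<and> x < Y j \<omega>) \<le> d * H x"
    using pair[OF d] by (intro eventually_ball_finite ballI) (auto simp: eventually_conj_iff intro: eventually_mono)
  from eventually_scaled_at_top[OF this u(1)]
  have P: "\<forall>\<^sub>F x in at_top. \<forall>i\<in>{1..n}. \<forall>j\<in>{1..n}. i \<noteq> j \<longrightarrow>
      \<P>(\<omega> in M. u * x < \<bar>Y i \<omega>\<bar> \<and> u * x < Y j \<omega>) \<le> d * H (u * x)" .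
  have up: "\<forall>\<^sub>F x in at_top. H (v * ((2 - v) * x)) \<le> (1 + e) * H ((2 - v) * x)"
    using v by (intro eventually_scaled_at_top[OF v(3)]) simp
  show ?thesis
  proof (rule exI[of _ "\<lambda>x. (1 - v) * x"])
    show "\<forall>\<^sub>F x in at_top. 0 < (1 - v) * x \<and> (1 - v) * x \<le> x \<and>
        H (x - (1 - v) * x) \<le> (1 + e) * H x \<and> (1 - e) * H x \<le> H (x + (1 - v) * x) \<and>
        (\<forall>i\<in>{1..n}. \<forall>j\<in>{1..n}. i \<noteq> j \<longrightarrow>
          \<P>(\<omega> in M. (1 - v) * x / n < \<bar>Y i \<omega>\<bar> \<and> x / n < Y j \<omega>) \<le> e * H x)"
      using v(3) K P up eventually_gt_at_top[of 0]
    proof eventually_elim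
      case (elim x)
      have eqs: "x - (1 - v) * x = v * x" "x + (1 - v) * x = (2 - v) * x" "(1 - v) * x / n = u * x"
        by (simp_all add: u_def algebra_simps)
      have sx: "0 < (1 - v) * x" "(1 - v) * x \<le> x" using v elim(5) by (simp_all add: mult_le_cancel_right1)
      have "0 \<le> (1 - v) * (1 - v)" using v by simp
      then have "v * (2 - v) \<le> 1" by (simp add: algebra_simps)
      then have "v * (2 - v) * x \<le> 1 * x" using elim(5) by (intro mult_right_mono) auto
      then have "H x \<le> H (v * ((2 - v) * x))" by (intro H(2)) (simp add: mult.assoc)
      also have "\<dots> \<le> (1 + e) * H ((2 - v) * x)" by (rule elim(4))
      finally have lower: "(1 - e) * H x \<le> H ((2 - v) * x)" by (rule shift_lower_bound[OF e H(1) H(1)])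
      have dK: "d * H (u * x) \<le> e * H x"
      proof -
        have "d * H (u * x) \<le> d * (K * H x)" using elim(2) d by (intro mult_left_mono) auto
        also have "\<dots> \<le> d * (max K 1 * H x)" using d H(1)[of x] by (intro mult_left_mono mult_right_mono) auto
        also have "\<dots> = e * H x" by (simp add: d_def)
        finally show ?thesis .
      qed
      have "u * x \<le> x / n"
        using sx n unfolding eqs(3)[symmetric] by (intro divide_right_mono) auto
      then have "\<P>(\<omega> in M. u * x < \<bar>Y i \<omega>\<bar> \<and> x / n < Y j \<omega>) \<le> e * H x"
        if ij: "i \<in> {1..n}" "j \<in> {1..n}" "i \<noteq> j" for i j
      proof -
        note [measurable] = Y[OF ij(1)] Y[OF ij(2)]
        have "\<P>(\<omega> in M. u * x < \<bar>Y i \<omega>\<bar> \<and> x / n < Y j \<omega>) \<le> \<P>(\<omega> in M. u * x < \<bar>Y i \<omega>\<bar> \<and> u * x < Y j \<omega>)"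
          using \<open>u * x \<le> x / n\<close> by (intro finite_measure_mono) auto
        also have "\<dots> \<le> d * H (u * x)" using elim(3) ij by blast
        finally show ?thesis using dK by linarith
      qed
      then show ?case using sx elim(1) lower unfolding eqs by blast
    qed
  qed
qed

end

theorem theorem5p1:
  fixes M :: "'a measure"
    and X Theta :: "'a \<Rightarrow> real"
    and Xs Thetas :: "nat \<Rightarrow> 'a \<Rightarrow> real"
    and N :: "'a \<Rightarrow> nat"
    and n :: nat
    and b h :: "real \<Rightarrow> real"
    and g :: "real \<times> real \<Rightarrow> real"
    and L U :: real
  assumes "prob_space M"
    and X_rv: "X \<in> borel_measurable M" "\<And>i. i \<ge> 1 \<Longrightarrow> Xs i \<in> borel_measurable M"
    and X_ident: "\<And>i. i \<ge> 1 \<Longrightarrow> distr M borel (Xs i) = distr M borel X"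
    and X_class: "distr M borel X \<in> class_D \<inter> class_L"
    and Theta_rv: "Theta \<in> borel_measurable M" "\<And>i. i \<ge> 1 \<Longrightarrow> Thetas i \<in> borel_measurable M"
    and Theta_nonneg: "AE \<omega> in M. 0 \<le> Theta \<omega>" "\<And>i. i \<ge> 1 \<Longrightarrow> AE \<omega> in M. 0 \<le> Thetas i \<omega>"
    and Theta_ident: "\<And>i. i \<ge> 1 \<Longrightarrow> distr M borel (Thetas i) = distr M borel Theta"
    and Theta_nondeg: "\<not> (AE \<omega> in M. Theta \<omega> = 0)"
    and prod_ident: "\<And>i. i \<ge> 1 \<Longrightarrow>
      distr M borel (\<lambda>\<omega>. Thetas i \<omega> * Xs i \<omega>) = distr M borel (\<lambda>\<omega>. Theta \<omega> * X \<omega>)"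
    and N_rv: "N \<in> measurable M (count_space UNIV)"
    and N_nondeg: "\<not> (AE \<omega> in M. N \<omega> = 0)"
    and N_bounded: "n \<ge> 2" "\<P>(\<omega> in M. N \<omega> > n) = 0"
    and N_indep: "indep_of_seqs M N Xs Thetas"
    and b_pos: "\<And>x. x \<ge> 0 \<Longrightarrow> b x > 0"
    and b_lim: "filterlim b at_top at_top" "((\<lambda>x. b x / x) \<longlongrightarrow> 0) at_top"
    and cond_i: "\<And>i j. i \<in> {1..n} \<Longrightarrow> j \<in> {1..n} \<Longrightarrow> i \<noteq> j \<Longrightarrow>
      (\<lambda>(x, y). \<P>(\<omega> in M. Thetas i \<omega> > b x)) \<in>
        o[min_at_top](\<lambda>(x, y). \<P>(\<omega> in M. Thetas i \<omega> * Xs i \<omega> > x \<and> Thetas j \<omega> * Xs j \<omega> > y))"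
    and h_pos: "\<And>\<theta>. \<theta> \<ge> 0 \<Longrightarrow> h \<theta> > 0"
    and cond_ii_exists: "\<And>i. i \<in> {1..n} \<Longrightarrow>
      \<forall>\<^sub>F x in at_top. \<forall>\<theta>\<in>rv_support M Theta. cond1_exists M (\<lambda>\<omega>. Xs i \<omega> > x) (Thetas i) \<theta>"
    and cond_ii: "\<And>i. i \<in> {1..n} \<Longrightarrow>
      uniform_equiv at_top (rv_support M Theta)
        (\<lambda>x \<theta>. cond1 M (\<lambda>\<omega>. Xs i \<omega> > x) (Thetas i) \<theta>)
        (\<lambda>x \<theta>. h \<theta> * \<P>(\<omega> in M. Xs i \<omega> > x))"
    and g_meas: "g \<in> borel_measurable (restrict_space borel ({0..} \<times> {0..}))"
    and g_pos: "\<And>\<theta> \<theta>'. \<theta> \<ge> 0 \<Longrightarrow> \<theta>' \<ge> 0 \<Longrightarrow> g (\<theta>, \<theta>') > 0"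
    and LU: "0 < L" "L \<le> U"
    and cond_iii_exists: "\<And>i j. i \<in> {1..n} \<Longrightarrow> j \<in> {1..n} \<Longrightarrow> i \<noteq> j \<Longrightarrow>
      \<forall>\<^sub>F (x, y) in min_at_top. \<forall>\<theta>\<in>rv_support M Theta \<times> rv_support M Theta.
        cond2_exists M (\<lambda>\<omega>. \<bar>Xs i \<omega>\<bar> > x \<and> Xs j \<omega> > y) (Thetas i) (Thetas j) \<theta> \<and>
        cond2_exists M (\<lambda>\<omega>. Xs i \<omega> > x \<and> Xs j \<omega> > y) (Thetas i) (Thetas j) \<theta>"
    and cond_iii_equiv: "\<And>i j. i \<in> {1..n} \<Longrightarrow> j \<in> {1..n} \<Longrightarrow> i \<noteq> j \<Longrightarrow>
      uniform_equiv min_at_top (rv_support M Theta \<times> rv_support M Theta)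
        (\<lambda>(x, y) \<theta>. cond2 M (\<lambda>\<omega>. \<bar>Xs i \<omega>\<bar> > x \<and> Xs j \<omega> > y) (Thetas i) (Thetas j) \<theta>)
        (\<lambda>(x, y) \<theta>. g \<theta> * \<P>(\<omega> in M. \<bar>Xs i \<omega>\<bar> > x \<and> Xs j \<omega> > y))"
    and cond_iii_lower: "\<And>i j. i \<in> {1..n} \<Longrightarrow> j \<in> {1..n} \<Longrightarrow> i \<noteq> j \<Longrightarrow>
      uniform_lesssim min_at_top (rv_support M Theta \<times> rv_support M Theta)
        (\<lambda>(x, y) \<theta>. L * g \<theta> * \<P>(\<omega> in M. Xs i \<omega> > x \<and> Xs j \<omega> > y))
        (\<lambda>(x, y) \<theta>. cond2 M (\<lambda>\<omega>. Xs i \<omega> > x \<and> Xs j \<omega> > y) (Thetas i) (Thetas j) \<theta>)"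
    and cond_iii_upper: "\<And>i j. i \<in> {1..n} \<Longrightarrow> j \<in> {1..n} \<Longrightarrow> i \<noteq> j \<Longrightarrow>
      uniform_lesssim min_at_top (rv_support M Theta \<times> rv_support M Theta)
        (\<lambda>(x, y) \<theta>. cond2 M (\<lambda>\<omega>. Xs i \<omega> > x \<and> Xs j \<omega> > y) (Thetas i) (Thetas j) \<theta>)
        (\<lambda>(x, y) \<theta>. U * g \<theta> * \<P>(\<omega> in M. Xs i \<omega> > x \<and> Xs j \<omega> > y))"
  shows
    "(pTAI M n Xs \<longrightarrow>
        (\<lambda>x. \<P>(\<omega> in M. stopped_sum Thetas Xs N \<omega> > x))
          \<sim>[at_top] (\<lambda>x. \<P>(\<omega> in M. stopped_max_sum Thetas Xs N \<omega> > x)) \<and>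
        (\<lambda>x. \<P>(\<omega> in M. stopped_max_sum Thetas Xs N \<omega> > x))
          \<sim>[at_top] (\<lambda>x. \<P>(\<omega> in M. stopped_max Thetas Xs N \<omega> > x)) \<and>
        (\<lambda>x. \<P>(\<omega> in M. stopped_max Thetas Xs N \<omega> > x))
          \<sim>[at_top] (\<lambda>x. (LINT \<omega>|M. real (N \<omega>)) * \<P>(\<omega> in M. Theta \<omega> * X \<omega> > x)) \<and>
        distr M borel (stopped_sum Thetas Xs N) \<in> class_D \<inter> class_L \<and>
        distr M borel (stopped_max_sum Thetas Xs N) \<in> class_D \<inter> class_L \<and>
        distr M borel (stopped_max Thetas Xs N) \<in> class_D \<inter> class_L)
     \<and>
     (pQAI M n Xs \<and> distr M borel X \<in> class_C \<longrightarrow>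
        (\<lambda>x. \<P>(\<omega> in M. stopped_sum Thetas Xs N \<omega> > x))
          \<sim>[at_top] (\<lambda>x. \<P>(\<omega> in M. stopped_max_sum Thetas Xs N \<omega> > x)) \<and>
        (\<lambda>x. \<P>(\<omega> in M. stopped_max_sum Thetas Xs N \<omega> > x))
          \<sim>[at_top] (\<lambda>x. (LINT \<omega>|M. real (N \<omega>)) * \<P>(\<omega> in M. Theta \<omega> * X \<omega> > x)) \<and>
        distr M borel (stopped_sum Thetas Xs N) \<in> class_C \<and>
        distr M borel (stopped_max_sum Thetas Xs N) \<in> class_C)"
proof -
  interpret prob_space M by fact
  define F where "F x = \<P>(\<omega> in M. x < X \<omega>)" for x
  define H where "H x = \<P>(\<omega> in M. x < Theta \<omega> * X \<omega>)" for x
  define S where "S = rv_support M Theta"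
  define Y where "Y i \<omega> = Thetas i \<omega> * Xs i \<omega>" for i \<omega>
  note [measurable] = X_rv Theta_rv
  have Y_meas: "Y i \<in> borel_measurable M" if "i \<in> {1..n}" for i
    unfolding Y_def using that by (intro borel_measurable_times X_rv Theta_rv) auto
  have Xs_tail: "\<P>(\<omega> in M. x < Xs i \<omega>) = F x" if "i \<ge> 1" for i x
    using tail_distr[OF X_rv(2)[OF that], of x] tail_distr[OF X_rv(1), of x] X_ident[OF that]
    by (simp add: F_def)
  have Y_tail: "\<P>(\<omega> in M. x < Thetas i \<omega> * Xs i \<omega>) = H x" if "i \<ge> 1" for i x
    using tail_distr[OF borel_measurable_times[OF Theta_rv(2)[OF that] X_rv(2)[OF that]], of x]
      tail_distr[OF borel_measurable_times[OF Theta_rv(1) X_rv(1)], of x] prod_ident[OF that]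
    by (simp add: H_def)
  have F_tail: "tail (distr M borel X) = F"
    by (rule ext) (simp add: tail_distr F_def)
  have F_D: "dominated_tail F" and F_L: "long_tail F"
    using class_D_imp_dominated_tail class_L_imp_long_tail X_class unfolding F_tail[symmetric] by blast+
  have F_pos: "F x > 0" for x
  proof -
    have "0 < tail (distr M borel X) (max x 0)" using X_class by (simp add: class_D_def pos_tail_def)
    also have "\<dots> \<le> F x" unfolding F_tail F_def by (intro finite_measure_mono) auto
    finally show ?thesis .
  qed
  have S_eq: "rv_support M (Thetas i) = S" if "i \<ge> 1" for i
    unfolding S_def using that by (intro rv_support_cong Theta_rv Theta_ident)
  have S_AE: "AE \<omega> in M. Thetas i \<omega> \<in> S" if "i \<ge> 1" for i
    using AE_rv_support[OF Theta_rv(2)[OF that]] S_eq[OF that] by simp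
  have S_nonneg: "0 \<le> \<theta>" if "\<theta> \<in> S" for \<theta>
  proof (rule ccontr)
    assume neg: "\<not> 0 \<le> \<theta>"
    then have "0 < \<P>(\<omega> in M. Theta \<omega> \<in> {\<theta> - (- \<theta> / 2)..\<theta> + - \<theta> / 2})"
      using that unfolding S_def rv_support_def by (auto dest: spec[of _ "- \<theta> / 2"])
    moreover have "AE \<omega> in M. \<not> Theta \<omega> \<in> {\<theta> - (- \<theta> / 2)..\<theta> + - \<theta> / 2}"
      using Theta_nonneg(1) by eventually_elim (use neg in auto)
    then have "\<P>(\<omega> in M. Theta \<omega> \<in> {\<theta> - (- \<theta> / 2)..\<theta> + - \<theta> / 2}) = 0"
      by (subst prob_Collect_eq_0) auto
    ultimately show False by simp
  qed
  have "\<exists>\<theta>\<in>S. 0 < \<theta>"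
  proof (rule ccontr)
    assume none: "\<not> ?thesis"
    have "AE \<omega> in M. Theta \<omega> = 0"
      using AE_rv_support[OF Theta_rv(1)] unfolding S_def[symmetric]
    proof eventually_elim
      case (elim \<omega>)
      then show ?case using none S_nonneg[OF elim] by (auto simp: not_less)
    qed
    with Theta_nondeg show False ..
  qed
  then obtain \<theta>0 where \<theta>0: "\<theta>0 \<in> S" "0 < \<theta>0" by blast
  have small: "\<exists>z. \<forall>x\<ge>z. \<forall>y\<ge>z. \<P>(\<omega> in M. b x < Thetas i \<omega>)
      \<le> e * \<P>(\<omega> in M. x < Thetas i \<omega> * Xs i \<omega> \<and> y < Thetas j \<omega> * Xs j \<omega>)"
    if "i \<in> {1..n}" "j \<in> {1..n}" "i \<noteq> j" "e > 0" for i j and e :: real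
    using landau_o.smallD[OF cond_i[OF that(1-3)] that(4)] by (simp add: eventually_min_at_top)
  have variable: "weighted_variable M (Xs i) (Thetas i) b" if i: "i \<in> {1..n}" for i
  proof (intro weighted_variable.intro weighted_variable_axioms.intro)
    have i1: "i \<ge> 1" using i by simp
    \<comment> \<open>A second index turns negligibility compared with a joint exceedance into negligibility compared
      with a single one.\<close>
    obtain j where j: "j \<in> {1..n}" "i \<noteq> j" using N_bounded(1) by (intro that[of "if i = 1 then 2 else 1"]) auto
    show "prob_space M" by fact
    show "Xs i \<in> borel_measurable M" "Thetas i \<in> borel_measurable M" "AE \<omega> in M. 0 \<le> Thetas i \<omega>"
      using i1 by (rule X_rv Theta_rv Theta_nonneg)+
    show "0 < \<P>(\<omega> in M. x < Xs i \<omega>)" for x using F_pos[of x] Xs_tail[OF i1, of x] by simp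
    have pos: "0 < \<P>(\<omega> in M. x < Xs i \<omega>)" for x using F_pos[of x] Xs_tail[OF i1, of x] by simp
    have h: "0 < h \<theta>" if "\<theta> \<in> S" for \<theta> using that by (intro h_pos S_nonneg)
    show "\<exists>x0. \<forall>r\<ge>x0. \<forall>r'\<ge>x0. \<forall>B\<in>sets borel.
      \<P>(\<omega> in M. r < Xs i \<omega> \<and> Thetas i \<omega> \<in> B) * \<P>(\<omega> in M. r' < Xs i \<omega>)
        \<le> (1 + e) * \<P>(\<omega> in M. r < Xs i \<omega>) * \<P>(\<omega> in M. r' < Xs i \<omega> \<and> Thetas i \<omega> \<in> B)"
      if "e > 0" for e :: real
      by (rule near_product_of_cond1[OF X_rv(2)[OF i1] Theta_rv(2)[OF i1] S_AE[OF i1]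
            cond_ii_exists[OF i, folded S_def] cond_ii[OF i, folded S_def] h pos that])
    show "0 < b x" if "0 \<le> x" for x using that by (rule b_pos)
    show "((\<lambda>x. b x / x) \<longlongrightarrow> 0) at_top" by fact
    show "\<forall>\<^sub>F x in at_top. \<P>(\<omega> in M. b x < Thetas i \<omega>) \<le> e * \<P>(\<omega> in M. x < Thetas i \<omega> * Xs i \<omega>)"
      if e: "e > 0" for e :: real
    proof -
      have j1: "j \<ge> 1" using j by simp
      obtain z where z: "\<And>x y. x \<ge> z \<Longrightarrow> y \<ge> z \<Longrightarrow> \<P>(\<omega> in M. b x < Thetas i \<omega>)
          \<le> e * \<P>(\<omega> in M. x < Thetas i \<omega> * Xs i \<omega> \<and> y < Thetas j \<omega> * Xs j \<omega>)"
        using small[OF i j e] by blast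
      show ?thesis
        using eventually_ge_at_top[of z]
      proof eventually_elim
        case (elim x)
        note [measurable] = X_rv(2)[OF i1] X_rv(2)[OF j1] Theta_rv(2)[OF i1] Theta_rv(2)[OF j1]
        have "\<P>(\<omega> in M. x < Thetas i \<omega> * Xs i \<omega> \<and> x < Thetas j \<omega> * Xs j \<omega>) \<le> \<P>(\<omega> in M. x < Thetas i \<omega> * Xs i \<omega>)"
          by (intro finite_measure_mono) auto
        then have "e * \<P>(\<omega> in M. x < Thetas i \<omega> * Xs i \<omega> \<and> x < Thetas j \<omega> * Xs j \<omega>)
            \<le> e * \<P>(\<omega> in M. x < Thetas i \<omega> * Xs i \<omega>)"
          using e by (intro mult_left_mono) auto
        then show ?case using z[OF elim elim] by linarith
      qed
    qed
    have "\<forall>\<^sub>F r in at_top. 0 < \<P>(\<omega> in M. r < Xs i \<omega> \<and> \<theta>0 / 2 < Thetas i \<omega>)"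
      by (rule joint_positive_of_cond1[OF X_rv(2)[OF i1] Theta_rv(2)[OF i1]
            cond_ii_exists[OF i, folded S_def] cond_ii[OF i, folded S_def] h pos \<theta>0])
    then show "\<exists>t>0. \<forall>\<^sub>F r in at_top. 0 < \<P>(\<omega> in M. r < Xs i \<omega> \<and> t < Thetas i \<omega>)"
      using \<theta>0(2) by (intro exI[of _ "\<theta>0 / 2"]) simp
  qed
  have pair: "weighted_pair M (Xs i) (Thetas i) (Xs j) (Thetas j) b"
    if ij: "i \<in> {1..n}" "j \<in> {1..n}" "i \<noteq> j" for i j
  proof (intro weighted_pair.intro weighted_pair_axioms.intro variable ij)
    have i1: "i \<ge> 1" "j \<ge> 1" using ij by simp_all
    have g: "0 < g \<theta>" if "\<theta> \<in> S \<times> S" for \<theta>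
      using that S_nonneg g_pos[of "fst \<theta>" "snd \<theta>"] by (auto simp: mem_Times_iff)
    note bounds = pair_bound_of_cond2[OF X_rv(2)[OF i1(1)] X_rv(2)[OF i1(2)] Theta_rv(2)[OF i1(1)] Theta_rv(2)[OF i1(2)]
        S_AE[OF i1(1)] S_AE[OF i1(2)] cond_iii_exists[OF ij, folded S_def] cond_iii_equiv[OF ij, folded S_def]
        cond_iii_lower[OF ij, folded S_def] LU(1) g]
    show "prob_space M" by fact
    show "joint_product_bound (Xs i) (Xs j) (Thetas i) (Thetas j) (\<lambda>w \<omega>. w < \<bar>Xs i \<omega>\<bar> \<and> w < Xs j \<omega>)"
      by (rule bounds(1))
    show "joint_product_bound (Xs i) (Xs j) (Thetas i) (Thetas j) (\<lambda>w \<omega>. w < Xs i \<omega> \<and> w < Xs j \<omega>)"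
      if "\<And>x. 0 < \<P>(\<omega> in M. x < Xs i \<omega> \<and> x < Xs j \<omega>)"
      by (rule bounds(2)) (assumption, rule that)
    fix e :: real assume e: "e > 0"
    obtain z1 where z1: "\<And>x y. x \<ge> z1 \<Longrightarrow> y \<ge> z1 \<Longrightarrow> \<P>(\<omega> in M. b x < Thetas i \<omega>)
          \<le> e * \<P>(\<omega> in M. x < Thetas i \<omega> * Xs i \<omega> \<and> y < Thetas j \<omega> * Xs j \<omega>)"
      using small[OF ij e] by blast
    obtain z2 where z2: "\<And>x y. x \<ge> z2 \<Longrightarrow> y \<ge> z2 \<Longrightarrow> \<P>(\<omega> in M. b x < Thetas j \<omega>)
          \<le> e * \<P>(\<omega> in M. x < Thetas j \<omega> * Xs j \<omega> \<and> y < Thetas i \<omega> * Xs i \<omega>)"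
      using small[OF ij(2,1) ij(3)[symmetric] e] by blast
    show "\<exists>z. \<forall>x\<ge>z. \<forall>y\<ge>z.
      \<P>(\<omega> in M. b x < Thetas i \<omega>) \<le> e * \<P>(\<omega> in M. x < Thetas i \<omega> * Xs i \<omega> \<and> y < Thetas j \<omega> * Xs j \<omega>) \<and>
      \<P>(\<omega> in M. b y < Thetas j \<omega>) \<le> e * \<P>(\<omega> in M. x < Thetas i \<omega> * Xs i \<omega> \<and> y < Thetas j \<omega> * Xs j \<omega>)"
    proof (rule exI[of _ "max z1 z2"], intro allI impI conjI)
      fix x y assume xy: "max z1 z2 \<le> x" "max z1 z2 \<le> y"
      then show "\<P>(\<omega> in M. b x < Thetas i \<omega>) \<le> e * \<P>(\<omega> in M. x < Thetas i \<omega> * Xs i \<omega> \<and> y < Thetas j \<omega> * Xs j \<omega>)"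
        by (intro z1) auto
      have "\<P>(\<omega> in M. b y < Thetas j \<omega>) \<le> e * \<P>(\<omega> in M. y < Thetas j \<omega> * Xs j \<omega> \<and> x < Thetas i \<omega> * Xs i \<omega>)"
        using xy by (intro z2) auto
      then show "\<P>(\<omega> in M. b y < Thetas j \<omega>) \<le> e * \<P>(\<omega> in M. x < Thetas i \<omega> * Xs i \<omega> \<and> y < Thetas j \<omega> * Xs j \<omega>)"
        by (simp only: conj_commute)
    qed
  qed
  have F_i: "weighted_variable.F M (Xs i) = F" if "i \<in> {1..n}" for i
    using that by (intro ext) (simp add: weighted_variable.F_def[OF variable[OF that]] Xs_tail)
  have H_i: "weighted_variable.H M (Xs i) (Thetas i) = H" if "i \<in> {1..n}" for i
    using that by (intro ext) (simp add: weighted_variable.H_def[OF variable[OF that]] Y_tail)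
  have one: "1 \<in> {1..n}" using N_bounded(1) by simp
  have H_D: "dominated_tail H"
    using weighted_variable.H_dominated[OF variable[OF one]] F_D unfolding F_i[OF one] H_i[OF one] by blast
  have H_L: "long_tail H"
    using weighted_variable.H_long[OF variable[OF one]] F_D F_L unfolding F_i[OF one] H_i[OF one] by blast
  have H_C: "consistent_tail H" if "distr M borel X \<in> class_C"
    using weighted_variable.H_consistent[OF variable[OF one]] class_C_imp_consistent_tail[OF that]
    unfolding F_i[OF one] H_i[OF one] F_tail by blast
  have H_pos: "H x > 0" for x
    using weighted_variable.H_pos[OF variable[OF one]] F_D unfolding F_i[OF one] H_i[OF one] by blast
  have H_mono: "H y \<le> H x" if "x \<le> y" for x y
    unfolding H_def using that by (intro finite_measure_mono) auto
  have EN: "(LINT \<omega>|M. real (N \<omega>)) > 0"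
  proof -
    have "AE \<omega> in M. \<not> n < N \<omega>" using N_bounded(2) N_rv by (simp add: prob_Collect_eq_0)
    then have "integrable M (\<lambda>\<omega>. real (N \<omega>))"
      using N_rv by (intro integrable_const_bound[where B="real n"]) (auto elim!: eventually_mono)
    then have "(LINT \<omega>|M. real (N \<omega>)) \<noteq> 0"
      using N_nondeg by (subst integral_nonneg_eq_0_iff_AE) auto
    moreover have "(LINT \<omega>|M. real (N \<omega>)) \<ge> 0" by simp
    ultimately show ?thesis by linarith
  qed
  have equiv: "f \<sim>[at_top] f'"
    if "((\<lambda>x. f x / H x) \<longlongrightarrow> (LINT \<omega>|M. real (N \<omega>))) at_top"
      "((\<lambda>x. f' x / H x) \<longlongrightarrow> (LINT \<omega>|M. real (N \<omega>))) at_top" for f f'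
  proof (rule asymp_equivI')
    have "((\<lambda>x. (f x / H x) / (f' x / H x)) \<longlongrightarrow> (LINT \<omega>|M. real (N \<omega>)) / (LINT \<omega>|M. real (N \<omega>))) at_top"
      using EN by (intro tendsto_divide that) simp
    moreover have "(\<lambda>x. (f x / H x) / (f' x / H x)) = (\<lambda>x. f x / f' x)"
    proof
      fix x
      show "(f x / H x) / (f' x / H x) = f x / f' x" using H_pos[of x] by simp
    qed
    moreover have "(LINT \<omega>|M. real (N \<omega>)) / (LINT \<omega>|M. real (N \<omega>)) = 1" using EN by simp
    ultimately show "((\<lambda>x. f x / f' x) \<longlongrightarrow> 1) at_top" by (simp only:)
  qed
  have mean: "((\<lambda>x. (LINT \<omega>|M. real (N \<omega>)) * \<P>(\<omega> in M. x < Theta \<omega> * X \<omega>) / H x)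
      \<longlongrightarrow> (LINT \<omega>|M. real (N \<omega>))) at_top"
  proof -
    have "(LINT \<omega>|M. real (N \<omega>)) * \<P>(\<omega> in M. x < Theta \<omega> * X \<omega>) / H x = (LINT \<omega>|M. real (N \<omega>))" for x
      using H_pos[of x] by (simp add: H_def)
    then show ?thesis by simp
  qed
  have n0: "0 < n" using N_bounded(1) by simp
  have Y_tail': "\<P>(\<omega> in M. x < Thetas i \<omega> * Xs i \<omega>) = H x" if "i \<in> {1..n}" for i x
    using that by (intro Y_tail) simp
  note limits = stopped_ratio_limits[OF N_rv N_bounded(2) N_indep X_rv(2) Theta_rv(2) n0 Y_tail' H_pos]
  have part1: "\<exists>s. \<forall>\<^sub>F x in at_top. 0 < s x \<and> s x \<le> x \<and>
        H (x - s x) \<le> (1 + e) * H x \<and> (1 - e) * H x \<le> H (x + s x) \<and>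
        (\<forall>i\<in>{1..n}. \<forall>j\<in>{1..n}. i \<noteq> j \<longrightarrow>
          \<P>(\<omega> in M. s x / n < \<bar>Thetas i \<omega> * Xs i \<omega>\<bar> \<and> x / n < Thetas j \<omega> * Xs j \<omega>) \<le> e * H x)"
    if pTAI: "pTAI M n Xs" and e: "e > 0" for e
  proof (rule constant_shift[where Y="\<lambda>i \<omega>. Thetas i \<omega> * Xs i \<omega>", OF N_bounded(1) H_pos H_mono H_D H_L _ e])
    fix d :: real and i j assume d: "d > 0" and ij: "i \<in> {1..n}" "j \<in> {1..n}" "i \<noteq> j"
    have X: "\<exists>z. \<forall>x\<ge>z. \<forall>y\<ge>z. \<P>(\<omega> in M. x < \<bar>Xs i \<omega>\<bar> \<and> y < Xs j \<omega>) \<le> c * F y" if c: "c > 0" for c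
    proof -
      have "((\<lambda>(x, y). \<P>(\<omega> in M. x < \<bar>Xs i \<omega>\<bar> \<bar> y < Xs j \<omega>)) \<longlongrightarrow> 0) min_at_top"
        using pTAI ij unfolding pTAI_def by blast
      from order_tendstoD(2)[OF this c] obtain z where z: "\<And>x y. x \<ge> z \<Longrightarrow> y \<ge> z \<Longrightarrow>
          \<P>(\<omega> in M. x < \<bar>Xs i \<omega>\<bar> \<bar> y < Xs j \<omega>) < c"
        by (auto simp: eventually_min_at_top)
      show ?thesis
      proof (rule exI[of _ z], intro allI impI)
        fix x y assume "z \<le> x" "z \<le> y"
        then have "\<P>(\<omega> in M. x < \<bar>Xs i \<omega>\<bar> \<and> y < Xs j \<omega>) / F y < c"
          using z[of x y] Xs_tail[of j y] ij by (simp add: cond_prob_def)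
        then show "\<P>(\<omega> in M. x < \<bar>Xs i \<omega>\<bar> \<and> y < Xs j \<omega>) \<le> c * F y"
          using F_pos[of y] by (simp add: pos_divide_less_eq)
      qed
    qed
    show "\<exists>z. \<forall>x\<ge>z. \<forall>y\<ge>z. \<P>(\<omega> in M. x < \<bar>Thetas i \<omega> * Xs i \<omega>\<bar> \<and> y < Thetas j \<omega> * Xs j \<omega>) \<le> d * H y"
      using weighted_pair.products_pTAI[OF pair[OF ij] _ d] X by (simp add: F_i[OF ij(2)] H_i[OF ij(2)])
  qed
  have part2: "\<exists>s. \<forall>\<^sub>F x in at_top. 0 < s x \<and> s x \<le> x \<and>
        H (x - s x) \<le> (1 + e) * H x \<and> (1 - e) * H x \<le> H (x + s x) \<and>
        (\<forall>i\<in>{1..n}. \<forall>j\<in>{1..n}. i \<noteq> j \<longrightarrow>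
          \<P>(\<omega> in M. s x / n < \<bar>Thetas i \<omega> * Xs i \<omega>\<bar> \<and> x / n < Thetas j \<omega> * Xs j \<omega>) \<le> e * H x)"
    if pQAI: "pQAI M n Xs" and C: "distr M borel X \<in> class_C" and e: "e > 0" for e
  proof (rule proportional_shift[where Y="\<lambda>i \<omega>. Thetas i \<omega> * Xs i \<omega>", OF N_bounded(1) _ H_pos H_mono H_D H_C[OF C] _ e])
    show "(\<lambda>\<omega>. Thetas i \<omega> * Xs i \<omega>) \<in> borel_measurable M" if "i \<in> {1..n}" for i
      using that by (intro borel_measurable_times X_rv Theta_rv) auto
    fix d :: real and i j assume d: "d > 0" and ij: "i \<in> {1..n}" "j \<in> {1..n}" "i \<noteq> j"
    have i1: "i \<ge> 1" "j \<ge> 1" using ij by simp_all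
    have X: "\<forall>\<^sub>F x in at_top. \<P>(\<omega> in M. x < \<bar>Xs i \<omega>\<bar> \<and> x < Xs j \<omega>) \<le> c * F x" if c: "c > 0" for c
    proof -
      have lims: "((\<lambda>x. \<P>(\<omega> in M. x < pos_part (Xs i \<omega>) \<and> x < pos_part (Xs j \<omega>)) / (F x + F x)) \<longlongrightarrow> 0) at_top"
        "((\<lambda>x. \<P>(\<omega> in M. x < neg_part (Xs i \<omega>) \<and> x < Xs j \<omega>) / (F x + F x)) \<longlongrightarrow> 0) at_top"
        using pQAI[unfolded pQAI_def, rule_format, OF ij, unfolded Xs_tail[OF i1(1)] Xs_tail[OF i1(2)]] by blast+
      have c4: "c / 4 > 0" using c by simp
      show ?thesis
        using order_tendstoD(2)[OF lims(1) c4] order_tendstoD(2)[OF lims(2) c4] eventually_ge_at_top[of 0]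
      proof eventually_elim
        case (elim x)
        note [measurable] = X_rv(2)[OF i1(1)] X_rv(2)[OF i1(2)]
        have [measurable]: "pos_part \<in> borel_measurable borel" "neg_part \<in> borel_measurable borel"
          unfolding pos_part_def[abs_def] neg_part_def[abs_def] by measurable
        have "\<P>(\<omega> in M. x < \<bar>Xs i \<omega>\<bar> \<and> x < Xs j \<omega>)
            \<le> \<P>(\<omega> in M. x < pos_part (Xs i \<omega>) \<and> x < pos_part (Xs j \<omega>))
              + \<P>(\<omega> in M. x < neg_part (Xs i \<omega>) \<and> x < Xs j \<omega>)"
          using elim(3)
          by (intro prob_le_add AE_I2) (auto simp: pos_part_def neg_part_def abs_if split: if_splits)
        also have "\<dots> \<le> c / 4 * (F x + F x) + c / 4 * (F x + F x)"
        proof (rule add_mono)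
          have "F x + F x > 0" using F_pos[of x] by simp
          then show "\<P>(\<omega> in M. x < pos_part (Xs i \<omega>) \<and> x < pos_part (Xs j \<omega>)) \<le> c / 4 * (F x + F x)"
            "\<P>(\<omega> in M. x < neg_part (Xs i \<omega>) \<and> x < Xs j \<omega>) \<le> c / 4 * (F x + F x)"
            using elim(1,2) by (simp_all only: pos_divide_less_eq less_imp_le)
        qed
        finally show ?case by simp
      qed
    qed
    show "\<forall>\<^sub>F x in at_top. \<P>(\<omega> in M. x < \<bar>Thetas i \<omega> * Xs i \<omega>\<bar> \<and> x < Thetas j \<omega> * Xs j \<omega>) \<le> d * H x"
      using weighted_pair.products_pQAI[OF pair[OF ij] _ _ _ _ d] X F_D
      by (simp add: F_i[OF ij(1)] H_i[OF ij(1)] F_i[OF ij(2)] H_i[OF ij(2)])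
  qed
  show ?thesis
  proof (rule conjI; rule impI)
    assume pTAI: "pTAI M n Xs"
    note L = limits[OF _ _ _ part1[OF pTAI]]
    have m1: "stopped_sum Thetas Xs N \<in> borel_measurable M" by (rule L(1))
    have l1: "((\<lambda>x. \<P>(\<omega> in M. x < stopped_sum Thetas Xs N \<omega>) / H x) \<longlongrightarrow> (LINT \<omega>|M. real (N \<omega>))) at_top"
      by (rule L(4))
    have m2: "stopped_max_sum Thetas Xs N \<in> borel_measurable M" by (rule L(2))
    have l2: "((\<lambda>x. \<P>(\<omega> in M. x < stopped_max_sum Thetas Xs N \<omega>) / H x) \<longlongrightarrow> (LINT \<omega>|M. real (N \<omega>))) at_top"
      by (rule L(5))
    have m3: "stopped_max Thetas Xs N \<in> borel_measurable M" by (rule L(3))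
    have l3: "((\<lambda>x. \<P>(\<omega> in M. x < stopped_max Thetas Xs N \<omega>) / H x) \<longlongrightarrow> (LINT \<omega>|M. real (N \<omega>))) at_top"
      by (rule L(6))
    show "(\<lambda>x. \<P>(\<omega> in M. stopped_sum Thetas Xs N \<omega> > x))
          \<sim>[at_top] (\<lambda>x. \<P>(\<omega> in M. stopped_max_sum Thetas Xs N \<omega> > x)) \<and>
        (\<lambda>x. \<P>(\<omega> in M. stopped_max_sum Thetas Xs N \<omega> > x))
          \<sim>[at_top] (\<lambda>x. \<P>(\<omega> in M. stopped_max Thetas Xs N \<omega> > x)) \<and>
        (\<lambda>x. \<P>(\<omega> in M. stopped_max Thetas Xs N \<omega> > x))
          \<sim>[at_top] (\<lambda>x. (LINT \<omega>|M. real (N \<omega>)) * \<P>(\<omega> in M. Theta \<omega> * X \<omega> > x)) \<and>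
        distr M borel (stopped_sum Thetas Xs N) \<in> class_D \<inter> class_L \<and>
        distr M borel (stopped_max_sum Thetas Xs N) \<in> class_D \<inter> class_L \<and>
        distr M borel (stopped_max Thetas Xs N) \<in> class_D \<inter> class_L"
      by (intro conjI IntI equiv l1 l2 l3 mean
        distr_class_ratio_limit(1)[OF m1 l1 EN H_pos H_D] distr_class_ratio_limit(2)[OF m1 l1 EN H_pos H_L]
        distr_class_ratio_limit(1)[OF m2 l2 EN H_pos H_D] distr_class_ratio_limit(2)[OF m2 l2 EN H_pos H_L]
        distr_class_ratio_limit(1)[OF m3 l3 EN H_pos H_D] distr_class_ratio_limit(2)[OF m3 l3 EN H_pos H_L])
  next
    assume "pQAI M n Xs \<and> distr M borel X \<in> class_C"
    then have pQAI: "pQAI M n Xs" and C: "distr M borel X \<in> class_C" by auto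
    note L = limits[OF _ _ _ part2[OF pQAI C]]
    have m1: "stopped_sum Thetas Xs N \<in> borel_measurable M" by (rule L(1))
    have l1: "((\<lambda>x. \<P>(\<omega> in M. x < stopped_sum Thetas Xs N \<omega>) / H x) \<longlongrightarrow> (LINT \<omega>|M. real (N \<omega>))) at_top"
      by (rule L(4))
    have m2: "stopped_max_sum Thetas Xs N \<in> borel_measurable M" by (rule L(2))
    have l2: "((\<lambda>x. \<P>(\<omega> in M. x < stopped_max_sum Thetas Xs N \<omega>) / H x) \<longlongrightarrow> (LINT \<omega>|M. real (N \<omega>))) at_top"
      by (rule L(5))
    have m3: "stopped_max Thetas Xs N \<in> borel_measurable M" by (rule L(3))
    have l3: "((\<lambda>x. \<P>(\<omega> in M. x < stopped_max Thetas Xs N \<omega>) / H x) \<longlongrightarrow> (LINT \<omega>|M. real (N \<omega>))) at_top"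
      by (rule L(6))
    show "(\<lambda>x. \<P>(\<omega> in M. stopped_sum Thetas Xs N \<omega> > x))
          \<sim>[at_top] (\<lambda>x. \<P>(\<omega> in M. stopped_max_sum Thetas Xs N \<omega> > x)) \<and>
        (\<lambda>x. \<P>(\<omega> in M. stopped_max_sum Thetas Xs N \<omega> > x))
          \<sim>[at_top] (\<lambda>x. (LINT \<omega>|M. real (N \<omega>)) * \<P>(\<omega> in M. Theta \<omega> * X \<omega> > x)) \<and>
        distr M borel (stopped_sum Thetas Xs N) \<in> class_C \<and>
        distr M borel (stopped_max_sum Thetas Xs N) \<in> class_C"
      by (intro conjI equiv l1 l2 mean
        distr_class_ratio_limit(3)[OF m1 l1 EN H_pos H_C[OF C]] distr_class_ratio_limit(3)[OF m2 l2 EN H_pos H_C[OF C]])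
  qed
qed

end
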